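(* Let $\mathcal{H}$ be the Fock space with orthonormal basis of Fock states $\{|0\rangle,|1\rangle,|2\rangle,\dots\}$, let $\bar{B}_1=\{|\psi\rangle\in\mathcal{H}:\||\psi\rangle\|=1\}$, and fix a target photon number $\bar n\in\{0,1,2,\dots\}$ and real parameters $\theta,\phi$ satisfying Assumption A1: the eigenvalues of $M_g$ and of $M_e$ (defined in the context) are non-degenerate (equivalently, $\pi/\phi$ is not rational). Then for every $\epsilon>0$ and every $C>0$ there exist constants $\delta>0$ and $\bar\alpha>0$ such that, for the closed-loop Markov process described in the context (with Lyapunov function $V=V_\delta$ and control bound $\bar\alpha$), and for every probability measure $\mu$ on $\bar{B}_1$ with $\mathbb{E}_\mu[V]\le C$, the sequence of laws $\Gamma_k(\mu)$ converges to its limit set $\Omega$ (the set of weak-$\ast$ limits of subsequences of $(\Gamma_k(\mu))_k$), and for every $\mu_\infty\in\Omega$: every $|\psi\rangle\in\operatorname{supp}(\mu_\infty)$ is one of the Fock states $|n\rangle$, and $$\mu_\infty(\{|\bar n\rangle\})\ge 1-\epsilon .$$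
   Context: Let $a$ be the annihilation operator, $a|n\rangle=\sqrt{n}\,|n-1\rangle$, $a^\dagger$ its adjoint, and $N=a^\dagger a$ the number operator, $N|n\rangle=n|n\rangle$. For $\alpha\in\mathbb{R}$ let $D_\alpha=\exp(\alpha(a^\dagger-a))$ (unitary displacement operator). Let $M_g=\cos(\theta+N\phi)$ and $M_e=\sin(\theta+N\phi)$, and set $\phi_n=\theta+n\phi$. Lyapunov function: for $\delta>0$ define $V:\bar B_1\to[0,\infty]$ by $$V(|\psi\rangle)=\sum_{n=0}^\infty\sigma_n|\langle\psi|n\rangle|^2+\delta\big(\cos^4\phi_{\bar n}+\sin^4\phi_{\bar n}\big)-\delta\big(\|M_g|\psi\rangle\|^4+\|M_e|\psi\rangle\|^4\big),$$ where $\sigma_{\bar n}=0$; for $n>\bar n$, $\sigma_n=\sum_{k=\bar n+1}^{n}\big(\tfrac1k+\tfrac1{k^2}\big)$; for $1\le n<\bar n$, $\sigma_n=\sum_{k=n+1}^{\bar n}\big(\tfrac1k-\tfrac1{k^2}\big)$; and if $0<\bar n$, $\sigma_0=\tfrac18+\sum_{k=1}^{\bar n}\big(\tfrac1k-\tfrac1{k^2}\big)$. Closed-loop dynamics: given $|\psi_k\rangle\in\bar B_1$, set $|\psi_{k+1/2}\rangle=M_s|\psi_k\rangle/\|M_s|\psi_k\rangle\|$ with probability $\|M_s|\psi_k\rangle\|^2$, for $s\in\{g,e\}$; then $|\psi_{k+1}\rangle=D_{\alpha_k}|\psi_{k+1/2}\rangle$ with feedback $\alpha_k\in\arg\min_{\alpha\in[-\bar\alpha,\bar\alpha]}V(D_\alpha|\psi_{k+1/2}\rangle)$.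 This defines a discrete-time Markov process on $\bar B_1$; $\Gamma_k(\mu)$ denotes the probability distribution of $|\psi_k\rangle$ when $|\psi_0\rangle$ has distribution $\mu$. Weak-$\ast$ convergence: $\mu_n\to\mu$ if $\mathbb{E}_{\mu_n}[f]\to\mathbb{E}_\mu[f]$ for every bounded continuous $f$ on $\bar B_1$ (norm topology).
   Formalization: Fock states are taken up to a global phase (support in vectors e^{iγ}|n⟩, mass of the ray of |n̄⟩), as the literal claim fails by phase covariance; A1 means non-degenerate eigenvalues, which π/φ irrational alone does not give; D_α is given by its normal-ordered Fock matrix elements. *)

theory Defs
  imports "HOL-Probability.Probability"
begin

text \<open>A vector of the Fock space is represented by its coefficient sequence
  psi n = <n|psi> in the Fock basis.\<close>

definition l2norm :: "(nat \<Rightarrow> complex) \<Rightarrow> real" where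
  "l2norm psi = sqrt (\<Sum>n. (cmod (psi n))\<^sup>2)"

definition l2dist :: "(nat \<Rightarrow> complex) \<Rightarrow> (nat \<Rightarrow> complex) \<Rightarrow> real" where
  "l2dist psi phi = l2norm (\<lambda>n. psi n - phi n)"

definition B1 :: "(nat \<Rightarrow> complex) set" where
  "B1 = {psi. summable (\<lambda>n. (cmod (psi n))\<^sup>2) \<and> (\<Sum>n. (cmod (psi n))\<^sup>2) = 1}"

definition fock :: "nat \<Rightarrow> nat \<Rightarrow> complex" where
  "fock n = (\<lambda>m. if m = n then 1 else 0)"

definition l2open_in :: "(nat \<Rightarrow> complex) set \<Rightarrow> bool" where
  "l2open_in U \<longleftrightarrow> U \<subseteq> B1 \<and>
     (\<forall>psi\<in>U. \<exists>e>0. \<forall>phi\<in>B1. l2dist phi psi < e \<longrightarrow> phi \<in> U)"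

definition B1_borel :: "(nat \<Rightarrow> complex) measure" where
  "B1_borel = sigma B1 {U. l2open_in U}"

definition prob_on_B1 :: "(nat \<Rightarrow> complex) measure \<Rightarrow> bool" where
  "prob_on_B1 mu \<longleftrightarrow> prob_space mu \<and> sets mu = sets B1_borel"

definition bcont_B1 :: "((nat \<Rightarrow> complex) \<Rightarrow> real) \<Rightarrow> bool" where
  "bcont_B1 f \<longleftrightarrow> (\<exists>K. \<forall>psi\<in>B1. \<bar>f psi\<bar> \<le> K) \<and>
     (\<forall>psi\<in>B1. \<forall>e>0. \<exists>d>0. \<forall>phi\<in>B1. l2dist phi psi < d \<longrightarrow> \<bar>f phi - f psi\<bar> < e)"

definition weak_conv_B1 :: "(nat \<Rightarrow> (nat \<Rightarrow> complex) measure) \<Rightarrow> (nat \<Rightarrow> complex) measure \<Rightarrow> bool" where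
  "weak_conv_B1 Ms M \<longleftrightarrow>
     (\<forall>f. bcont_B1 f \<longrightarrow> (\<lambda>k. integral\<^sup>L (Ms k) f) \<longlonglongrightarrow> integral\<^sup>L M f)"

definition limit_set :: "(nat \<Rightarrow> (nat \<Rightarrow> complex) measure) \<Rightarrow> (nat \<Rightarrow> complex) measure set" where
  "limit_set Ms = {M. prob_on_B1 M \<and> (\<exists>r. strict_mono r \<and> weak_conv_B1 (Ms \<circ> r) M)}"

definition supp_B1 :: "(nat \<Rightarrow> complex) measure \<Rightarrow> (nat \<Rightarrow> complex) set" where
  "supp_B1 M = {psi\<in>B1. \<forall>e>0. emeasure M {phi\<in>B1. l2dist phi psi < e} > 0}"

text \<open>Measurement operators: b = True is M_g = cos(theta + N phi), b = False is M_e = sin(theta + N phi).\<close>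
definition Mop :: "bool \<Rightarrow> real \<Rightarrow> real \<Rightarrow> (nat \<Rightarrow> complex) \<Rightarrow> nat \<Rightarrow> complex" where
  "Mop b theta ph psi = (\<lambda>n. complex_of_real
      ((if b then cos else sin) (theta + real n * ph)) * psi n)"

text \<open>Fock-basis matrix elements <m|D_alpha|n> of D_alpha = exp(alpha (a^dagger - a)), alpha real,
  in normal-ordered form D_alpha = exp(-alpha^2/2) exp(alpha a^dagger) exp(-alpha a).\<close>
definition Dmat :: "real \<Rightarrow> nat \<Rightarrow> nat \<Rightarrow> real" where
  "Dmat alpha m n = exp (- alpha\<^sup>2 / 2) *
     (\<Sum>k\<le>min m n. sqrt (fact m * fact n) / (fact k * fact (m - k) * fact (n - k))
                    * alpha ^ (m - k) * (- alpha) ^ (n - k))"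

definition Dop :: "real \<Rightarrow> (nat \<Rightarrow> complex) \<Rightarrow> nat \<Rightarrow> complex" where
  "Dop alpha psi = (\<lambda>m. \<Sum>n. complex_of_real (Dmat alpha m n) * psi n)"

definition sigma_coef :: "nat \<Rightarrow> nat \<Rightarrow> real" where
  "sigma_coef nbar n =
     (if n = nbar then 0
      else if nbar < n then (\<Sum>k\<in>{nbar+1..n}. 1 / real k + 1 / (real k)\<^sup>2)
      else if 1 \<le> n then (\<Sum>k\<in>{n+1..nbar}. 1 / real k - 1 / (real k)\<^sup>2)
      else 1/8 + (\<Sum>k\<in>{1..nbar}. 1 / real k - 1 / (real k)\<^sup>2))"

definition Vlyap :: "nat \<Rightarrow> real \<Rightarrow> real \<Rightarrow> real \<Rightarrow> (nat \<Rightarrow> complex) \<Rightarrow> ereal" where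
  "Vlyap nbar theta ph delta psi =
     (\<Sum>n. ereal (sigma_coef nbar n * (cmod (psi n))\<^sup>2))
     + ereal (delta * ((cos (theta + real nbar * ph)) ^ 4 + (sin (theta + real nbar * ph)) ^ 4))
     - ereal (delta * ((l2norm (Mop True theta ph psi)) ^ 4 + (l2norm (Mop False theta ph psi)) ^ 4))"

definition argmin_set :: "nat \<Rightarrow> real \<Rightarrow> real \<Rightarrow> real \<Rightarrow> real \<Rightarrow> (nat \<Rightarrow> complex) \<Rightarrow> real set" where
  "argmin_set nbar theta ph delta abar psi =
     {a\<in>{-abar..abar}. \<forall>b\<in>{-abar..abar}.
        Vlyap nbar theta ph delta (Dop a psi) \<le> Vlyap nbar theta ph delta (Dop b psi)}"

text \<open>Probability of outcome b, and the post-measurement state (set to psi itself when the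
  outcome has probability 0; this branch is then irrelevant).\<close>
definition pout :: "bool \<Rightarrow> real \<Rightarrow> real \<Rightarrow> (nat \<Rightarrow> complex) \<Rightarrow> real" where
  "pout b theta ph psi = (l2norm (Mop b theta ph psi))\<^sup>2"

definition halfstep :: "bool \<Rightarrow> real \<Rightarrow> real \<Rightarrow> (nat \<Rightarrow> complex) \<Rightarrow> nat \<Rightarrow> complex" where
  "halfstep b theta ph psi =
     (if l2norm (Mop b theta ph psi) = 0 then psi
      else (\<lambda>n. Mop b theta ph psi n / complex_of_real (l2norm (Mop b theta ph psi))))"

definition fullstep :: "bool \<Rightarrow> real \<Rightarrow> real \<Rightarrow> ((nat \<Rightarrow> complex) \<Rightarrow> real) \<Rightarrow> (nat \<Rightarrow> complex) \<Rightarrow> nat \<Rightarrow> complex" where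
  "fullstep b theta ph fb psi = Dop (fb (halfstep b theta ph psi)) (halfstep b theta ph psi)"

definition Gstep :: "real \<Rightarrow> real \<Rightarrow> ((nat \<Rightarrow> complex) \<Rightarrow> real) \<Rightarrow> (nat \<Rightarrow> complex) measure \<Rightarrow> (nat \<Rightarrow> complex) measure" where
  "Gstep theta ph fb mu = measure_of B1 (sets B1_borel)
     (\<lambda>A. \<integral>\<^sup>+ psi. ennreal (pout True theta ph psi) * indicator A (fullstep True theta ph fb psi)
               + ennreal (pout False theta ph psi) * indicator A (fullstep False theta ph fb psi) \<partial>mu)"

definition Gamma :: "real \<Rightarrow> real \<Rightarrow> ((nat \<Rightarrow> complex) \<Rightarrow> real) \<Rightarrow> nat \<Rightarrow> (nat \<Rightarrow> complex) measure \<Rightarrow> (nat \<Rightarrow> complex) measure" where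
  "Gamma theta ph fb k mu = (Gstep theta ph fb ^^ k) mu"

definition A1 :: "real \<Rightarrow> real \<Rightarrow> bool" where
  "A1 theta ph \<longleftrightarrow> (\<forall>m n. m \<noteq> n \<longrightarrow>
      cos (theta + real m * ph) \<noteq> cos (theta + real n * ph) \<and>
      sin (theta + real m * ph) \<noteq> sin (theta + real n * ph))"

end

theory Submission
  imports Defs
begin

text \<open>
  The weights \<open>\<sigma>\<^sub>n\<close> are chosen so that the energy \<open>\<Sum>\<sigma>\<^sub>n|\<psi>\<^sub>n|\<^sup>2\<close> has negative second variation along
  \<open>D\<^sub>\<alpha>\<close> at every Fock state but the target, and so that its commutator with the generator
  \<open>a\<^sup>\<dagger> - a\<close> is a bounded operator. Hence for small \<open>\<delta>\<close> the optimal feedback decreases \<open>V\<close> by a fixed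
  amount in a norm neighbourhood of each \<open>|n\<rangle>\<close>, \<open>n \<le> N\<close>, \<open>n \<noteq> nbar\<close>, although \<open>V\<close> itself is unbounded
  there; any bound on \<open>\<alpha>\<close> will do and we take 1. The measurement preserves the mean energy and decreases
  the mean of the remaining part of \<open>V\<close> by at least \<open>8\<delta> Var(cos\<^sup>2\<phi>\<^sub>n)\<^sup>2\<close>, with the variance taken
  for the photon number distribution of the state. Since \<open>E V\<close> stays bounded, both decrements tend
  to 0 in mean: the laws concentrate on Fock states (on which alone the variance vanishes, by A1) and
  leave the unstable ones up to \<open>N\<close>, while the mass beyond \<open>N\<close> is at most \<open>E V / \<sigma>\<^sub>N\<close>, which tends
  to 0 because \<open>\<sigma>\<^sub>n\<close> grows like \<open>ln n\<close>.\<close>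

text \<open>A general state has infinite energy and lies outside the domain of
  \<open>a^dagger - a\<close>, so \<open>V\<close> cannot be expanded along the displacement of such
  a state. What rescues the expansion is the logarithmic growth of the weights: the commutator of
  energy and generator has entries of order \<open>1 / sqrt m\<close>, so its quadratic form is
  continuous in norm, and the drop found at |n> persists for all nearby states once the weights are
  cut off at a level M, with bounds that do not depend on M. Near |n> both the energy gain and the
  change of the \<delta>-term are of second order in \<alpha>, which fixes a threshold for \<delta>
  at each level. Only finitely many thresholds can be met, so the cutoff N must precede \<delta>.
  This is not circular: as long as \<delta> \<le> 1, passing from \<open>V\<close> to its
  nonnegative shift costs at most 1, and N can be chosen from eps and \<open>C + 1\<close>. Limit
  laws would follow from Prokhorov's theorem on the sphere. Since all mass gathers at countably many
  circles, one real parameter is enough and Helly's selection on the line replaces it.\<close>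

abbreviation pr :: "(nat \<Rightarrow> complex) \<Rightarrow> nat \<Rightarrow> real" where
  "pr psi n \<equiv> (cmod (psi n))^2"

section \<open>The matrix of the displacement operator\<close>

text \<open>Up to the Gaussian factor, the matrix of \<open>D_\<alpha>\<close> between the
  unnormalised vectors \<open>(a^dagger)^n |0>\<close>. Binomials in place of quotients of
  factorials make all summands with \<open>k > n\<close> vanish, so the range of summation can be
  enlarged freely in the recurrences.\<close>

definition hmat :: "real \<Rightarrow> nat \<Rightarrow> nat \<Rightarrow> real" where
  "hmat a m n = (\<Sum>k\<le>m. of_nat (m choose k) * of_nat (n choose k) * fact k * a ^ (m - k) * (- a) ^ (n - k))"

lemma hmat_upper:
  assumes "m \<le> K \<or> n \<le> K"
  shows "hmat a m n = (\<Sum>k\<le>K. of_nat (m choose k) * of_nat (n choose k) * fact k * a ^ (m - k) * (- a) ^ (n - k))"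
proof (cases "m \<le> K")
  case True
  then show ?thesis unfolding hmat_def by (intro sum.mono_neutral_left) auto
next
  case False
  then show ?thesis unfolding hmat_def using assms by (intro sum.mono_neutral_right) auto
qed

lemma hmat_transpose: "hmat a m n = hmat (-a) n m"
  unfolding hmat_upper[of m "max m n" n a, simplified] hmat_upper[of n "max m n" m "-a", simplified]
  by (intro sum.cong) auto

text \<open>Pascal's rule in \<open>m\<close> splits the sum. One half is \<open>a\<close> times the
  old entry; the other is shifted by one in \<open>k\<close> and absorbed by
  \<open>k (n choose k) = n ((n-1) choose (k-1))\<close>. At \<open>n = 0\<close> the truncated
  \<open>n - 1\<close> is harmless because of the factor \<open>n\<close>.\<close>

lemma hmat_Suc: "hmat a (Suc m) n = a * hmat a m n + of_nat n * hmat a m (n - 1)"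
proof -
  let ?t = "\<lambda>c k. of_nat c * of_nat (n choose k) * fact k * a ^ (Suc m - k) * (- a) ^ (n - k) :: real"
  have "hmat a (Suc m) n = (\<Sum>k\<le>Suc m. ?t (Suc m choose k) k)"
    by (simp add: hmat_def)
  also have "\<dots> = ?t 1 0 + (\<Sum>k\<le>m. ?t (Suc m choose Suc k) (Suc k))"
    by (subst sum.atMost_Suc_shift) simp
  also have "(\<Sum>k\<le>m. ?t (Suc m choose Suc k) (Suc k)) = (\<Sum>k\<le>m. ?t (m choose k) (Suc k)) + (\<Sum>k\<le>m. ?t (m choose Suc k) (Suc k))"
    by (simp add: sum.distrib [symmetric] algebra_simps)
  also have "?t 1 0 + ((\<Sum>k\<le>m. ?t (m choose k) (Suc k)) + (\<Sum>k\<le>m. ?t (m choose Suc k) (Suc k)))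
      = (\<Sum>k\<le>m. ?t (m choose k) (Suc k)) + (\<Sum>k\<le>Suc m. ?t (m choose k) k)"
    unfolding sum.atMost_Suc_shift[of "\<lambda>k. ?t (m choose k) k" m] by simp
  also have "(\<Sum>k\<le>Suc m. ?t (m choose k) k) = (\<Sum>k\<le>m. ?t (m choose k) k)" by simp
  also have "\<dots> = a * hmat a m n"
    unfolding hmat_def sum_distrib_left by (intro sum.cong) (auto simp: Suc_diff_le)
  also have "(\<Sum>k\<le>m. ?t (m choose k) (Suc k)) = of_nat n * hmat a m (n - 1)"
    unfolding hmat_def sum_distrib_left
  proof (intro sum.cong refl)
    fix k
    have "Suc k * (n choose Suc k) = n * ((n - 1) choose k)"
      by (cases n) (auto simp only: Suc_times_binomial binomial_0_Suc mult_0 mult_0_right diff_Suc_1)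
    then have e: "real (n choose Suc k) * real (Suc k) = real n * real ((n - 1) choose k)"
      by (metis mult.commute of_nat_mult)
    have "?t (m choose k) (Suc k) = (real (n choose Suc k) * real (Suc k)) * (real (m choose k) * fact k * a ^ (m - k) * (- a) ^ (n - Suc k))"
      by (simp add: algebra_simps)
    then show "?t (m choose k) (Suc k) = of_nat n * (of_nat (m choose k) * of_nat ((n - 1) choose k) * fact k * a ^ (m - k) * (- a) ^ (n - 1 - k))"
      unfolding e by (simp add: algebra_simps)
  qed
  finally show ?thesis by simp
qed

lemma binomial_absorb_diff: "of_nat (m choose k) * of_nat (m - k) = (of_nat m * of_nat ((m - 1) choose k) :: real)"
  by (metis binomial_absorb_comp mult.commute of_nat_mult)

lemma hmat_deriv:
  "((\<lambda>a. hmat a m n) has_real_derivative (of_nat m * hmat a (m - 1) n - of_nat n * hmat a m (n - 1))) (at a)"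
proof -
  let ?c = "\<lambda>k. of_nat (m choose k) * of_nat (n choose k) * fact k :: real"
  let ?e = "\<lambda>k. ?c k * (real (m - k) * a ^ (m - k - 1) * (-a) ^ (n - k) - real (n - k) * a ^ (m - k) * (-a) ^ (n - k - 1))"
  let ?r = "\<lambda>k. real m * (of_nat ((m - 1) choose k) * of_nat (n choose k) * fact k * a ^ (m - 1 - k) * (- a) ^ (n - k))"
  let ?s = "\<lambda>k. real n * (of_nat (m choose k) * of_nat ((n-1) choose k) * fact k * a ^ (m - k) * (- a) ^ (n - 1 - k))"
  have "((\<lambda>a. hmat a m n) has_real_derivative
     (\<Sum>k\<le>m. ?e k)) (at a)"
    unfolding hmat_def
    by (auto intro!: derivative_eq_intros sum.cong simp: algebra_simps)
  also have "(\<Sum>k\<le>m. ?e k)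
    = (\<Sum>k\<le>m. ?r k)
    - (\<Sum>k\<le>m. ?s k)"
    unfolding sum_subtractf [symmetric]
  proof (intro sum.cong refl)
    fix k
    have "?e k
      = (real (m choose k) * real (m - k)) * (real (n choose k) * fact k * a ^ (m - k - 1) * (-a) ^ (n - k))
      - (real (n choose k) * real (n - k)) * (real (m choose k) * fact k * a ^ (m - k) * (-a) ^ (n - k - 1))"
      by (simp only: algebra_simps)
    then show "?e k
     = ?r k
     - ?s k"
      unfolding binomial_absorb_diff by (simp add: diff_commute algebra_simps)
  qed
  also have "\<dots> = of_nat m * hmat a (m - 1) n - of_nat n * hmat a m (n - 1)"
    by (simp only: sum_distrib_left hmat_upper[of "m - 1" m n a, OF disjI1, OF diff_le_self] hmat_upper[of m m "n - 1" a, OF disjI1, OF order_refl])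
  finally show ?thesis .
qed

lemma Dmat_hmat: "Dmat a m n = exp (- a\<^sup>2 / 2) * hmat a m n / sqrt (fact m * fact n)"
proof -
  have "(\<Sum>k\<le>min m n. sqrt (fact m * fact n) / (fact k * fact (m - k) * fact (n - k))
                    * a ^ (m - k) * (- a) ^ (n - k)) = hmat a m n / sqrt (fact m * fact n)"
    unfolding hmat_upper[of m "min m n" n, simplified, OF linear] sum_divide_distrib
  proof (intro sum.cong refl)
    fix k assume k: "k \<in> {..min m n}"
    have s: "sqrt (fact m * fact n) = (fact m * fact n) / sqrt (fact m * fact n)"
      by (simp add: real_div_sqrt)
    have "sqrt (fact m * fact n) / (fact k * fact (m - k) * fact (n - k)) =
       real (m choose k) * real (n choose k) * fact k / sqrt (fact m * fact n)"
      using k by (subst s) (simp add: binomial_fact)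
    then show "sqrt (fact m * fact n) / (fact k * fact (m - k) * fact (n - k)) * a ^ (m - k) * (- a) ^ (n - k)
      = real (m choose k) * real (n choose k) * fact k * a ^ (m - k) * (- a) ^ (n - k) / sqrt (fact m * fact n)"
      by simp
  qed
  then show ?thesis by (simp add: Dmat_def)
qed

lemma Dmat_transpose: "Dmat a m n = Dmat (-a) n m"
  by (simp add: Dmat_hmat hmat_transpose[of a m n] mult.commute)

text \<open>Matrix form of \<open>a D_\<alpha> = D_\<alpha> (a + \<alpha>)\<close>. Transposition
  turns it into the column version
  \<open>D_\<alpha> a^dagger = (a^dagger - \<alpha>) D_\<alpha>\<close>.\<close>

lemma Dmat_Suc_row: "sqrt (real (Suc m)) * Dmat a (Suc m) n = a * Dmat a m n + sqrt (real n) * Dmat a m (n - 1)"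
proof -
  have 1: "sqrt (real (Suc m)) / sqrt (fact (Suc m) * fact n) = 1 / sqrt (fact m * fact n)"
    by (simp add: real_sqrt_mult del: of_nat_Suc)
  have 2: "real n / sqrt (fact m * fact n) = sqrt (real n) / sqrt (fact m * fact (n - 1))"
    by (cases n) (auto simp: real_sqrt_mult real_div_sqrt divide_simps simp del: of_nat_Suc)
  have "sqrt (real (Suc m)) * Dmat a (Suc m) n
    = exp (- a\<^sup>2 / 2) * hmat a (Suc m) n * (sqrt (real (Suc m)) / sqrt (fact (Suc m) * fact n))"
    by (simp add: Dmat_hmat)
  also have "\<dots> = a * (exp (- a\<^sup>2 / 2) * hmat a m n / sqrt (fact m * fact n))
     + exp (- a\<^sup>2 / 2) * hmat a m (n - 1) * (real n / sqrt (fact m * fact n))"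
    unfolding 1 hmat_Suc by (simp add: algebra_simps add_divide_distrib)
  also have "\<dots> = a * Dmat a m n + sqrt (real n) * Dmat a m (n - 1)"
    unfolding 2 by (simp add: Dmat_hmat)
  finally show ?thesis .
qed

lemma Dmat_Suc_col: "sqrt (real (Suc n)) * Dmat a m (Suc n) = sqrt (real m) * Dmat a (m - 1) n - a * Dmat a m n"
  using Dmat_Suc_row[of n "-a" m] by (simp add: Dmat_transpose[of a])

text \<open>The flow equation of the generator \<open>a^dagger - a\<close>, entry by entry. It ties
  the normal-ordered formula to the exponential; the derivative of the Gaussian factor is absorbed
  by the row recurrence.\<close>

lemma Dmat_deriv:
  "((\<lambda>a. Dmat a m n) has_real_derivative (sqrt (real m) * Dmat a (m - 1) n - sqrt (real (Suc m)) * Dmat a (Suc m) n)) (at a)"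
proof -
  have 1: "real m / sqrt (fact m * fact n) = sqrt (real m) / sqrt (fact (m - 1) * fact n)"
    by (cases m) (auto simp: real_sqrt_mult real_div_sqrt divide_simps simp del: of_nat_Suc)
  have 2: "real n / sqrt (fact m * fact n) = sqrt (real n) / sqrt (fact m * fact (n - 1))"
    by (cases n) (auto simp: real_sqrt_mult real_div_sqrt divide_simps simp del: of_nat_Suc)
  have "((\<lambda>a. Dmat a m n) has_real_derivative
     (- a * exp (- a\<^sup>2 / 2) * hmat a m n + exp (- a\<^sup>2 / 2) * (of_nat m * hmat a (m - 1) n - of_nat n * hmat a m (n - 1))) / sqrt (fact m * fact n)) (at a)"
    unfolding Dmat_hmat
  proof (rule DERIV_cdivide)
    show "((\<lambda>a. exp (- a\<^sup>2 / 2) * hmat a m n) has_real_derivative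
       - a * exp (- a\<^sup>2 / 2) * hmat a m n + exp (- a\<^sup>2 / 2) * (of_nat m * hmat a (m - 1) n - of_nat n * hmat a m (n - 1))) (at a)"
      by (rule derivative_eq_intros hmat_deriv refl | simp)+
  qed
  also have "(- a * exp (- a\<^sup>2 / 2) * hmat a m n + exp (- a\<^sup>2 / 2) * (of_nat m * hmat a (m - 1) n - of_nat n * hmat a m (n - 1))) / sqrt (fact m * fact n)
    = - a * Dmat a m n + exp (- a\<^sup>2 / 2) * hmat a (m-1) n * (real m / sqrt (fact m * fact n)) - exp (- a\<^sup>2 / 2) * hmat a m (n-1) * (real n / sqrt (fact m * fact n))"
    by (simp add: Dmat_hmat algebra_simps add_divide_distrib diff_divide_distrib)
  also have "\<dots> = - a * Dmat a m n + sqrt (real m) * Dmat a (m - 1) n - sqrt (real n) * Dmat a m (n - 1)"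
    unfolding 1 2 by (simp add: Dmat_hmat mult_ac)
  also have "\<dots> = sqrt (real m) * Dmat a (m - 1) n - sqrt (real (Suc m)) * Dmat a (Suc m) n"
    unfolding Dmat_Suc_row by simp
  finally show ?thesis .
qed

section \<open>Initial values, decay and orthonormality of the columns\<close>

lemma Dmat_0: "Dmat 0 m n = (if m = n then 1 else 0)"
proof -
  have "hmat 0 m n = (\<Sum>k\<le>m. if k = m then (if m = n then fact m else 0) else 0)"
    unfolding hmat_def by (intro sum.cong) (auto simp: power_0_left)
  then show ?thesis by (auto simp: Dmat_hmat)
qed

lemma Dmat_col_0: "Dmat a m 0 = exp (- a\<^sup>2 / 2) * a ^ m / sqrt (fact m)"
proof -
  have "hmat a m 0 = a ^ m" using hmat_upper[of m 0 0 a] by simp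
  then show ?thesis by (simp add: Dmat_hmat)
qed

text \<open>Induction over the columns by \<open>Dmat_Suc_col\<close>. Each of its two terms is at
  most \<open>K (2r)^m / sqrt (m!)\<close>: the factor \<open>sqrt m\<close> becomes
  \<open>m\<close> once the factorial is adjusted, and \<open>2^m\<close> absorbs it. This decay
  beats every geometric growth and justifies the later exchanges of limits.\<close>

lemma Dmat_col_bound:
  "\<exists>K r. 0 \<le> K \<and> 1 \<le> r \<and> (\<forall>a m. \<bar>a\<bar> \<le> 1 \<longrightarrow> \<bar>Dmat a m n\<bar> \<le> K * r ^ m / sqrt (fact m))"
proof (induction n)
  case 0
  have "\<bar>Dmat a m 0\<bar> \<le> 1 * 1 ^ m / sqrt (fact m)" if "\<bar>a\<bar> \<le> 1" for a m
  proof -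
    have "exp (- a\<^sup>2 / 2) * \<bar>a\<bar> ^ m \<le> 1 * 1"
      using that by (intro mult_mono) (auto simp: power_le_one)
    then show ?thesis by (simp add: Dmat_col_0 abs_mult power_abs divide_right_mono)
  qed
  then show ?case by (intro exI[of _ 1] exI[of _ 1]) auto
next
  case (Suc n)
  then obtain K r where K: "0 \<le> K" "1 \<le> r"
    and b: "\<And>a m. \<bar>a\<bar> \<le> 1 \<Longrightarrow> \<bar>Dmat a m n\<bar> \<le> K * r ^ m / sqrt (fact m)" by blast
  have "\<bar>Dmat a m (Suc n)\<bar> \<le> (2 * K) * (2 * r) ^ m / sqrt (fact m)" if a: "\<bar>a\<bar> \<le> 1" for a m
  proof -
    have 1: "sqrt (real m) * \<bar>Dmat a (m - 1) n\<bar> \<le> K * (2 * r) ^ m / sqrt (fact m)"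
    proof (cases m)
      case (Suc j)
      have "sqrt (real m) * \<bar>Dmat a (m - 1) n\<bar> \<le> sqrt (real m) * (K * r ^ j / sqrt (fact j))"
        using b[OF a, of j] Suc by (intro mult_left_mono) auto
      also have "\<dots> = K * (real m * r ^ j) / sqrt (fact m)"
        using Suc by (simp add: real_sqrt_mult field_simps del: of_nat_Suc)
      also have "real m * r ^ j \<le> 2 ^ m * r ^ m"
        using K Suc by (intro mult_mono power_increasing) (auto intro: less_imp_le[OF of_nat_less_two_power] simp del: of_nat_Suc power_Suc)
      then have "K * (real m * r ^ j) / sqrt (fact m) \<le> K * (2 ^ m * r ^ m) / sqrt (fact m)"
        using K by (intro divide_right_mono mult_left_mono) auto
      finally show ?thesis by (simp add: power_mult_distrib)
    qed (use K in auto)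
    have 2: "\<bar>a * Dmat a m n\<bar> \<le> K * (2 * r) ^ m / sqrt (fact m)"
    proof -
      have "\<bar>a * Dmat a m n\<bar> \<le> 1 * (K * r ^ m / sqrt (fact m))"
        unfolding abs_mult using b[OF a] a by (intro mult_mono) auto
      also have "1 * (K * r ^ m / sqrt (fact m)) \<le> K * (2 * r) ^ m / sqrt (fact m)"
        using K by (auto intro!: divide_right_mono mult_left_mono power_mono)
      finally show ?thesis .
    qed
    have "\<bar>Dmat a m (Suc n)\<bar> \<le> sqrt (real (Suc n)) * \<bar>Dmat a m (Suc n)\<bar>"
      using mult_right_mono[of 1 "sqrt (real (Suc n))" "\<bar>Dmat a m (Suc n)\<bar>"] by simp
    also have "\<dots> = \<bar>sqrt (real (Suc n)) * Dmat a m (Suc n)\<bar>" by (simp add: abs_mult)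
    also have "\<dots> \<le> sqrt (real m) * \<bar>Dmat a (m - 1) n\<bar> + \<bar>a * Dmat a m n\<bar>"
      unfolding Dmat_Suc_col by (rule order_trans[OF abs_triangle_ineq4]) (simp add: abs_mult)
    finally show ?thesis using 1 2 by simp
  qed
  then show ?case using K by (intro exI[of _ "2*K"] exI[of _ "2*r"]) auto
qed

lemma Dmat_row_bound:
  "\<exists>K r. 0 \<le> K \<and> 1 \<le> r \<and> (\<forall>a n. \<bar>a\<bar> \<le> 1 \<longrightarrow> \<bar>Dmat a m n\<bar> \<le> K * r ^ n / sqrt (fact n))"
proof -
  obtain K r where "0 \<le> K" "1 \<le> r" "\<And>a n. \<bar>a\<bar> \<le> 1 \<Longrightarrow> \<bar>Dmat a n m\<bar> \<le> K * r ^ n / sqrt (fact n)"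
    using Dmat_col_bound[of m] by blast
  then have "\<bar>Dmat a m n\<bar> \<le> K * r ^ n / sqrt (fact n)" if "\<bar>a\<bar> \<le> 1" for a n
    unfolding Dmat_transpose[of a m n] using that by simp
  with \<open>0 \<le> K\<close> \<open>1 \<le> r\<close> show ?thesis by blast
qed

lemma summable_power_over_fact: "summable (\<lambda>n. (r::real) ^ n / fact n)"
  using summable_exp[of r] by (simp add: field_simps)

text \<open>The root of the factorial is removed by \<open>2uv \<le> u^2 + v^2\<close> with
  \<open>u = (1/2)^n\<close> and \<open>v = (2r)^n / sqrt (n!)\<close>, which leaves a geometric and
  an exponential series.\<close>

lemma summable_power_over_sqrt_fact:
  assumes "0 \<le> (r::real)" shows "summable (\<lambda>n. r ^ n / sqrt (fact n))"
proof (rule summable_comparison_test')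
  show "summable (\<lambda>n. (1/4) ^ n + (4 * r\<^sup>2) ^ n / fact n)"
    by (intro summable_add summable_power_over_fact summable_geometric) auto
  fix n :: nat
  have "2 * ((1/2) ^ n) * ((2*r) ^ n / sqrt (fact n)) \<le> ((1/2) ^ n)^2 + ((2*r) ^ n / sqrt (fact n))^2"
    by (rule sum_squares_bound)
  also have "\<dots> = (1/4) ^ n + (4 * r\<^sup>2) ^ n / fact n"
  proof -
    have "((x::real) ^ n)^2 = (x\<^sup>2) ^ n" for x by (simp add: power_mult[symmetric] mult.commute)
    then show ?thesis by (simp add: power_divide power_mult_distrib[of _ r] power_mult_distrib[of "2^n::real" "r^n"] power_mult_distrib[of _ "r\<^sup>2"])
  qed
  also have "2 * ((1/2) ^ n) * ((2*r) ^ n / sqrt (fact n)) = 2 * (r ^ n / sqrt (fact n))"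
    by (simp add: power_mult_distrib power_divide)
  finally have "2 * (r ^ n / sqrt (fact n)) \<le> (1/4) ^ n + (4 * r\<^sup>2) ^ n / fact n" .
  moreover have "0 \<le> r ^ n / sqrt (fact n)" using assms by simp
  ultimately show "norm (r ^ n / sqrt (fact n)) \<le> (1/4) ^ n + (4 * r\<^sup>2) ^ n / fact n"
    unfolding real_norm_def by linarith
qed

lemma summable_Dmat_col_prod:
  assumes "\<bar>a\<bar> \<le> 1"
  shows "summable (\<lambda>m. \<bar>Dmat a m n\<bar> * \<bar>Dmat a m n'\<bar>)"
    and "summable (\<lambda>m. sqrt (real (Suc m)) * (\<bar>Dmat a m n\<bar> * \<bar>Dmat a (Suc m) n'\<bar>))"
proof -
  obtain K r where K: "0 \<le> K" "1 \<le> r"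
    and b: "\<And>m. \<bar>Dmat a m n\<bar> \<le> K * r ^ m / sqrt (fact m)" using Dmat_col_bound[of n] assms by blast
  obtain K' r' where K': "0 \<le> K'" "1 \<le> r'"
    and b': "\<And>m. \<bar>Dmat a m n'\<bar> \<le> K' * r' ^ m / sqrt (fact m)" using Dmat_col_bound[of n'] assms by blast
  show "summable (\<lambda>m. \<bar>Dmat a m n\<bar> * \<bar>Dmat a m n'\<bar>)"
  proof (rule summable_comparison_test')
    show "summable (\<lambda>m. (K * K') * ((r * r') ^ m / fact m))"
      by (intro summable_mult summable_power_over_fact)
    fix m :: nat
    have "\<bar>Dmat a m n\<bar> * \<bar>Dmat a m n'\<bar> \<le> (K * r ^ m / sqrt (fact m)) * (K' * r' ^ m / sqrt (fact m))"
      using K K' b b' by (intro mult_mono) auto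
    then show "norm (\<bar>Dmat a m n\<bar> * \<bar>Dmat a m n'\<bar>) \<le> (K * K') * ((r * r') ^ m / fact m)"
      by (simp add: power_mult_distrib field_simps)
  qed
  show "summable (\<lambda>m. sqrt (real (Suc m)) * (\<bar>Dmat a m n\<bar> * \<bar>Dmat a (Suc m) n'\<bar>))"
  proof (rule summable_comparison_test')
    show "summable (\<lambda>m. (K * K' * r') * ((r * r') ^ m / fact m))"
      by (intro summable_mult summable_power_over_fact)
    fix m :: nat
    have "sqrt (real (Suc m)) * (\<bar>Dmat a m n\<bar> * \<bar>Dmat a (Suc m) n'\<bar>)
       \<le> sqrt (real (Suc m)) * ((K * r ^ m / sqrt (fact m)) * (K' * r' ^ Suc m / sqrt (fact (Suc m))))"
      using K K' b[of m] b'[of "Suc m"] by (intro mult_left_mono mult_mono) auto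
    also have "\<dots> = (K * K' * r') * ((r * r') ^ m / fact m)"
      by (simp add: power_mult_distrib real_sqrt_mult field_simps del: of_nat_Suc)
    finally show "norm (sqrt (real (Suc m)) * (\<bar>Dmat a m n\<bar> * \<bar>Dmat a (Suc m) n'\<bar>)) \<le> (K * K' * r') * ((r * r') ^ m / fact m)"
      by simp
  qed
qed

text \<open>The commutation relations give a recursion for the Gram matrix \<open>G\<close> that
  lowers both indices at once; with symmetry and \<open>G 0 0 = 1\<close> it leaves only the
  identity. The value at the origin is the normalisation of a Poisson distribution.\<close>

lemma Dmat_col_orthonormal:
  assumes "\<bar>a\<bar> \<le> 1"
  shows "(\<lambda>m. Dmat a m n * Dmat a m n') sums (if n = n' then 1 else 0)"
proof -
  define G where "G n n' = (\<Sum>m. Dmat a m n * Dmat a m n')" for n n'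
  have s: "summable (\<lambda>m. Dmat a m n * Dmat a m n')" for n n'
    using summable_Dmat_col_prod(1)[OF assms, of n n']
    by (auto intro: summable_rabs_cancel simp: abs_mult)
  have s2: "summable (\<lambda>m. sqrt (real (Suc m)) * (Dmat a m n * Dmat a (Suc m) n'))" for n n'
    using summable_Dmat_col_prod(2)[OF assms, of n n']
    by (auto intro: summable_rabs_cancel simp: abs_mult)
  \<comment> \<open>\<open>(a\<^sup>\<dagger> - \<alpha>)\<close> raises the columns and its adjoint \<open>(a - \<alpha>)\<close> lowers them.\<close>
  have rec: "sqrt (real (Suc n)) * G n' (Suc n) = sqrt (real n') * G (n' - 1) n" for n n'
  proof -
    have "(\<lambda>m. sqrt (real m) * (Dmat a (m - 1) n * Dmat a m n')) sums (\<Sum>m. sqrt (real (Suc m)) * (Dmat a m n * Dmat a (Suc m) n'))"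
      (is "_ sums ?J")
      using s2[of n n', THEN summable_sums] sums_Suc_iff[of "\<lambda>m. sqrt (real m) * (Dmat a (m - 1) n * Dmat a m n')" ?J] by simp
    then have "(\<lambda>m. sqrt (real m) * (Dmat a (m - 1) n * Dmat a m n') - a * (Dmat a m n * Dmat a m n')) sums (?J - a * G n n')"
      unfolding G_def by (intro sums_diff sums_mult summable_sums s)
    also have "(\<lambda>m. sqrt (real m) * (Dmat a (m - 1) n * Dmat a m n') - a * (Dmat a m n * Dmat a m n'))
      = (\<lambda>m. (sqrt (real (Suc n)) * Dmat a m (Suc n)) * Dmat a m n')"
      unfolding Dmat_Suc_col by (simp add: algebra_simps)
    finally have 1: "(\<lambda>m. (sqrt (real (Suc n)) * Dmat a m (Suc n)) * Dmat a m n') sums (?J - a * G n n')" .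
    have "(\<lambda>m. sqrt (real (Suc n)) * (Dmat a m n' * Dmat a m (Suc n))) sums (sqrt (real (Suc n)) * G n' (Suc n))"
      unfolding G_def by (intro sums_mult summable_sums s)
    then have 2: "sqrt (real (Suc n)) * G n' (Suc n) = ?J - a * G n n'"
      using 1 by (simp add: mult_ac sums_unique2)
    have "(\<lambda>m. Dmat a m n * (sqrt (real (Suc m)) * Dmat a (Suc m) n')) sums ?J"
      using s2[of n n', THEN summable_sums] by (simp add: mult_ac)
    then have "(\<lambda>m. a * (Dmat a m n * Dmat a m n') + sqrt (real n') * (Dmat a m (n' - 1) * Dmat a m n)) sums ?J"
      unfolding Dmat_Suc_row by (simp add: algebra_simps)
    moreover have "(\<lambda>m. a * (Dmat a m n * Dmat a m n') + sqrt (real n') * (Dmat a m (n' - 1) * Dmat a m n)) sums (a * G n n' + sqrt (real n') * G (n' - 1) n)"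
      unfolding G_def by (intro sums_add sums_mult summable_sums s)
    ultimately have "?J = a * G n n' + sqrt (real n') * G (n' - 1) n" by (rule sums_unique2)
    with 2 show ?thesis by simp
  qed
  have "G n n' = G n' n" for n n' by (simp add: G_def mult.commute)
  note sym = this
  have G00: "G 0 0 = 1"
  proof -
    have "(\<lambda>m. exp (- a\<^sup>2) * ((a\<^sup>2) ^ m / fact m)) sums (exp (- a\<^sup>2) * exp (a\<^sup>2))"
      using exp_converges[of "a\<^sup>2"] by (intro sums_mult) (simp add: field_simps)
    moreover have "exp (- a\<^sup>2) * ((a\<^sup>2) ^ m / fact m) = Dmat a m 0 * Dmat a m 0" for m
    proof -
      have "exp (- a\<^sup>2) = exp (- a\<^sup>2 / 2) * exp (- a\<^sup>2 / 2)" by (simp flip: exp_add)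
      then show ?thesis by (simp add: Dmat_col_0 field_simps power2_eq_square power_mult_distrib)
    qed
    ultimately show ?thesis unfolding G_def by (simp add: sums_unique[symmetric] exp_minus)
  qed
  have G0: "G 0 n = (if n = 0 then 1 else 0)" for n
    using rec[of "n - 1" 0] G00 by (cases n) auto
  have "G n' n = (if n = n' then 1 else 0)" for n n'
  proof (induction n arbitrary: n')
    case 0
    then show ?case using G0[of n'] sym[of n' 0] by auto
  next
    case (Suc n)
    have "sqrt (real (Suc n)) * G n' (Suc n) = sqrt (real (Suc n)) * (if Suc n = n' then 1 else 0)"
      unfolding rec Suc by (cases n') auto
    then show ?case by (subst (asm) mult_cancel_left) auto
  qed
  then have "G n n' = (if n = n' then 1 else 0)" by auto
  then show ?thesis using summable_sums[OF s[of n n']] by (simp only: G_def)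
qed

section \<open>Displacement operators are isometric\<close>

abbreviation l2 :: "(nat \<Rightarrow> complex) \<Rightarrow> bool" where
  "l2 psi \<equiv> summable (\<lambda>n. pr psi n)"

lemma l2_bounded:
  assumes "l2 psi" obtains B where "\<And>n. cmod (psi n) \<le> B"
proof
  fix n
  have "pr psi n \<le> (\<Sum>n. pr psi n)"
    using sum_le_suminf[OF assms, of "{n}"] by simp
  then show "cmod (psi n) \<le> sqrt (\<Sum>n. pr psi n)" by (rule real_le_rsqrt)
qed

lemma summable_Dop:
  assumes a: "\<bar>a\<bar> \<le> 1" and "l2 psi"
  shows "summable (\<lambda>n. complex_of_real (Dmat a m n) * psi n)"
proof -
  obtain B where B: "\<And>n. cmod (psi n) \<le> B" using assms l2_bounded by blast
  obtain K r where K: "0 \<le> K" "1 \<le> r" "\<And>n. \<bar>Dmat a m n\<bar> \<le> K * r ^ n / sqrt (fact n)"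
    using Dmat_row_bound[of m] a by blast
  show ?thesis
  proof (rule summable_comparison_test')
    show "summable (\<lambda>n. (K * B) * (r ^ n / sqrt (fact n)))"
      using K by (intro summable_mult summable_power_over_sqrt_fact) auto
    fix n
    have "\<bar>Dmat a m n\<bar> * cmod (psi n) \<le> (K * r ^ n / sqrt (fact n)) * B"
      using K B[of n] by (intro mult_mono) auto
    then show "cmod (complex_of_real (Dmat a m n) * psi n) \<le> (K * B) * (r ^ n / sqrt (fact n))"
      by (simp add: norm_mult mult_ac)
  qed
qed

lemma Dop_add:
  assumes "\<bar>a\<bar> \<le> 1" "l2 psi" "l2 chi"
  shows "Dop a (\<lambda>n. psi n + chi n) m = Dop a psi m + Dop a chi m"
  unfolding Dop_def by (simp add: distrib_left suminf_add[OF summable_Dop summable_Dop] assms)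

lemma Dop_diff:
  assumes "\<bar>a\<bar> \<le> 1" "l2 psi" "l2 chi"
  shows "Dop a (\<lambda>n. psi n - chi n) m = Dop a psi m - Dop a chi m"
  unfolding Dop_def by (simp add: right_diff_distrib suminf_diff[OF summable_Dop summable_Dop] assms)

lemma Dmat_finite_combination_norm:
  assumes "\<bar>a\<bar> \<le> 1"
  shows "(\<lambda>m. (cmod (\<Sum>n<T. complex_of_real (Dmat a m n) * psi n))^2) sums (\<Sum>n<T. pr psi n)"
proof -
  have "(\<lambda>m. \<Sum>n<T. \<Sum>k<T. Dmat a m n * Dmat a m k * Re (psi n * cnj (psi k))) sums
     (\<Sum>n<T. \<Sum>k<T. (if n = k then 1 else 0) * Re (psi n * cnj (psi k)))"
    by (intro sums_sum sums_mult2 Dmat_col_orthonormal assms)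
  also have "(\<Sum>n<T. \<Sum>k<T. (if n = k then 1 else 0) * Re (psi n * cnj (psi k))) = (\<Sum>n<T. pr psi n)"
  proof (intro sum.cong refl)
    fix n assume "n \<in> {..<T}"
    have "(\<Sum>k<T. (if n = k then 1 else 0) * Re (psi n * cnj (psi k))) = (\<Sum>k<T. if n = k then Re (psi n * cnj (psi k)) else 0)"
      by (intro sum.cong) auto
    also have "\<dots> = pr psi n" using \<open>n \<in> {..<T}\<close>
      by (simp add: complex_mult_cnj cmod_power2)
    finally show "(\<Sum>k<T. (if n = k then 1 else 0) * Re (psi n * cnj (psi k))) = pr psi n" .
  qed
  also have "(\<lambda>m. \<Sum>n<T. \<Sum>k<T. Dmat a m n * Dmat a m k * Re (psi n * cnj (psi k))) =
     (\<lambda>m. (cmod (\<Sum>n<T. complex_of_real (Dmat a m n) * psi n))^2)"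
  proof
    fix m
    let ?z = "\<Sum>n<T. complex_of_real (Dmat a m n) * psi n"
    have "(cmod z)^2 = Re (z * cnj z)" for z
      unfolding cmod_power2 by (simp add: power2_eq_square)
    then have "(cmod ?z)^2 = Re (?z * cnj ?z)" .
    also have "\<dots> = (\<Sum>n<T. \<Sum>k<T. Re (complex_of_real (Dmat a m n) * psi n * (complex_of_real (Dmat a m k) * cnj (psi k))))"
      by (simp add: sum_product cnj_sum)
    also have "\<dots> = (\<Sum>n<T. \<Sum>k<T. Dmat a m n * Dmat a m k * Re (psi n * cnj (psi k)))"
      by (intro sum.cong refl) (simp add: algebra_simps)
    finally show "(\<Sum>n<T. \<Sum>k<T. Dmat a m n * Dmat a m k * Re (psi n * cnj (psi k))) = (cmod ?z)^2" by simp
  qed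
  finally show ?thesis .
qed

text \<open>Finite heads of \<open>psi\<close> are mapped isometrically by orthonormality, but their
  images converge only coordinatewise. As in Fatou's lemma this transports just the upper bound; so
  far, mass could still escape to high levels.\<close>

lemma Dop_contraction:
  assumes a: "\<bar>a\<bar> \<le> 1" and l2: "l2 psi"
  shows "l2 (Dop a psi)" "(\<Sum>m. pr (Dop a psi) m) \<le> (\<Sum>n. pr psi n)"
proof -
  let ?w = "\<lambda>T m. \<Sum>n<T. complex_of_real (Dmat a m n) * psi n"
  have lim: "(\<lambda>T. ?w T m) \<longlonglongrightarrow> Dop a psi m" for m
    using summable_LIMSEQ[OF summable_Dop[OF a l2]] by (simp add: Dop_def)
  have le: "(\<Sum>m<R. pr (Dop a psi) m) \<le> (\<Sum>n. pr psi n)" for R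
  proof (rule LIMSEQ_le_const2)
    show "(\<lambda>T. \<Sum>m<R. (cmod (?w T m))^2) \<longlonglongrightarrow> (\<Sum>m<R. pr (Dop a psi) m)"
      by (intro tendsto_intros lim)
    have "(\<Sum>m<R. (cmod (?w T m))^2) \<le> (\<Sum>n. pr psi n)" for T
    proof -
      note s = Dmat_finite_combination_norm[OF a, where T=T and psi=psi]
      have "(\<Sum>m<R. (cmod (?w T m))^2) \<le> (\<Sum>m. (cmod (?w T m))^2)"
        by (intro sum_le_suminf sums_summable[OF s]) auto
      also have "\<dots> = (\<Sum>n<T. pr psi n)" using sums_unique[OF s] by simp
      also have "\<dots> \<le> (\<Sum>n. pr psi n)"
        by (intro sum_le_suminf l2) auto
      finally show ?thesis .
    qed
    then show "\<exists>N. \<forall>T\<ge>N. (\<Sum>m<R. (cmod (?w T m))^2) \<le> (\<Sum>n. pr psi n)" by blast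
  qed
  show *: "l2 (Dop a psi)" by (rule bounded_imp_summable[of _ "\<Sum>n. pr psi n"]) (use le[of "Suc _"] in \<open>auto simp: lessThan_Suc_atMost\<close>)
  show "(\<Sum>m. pr (Dop a psi) m) \<le> (\<Sum>n. pr psi n)"
    using suminf_le_const[OF * le] .
qed

lemma suminf_split_if_lessThan:
  fixes f :: "nat \<Rightarrow> real"
  assumes "summable f"
  shows "(\<lambda>n. if n < T then f n else 0) sums (\<Sum>n<T. f n)"
    and "(\<lambda>n. if n < T then 0 else f n) sums (suminf f - (\<Sum>n<T. f n))"
proof -
  show 1: "(\<lambda>n. if n < T then f n else 0) sums (\<Sum>n<T. f n)"
    using sums_If_finite_set[of "{..<T}" f] by simp
  have "(\<lambda>n. f n - (if n < T then f n else 0)) sums (suminf f - (\<Sum>n<T. f n))"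
    by (intro sums_diff 1 summable_sums assms)
  then show "(\<lambda>n. if n < T then 0 else f n) sums (suminf f - (\<Sum>n<T. f n))"
    by (rule sums_cong[THEN iffD1, rotated]) auto
qed

text \<open>The parallelogram law for \<open>psi = head + tail\<close> and \<open>head - tail\<close> turns the contraction
  property of \<open>Dop\<close> into the missing lower bound.\<close>

lemma Dop_isometry:
  assumes a: "\<bar>a\<bar> \<le> 1" and l2: "l2 psi"
  shows "(\<Sum>m. pr (Dop a psi) m) = (\<Sum>n. pr psi n)"
proof (rule antisym)
  let ?N = "\<lambda>psi::nat\<Rightarrow>complex. (\<Sum>n. pr psi n)"
  show "?N (Dop a psi) \<le> ?N psi" by (rule Dop_contraction[OF a l2])
  have "2 * (\<Sum>n<T. pr psi n) - ?N psi \<le> ?N (Dop a psi)" for T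
  proof -
    define h where "h = (\<lambda>n. if n < T then psi n else 0)"
    define t where "t = (\<lambda>n. if n < T then 0 else psi n)"
    have "(\<lambda>n. pr h n) sums (\<Sum>n<T. pr psi n)"
      using suminf_split_if_lessThan(1)[OF l2, of T] by (rule sums_cong[THEN iffD1, rotated]) (auto simp: h_def)
    moreover have "(\<lambda>n. pr t n) sums (?N psi - (\<Sum>n<T. pr psi n))"
      using suminf_split_if_lessThan(2)[OF l2, of T] by (rule sums_cong[THEN iffD1, rotated]) (auto simp: t_def)
    ultimately have lh: "l2 h" and lt: "l2 t" using sums_summable by blast+
    have eq: "(cmod (h n - t n))^2 = pr psi n" for n by (auto simp: h_def t_def)
    then have lm: "l2 (\<lambda>n. h n - t n)" using l2 by simp
    have p: "(\<lambda>n. h n + t n) = psi" by (auto simp: h_def t_def)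
    have Dh: "?N (Dop a h) = (\<Sum>n<T. pr psi n)"
    proof -
      have "Dop a h m = (\<Sum>n<T. complex_of_real (Dmat a m n) * psi n)" for m
        unfolding Dop_def by (subst suminf_finite[of "{..<T}"]) (auto simp: h_def)
      then show ?thesis using sums_unique[OF Dmat_finite_combination_norm[OF a, where T=T and psi=psi]] by simp
    qed
    have D: "Dop a psi m = Dop a h m + Dop a t m" "Dop a (\<lambda>n. h n - t n) m = Dop a h m - Dop a t m" for m
      using Dop_add[OF a lh lt] Dop_diff[OF a lh lt] p by auto
    have pl: "2 * (cmod z)^2 \<le> (cmod (z + w))^2 + (cmod (z - w))^2" for z w
      using zero_le_power2[of "Re w"] zero_le_power2[of "Im w"]
      unfolding cmod_power2 by (simp add: algebra_simps power2_eq_square)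
    have "2 * ?N (Dop a h) = (\<Sum>m. 2 * pr (Dop a h) m)"
      by (intro suminf_mult[symmetric] Dop_contraction a lh)
    also have "\<dots> \<le> (\<Sum>m. pr (Dop a psi) m + (cmod (Dop a (\<lambda>n. h n - t n) m))^2)"
      by (intro suminf_le summable_mult summable_add Dop_contraction a lh lm l2) (simp add: D pl)
    also have "\<dots> = ?N (Dop a psi) + ?N (Dop a (\<lambda>n. h n - t n))"
      by (intro suminf_add[symmetric] Dop_contraction a lm l2)
    also have "?N (Dop a (\<lambda>n. h n - t n)) \<le> ?N psi"
      using Dop_contraction(2)[OF a lm] by (simp add: eq)
    finally show ?thesis using Dh by simp
  qed
  moreover have "(\<lambda>T. 2 * (\<Sum>n<T. pr psi n) - ?N psi) \<longlonglongrightarrow> 2 * ?N psi - ?N psi"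
    by (intro tendsto_intros summable_LIMSEQ l2)
  ultimately have "2 * ?N psi - ?N psi \<le> ?N (Dop a psi)"
    by (intro LIMSEQ_le_const2) auto
  then show "?N psi \<le> ?N (Dop a psi)" by simp
qed

lemma Dop_B1: "\<bar>a\<bar> \<le> 1 \<Longrightarrow> psi \<in> B1 \<Longrightarrow> Dop a psi \<in> B1"
  unfolding B1_def using Dop_contraction(1) Dop_isometry by auto

lemma Dop_0: "Dop 0 psi = psi"
proof
  fix m
  show "Dop 0 psi m = psi m"
    unfolding Dop_def by (subst suminf_finite[of "{m}"]) (auto simp: Dmat_0)
qed

text \<open>For a \<open>psi\<close> outside the domain of the generator, \<open>Dop s psi\<close>
  is not differentiable in norm. Each coordinate is: the rows of the matrix decay so fast that the
  series can be differentiated term by term for merely bounded coefficients.\<close>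

lemma Dop_deriv:
  assumes l2: "l2 psi" and s: "\<bar>s\<bar> < 1"
  shows "((\<lambda>s. Re (Dop s psi m)) has_real_derivative
      (sqrt (real m) * Re (Dop s psi (m - 1)) - sqrt (real (Suc m)) * Re (Dop s psi (Suc m)))) (at s)" (is ?A)
   and "((\<lambda>s. Im (Dop s psi m)) has_real_derivative
      (sqrt (real m) * Im (Dop s psi (m - 1)) - sqrt (real (Suc m)) * Im (Dop s psi (Suc m)))) (at s)" (is ?B)
proof -
  obtain B where B: "\<And>n. cmod (psi n) \<le> B" using assms l2_bounded by blast
  have B0: "0 \<le> B" using B[of 0] norm_ge_zero order_trans by blast
  have *: "((\<lambda>s. \<Sum>n. Dmat s m n * f n) has_real_derivative
      (sqrt (real m) * (\<Sum>n. Dmat s (m-1) n * f n) - sqrt (real (Suc m)) * (\<Sum>n. Dmat s (Suc m) n * f n))) (at s)"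
    if f: "\<And>n. \<bar>f n\<bar> \<le> B" for f
  proof -
    have bd: "\<exists>g. summable g \<and> (\<forall>s n. \<bar>s\<bar> \<le> 1 \<longrightarrow> \<bar>Dmat s m n * f n\<bar> \<le> g n)" for m
    proof -
      obtain K r where K: "0 \<le> K" "1 \<le> r" "\<And>s n. \<bar>s\<bar> \<le> 1 \<Longrightarrow> \<bar>Dmat s m n\<bar> \<le> K * r ^ n / sqrt (fact n)"
        using Dmat_row_bound[of m] by blast
      have "\<bar>Dmat s m n * f n\<bar> \<le> (K * r ^ n / sqrt (fact n)) * B" if "\<bar>s\<bar> \<le> 1" for s n
        unfolding abs_mult using K f that by (intro mult_mono) auto
      moreover have "summable (\<lambda>n. (K * (r ^ n / sqrt (fact n))) * B)"
        using K by (intro summable_mult summable_mult2 summable_power_over_sqrt_fact) auto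
      ultimately show ?thesis by (intro exI[of _ "\<lambda>n. (K * r ^ n / sqrt (fact n)) * B"]) auto
    qed
    have sm: "summable (\<lambda>n. Dmat s m n * f n)" if s: "\<bar>s\<bar> \<le> 1" for s m
      using bd[of m] s by (auto intro: summable_comparison_test')
    let ?f' = "\<lambda>n s. (sqrt (real m) * Dmat s (m-1) n - sqrt (real (Suc m)) * Dmat s (Suc m) n) * f n"
    have "((\<lambda>s. \<Sum>n. Dmat s m n * f n) has_real_derivative (\<Sum>n. ?f' n s)) (at s)"
    proof (rule has_field_derivative_series'(2)[of "{-1..1}" _ _ 0])
      show "((\<lambda>s. Dmat s m n * f n) has_real_derivative ?f' n s) (at s within {-1..1})" for n s
        by (intro DERIV_cmult_right has_field_derivative_at_within[OF Dmat_deriv])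
      obtain g1 where g1: "summable g1" "\<And>s n. \<bar>s\<bar> \<le> 1 \<Longrightarrow> \<bar>Dmat s (m-1) n * f n\<bar> \<le> g1 n" using bd[of "m-1"] by blast
      obtain g2 where g2: "summable g2" "\<And>s n. \<bar>s\<bar> \<le> 1 \<Longrightarrow> \<bar>Dmat s (Suc m) n * f n\<bar> \<le> g2 n" using bd[of "Suc m"] by blast
      show "uniformly_convergent_on {-1..1} (\<lambda>n s. \<Sum>i<n. ?f' i s)"
      proof (rule Weierstrass_m_test'_ev[OF always_eventually])
        show "summable (\<lambda>n. sqrt (real m) * g1 n + sqrt (real (Suc m)) * g2 n)"
          by (intro summable_add summable_mult g1 g2)
        show "\<forall>n. \<forall>s\<in>{-1..1}. norm (?f' n s) \<le> sqrt (real m) * g1 n + sqrt (real (Suc m)) * g2 n"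
        proof (intro allI ballI)
          fix n and s :: real assume "s \<in> {-1..1}"
          then have s: "\<bar>s\<bar> \<le> 1" by auto
          have "?f' n s = sqrt (real m) * (Dmat s (m-1) n * f n) - sqrt (real (Suc m)) * (Dmat s (Suc m) n * f n)"
            by (simp only: left_diff_distrib mult.assoc)
          then have "norm (?f' n s) \<le> sqrt (real m) * \<bar>Dmat s (m-1) n * f n\<bar> + sqrt (real (Suc m)) * \<bar>Dmat s (Suc m) n * f n\<bar>"
            using abs_triangle_ineq4[of "sqrt (real m) * (Dmat s (m-1) n * f n)" "sqrt (real (Suc m)) * (Dmat s (Suc m) n * f n)"]
            by (simp add: abs_mult del: of_nat_Suc)
          also have "\<dots> \<le> sqrt (real m) * g1 n + sqrt (real (Suc m)) * g2 n"
            using g1(2)[OF s] g2(2)[OF s] by (intro add_mono mult_left_mono) auto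
          finally show "norm (?f' n s) \<le> sqrt (real m) * g1 n + sqrt (real (Suc m)) * g2 n" .
        qed
      qed
      show "summable (\<lambda>n. Dmat 0 m n * f n)" by (rule sm) simp
      show "s \<in> interior {-1..1}" using s by auto
    qed auto
    also have "(\<Sum>n. ?f' n s) = sqrt (real m) * (\<Sum>n. Dmat s (m-1) n * f n) - sqrt (real (Suc m)) * (\<Sum>n. Dmat s (Suc m) n * f n)"
    proof -
      have "summable (\<lambda>n. Dmat s (m-1) n * f n)" "summable (\<lambda>n. Dmat s (Suc m) n * f n)"
        using s by (auto intro: sm)
      note this[THEN summable_sums, THEN sums_mult]
      from sums_diff[OF this(1)[of "sqrt (real m)"] this(2)[of "sqrt (real (Suc m))"]]
      show ?thesis by (simp only: left_diff_distrib mult.assoc sums_unique[symmetric])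
    qed
    finally show ?thesis .
  qed
  have eq: "Re (Dop s psi m) = (\<Sum>n. Dmat s m n * Re (psi n))" "Im (Dop s psi m) = (\<Sum>n. Dmat s m n * Im (psi n))"
    if "\<bar>s\<bar> \<le> 1" for s m
    unfolding Dop_def
    using Re_suminf[OF summable_Dop[OF that l2, of m]] Im_suminf[OF summable_Dop[OF that l2, of m]] by simp_all
  have nb: "s \<in> {-1<..<1}" "open {-1<..<(1::real)}" using s by auto
  have "\<bar>Re (psi n)\<bar> \<le> B" "\<bar>Im (psi n)\<bar> \<le> B" for n
    using B[of n] abs_Re_le_cmod[of "psi n"] abs_Im_le_cmod[of "psi n"] by linarith+
  note d = *[OF this(1)] *[OF this(2)]
  have s1: "\<bar>s\<bar> \<le> 1" using s by simp
  show ?A unfolding eq(1)[OF s1]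
    by (rule has_field_derivative_transform_within_open[OF d(1) nb(2,1)]) (auto simp: eq)
  show ?B unfolding eq(2)[OF s1]
    by (rule has_field_derivative_transform_within_open[OF d(2) nb(2,1)]) (auto simp: eq)
qed

section \<open>Energy drop near an unstable Fock state\<close>

lemma sigma_coef_step:
  "sigma_coef nbar (Suc n) - sigma_coef nbar n =
     (if nbar \<le> n then 1 / real (Suc n) + 1 / (real (Suc n))^2
      else if n = 0 then - (1/8) else - (1 / real (Suc n) - 1 / (real (Suc n))^2))"
proof -
  consider "nbar = n" | "nbar < n" | "Suc n = nbar" | "Suc n < nbar" by linarith
  then show ?thesis
  proof cases
    case 2
    then show ?thesis by (simp add: sigma_coef_def)
  next
    case 4
    then have "(\<Sum>k\<in>{Suc n..nbar}. 1 / real k - 1 / (real k)^2) =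
      (1 / real (Suc n) - 1 / (real (Suc n))^2) + (\<Sum>k\<in>{Suc (Suc n)..nbar}. 1 / real k - 1 / (real k)^2)"
      by (intro sum.atLeast_Suc_atMost) auto
    then show ?thesis using 4 by (cases "n = 0") (simp_all add: sigma_coef_def)
  qed (auto simp: sigma_coef_def)
qed

lemma sigma_coef_nonneg: "0 \<le> sigma_coef nbar n"
proof -
  have "0 \<le> 1 / real k - 1 / (real k)^2" for k :: nat
    by (cases "k = 0") (auto simp: divide_simps power2_eq_square)
  then show ?thesis
    by (auto simp: sigma_coef_def intro!: sum_nonneg add_nonneg_nonneg simp del: diff_ge_0_iff_ge)
qed

lemma sigma_coef_mono:
  assumes "nbar \<le> m" "m \<le> n" shows "sigma_coef nbar m \<le> sigma_coef nbar n"
  using assms(2)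
proof (induction rule: dec_induct)
  case (step k)
  have "0 \<le> sigma_coef nbar (Suc k) - sigma_coef nbar k"
    unfolding sigma_coef_step using assms(1) step(1) by simp
  with step show ?case by linarith
qed simp

lemma sigma_coef_unbounded: "\<exists>n>nbar. L \<le> sigma_coef nbar n"
proof -
  have "eventually (\<lambda>n. L + harm nbar \<le> (harm n :: real)) sequentially"
    using harm_at_top by (auto simp: filterlim_at_top)
  then have "eventually (\<lambda>n. n > nbar \<and> L + harm nbar \<le> (harm n :: real)) sequentially"
    by (intro eventually_conj eventually_gt_at_top)
  then obtain n where n: "n > nbar" "L + harm nbar \<le> (harm n :: real)"
    by (auto simp: eventually_sequentially)
  have "(harm n :: real) = harm nbar + (\<Sum>k\<in>{nbar+1..n}. 1 / real k)"
  proof -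
    have "{1..n} = {1..nbar} \<union> {nbar+1..n}" using n by auto
    then show ?thesis unfolding harm_def
      by (simp add: sum.union_disjoint ivl_disj_int inverse_eq_divide)
  qed
  moreover have "(\<Sum>k\<in>{nbar+1..n}. 1 / real k) \<le> sigma_coef nbar n"
    using n(1) by (auto simp: sigma_coef_def intro!: sum_mono)
  ultimately show ?thesis using n by (intro exI[of _ n]) auto
qed

text \<open>The second variation of the energy \<open>\<Sum>\<sigma>\<^sub>n|\<psi>\<^sub>n|\<^sup>2\<close> at a Fock state.\<close>

lemma sigma_coef_concave:
  assumes "n \<noteq> nbar"
  shows "real (Suc n) * (sigma_coef nbar (Suc n) - sigma_coef nbar n)
       - real n * (sigma_coef nbar n - sigma_coef nbar (n - 1)) < 0"
proof (cases n)
  case 0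
  then show ?thesis using assms sigma_coef_step[of nbar 0] by simp
next
  case (Suc k)
  \<comment> \<open>Multiplied by its level k, a step of the weights is \<open>1 + 1/k\<close> above
    the target and \<open>1/k - 1\<close> below it. The strict decrease in k comes from the
    \<open>1/k^2\<close> parts; steps of size \<open>1/k\<close> alone would make the second
    variation vanish.\<close>
  have inv: "x * (1 / x + 1 / x\<^sup>2) = 1 + 1 / x" "x * (1 / x\<^sup>2 - 1 / x) = 1 / x - 1" if "x > 0" for x :: real
    using that by (simp_all add: field_simps power2_eq_square)
  have lt: "1 / real (Suc (Suc k)) < 1 / real (Suc k)" by (intro divide_strict_left_mono) auto
  consider "nbar \<le> k" | "Suc k < nbar" using assms Suc by linarith
  then show ?thesis
  proof cases
    case 1
    then show ?thesis unfolding Suc diff_Suc_1 sigma_coef_step using lt inv(1)[of "real (Suc k)"] inv(1)[of "real (Suc (Suc k))"]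
      by (simp del: of_nat_Suc)
  next
    case 2
    \<comment> \<open>At level 1 the exceptional step 1/8 meets the first regular one, 1/2 - 1/4,
      and \<open>- 2 * (1/4) + 1/8 < 0\<close>. Any value strictly between 0 and 1/2 in place of 1/8
      would do; 0 itself would make the vacuum neutral.\<close>
    show ?thesis
    proof (cases "k = 0")
      case True
      then show ?thesis unfolding Suc diff_Suc_1 sigma_coef_step using 2 by (simp add: power2_eq_square)
    next
      case False
      then show ?thesis unfolding Suc diff_Suc_1 sigma_coef_step
        using 2 lt inv(2)[of "real (Suc k)"] inv(2)[of "real (Suc (Suc k))"]
        by (simp del: of_nat_Suc)
    qed
  qed
qed

text \<open>These are the entries of the commutator of the energy with the generator. A step of size
  at most \<open>2/(m+1)\<close> against the factor \<open>sqrt (m+1)\<close> leaves a bounded band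
  matrix, although the energy is unbounded.\<close>

lemma sqrt_sigma_coef_step_bounded:
  "\<bar>sqrt (real (Suc m)) * (sigma_coef nbar (Suc m) - sigma_coef nbar m)\<bar> \<le> 2"
proof -
  let ?x = "real (Suc m)"
  have x: "?x \<ge> 1" by simp
  have h: "1 / ?x\<^sup>2 \<le> 1 / ?x" "0 \<le> 1 / ?x\<^sup>2" "0 \<le> 1 / ?x" using x by (auto simp: divide_simps power2_eq_square simp del: of_nat_Suc)
  have m0: "m = 0 \<Longrightarrow> 1 / ?x = 1" by simp
  have "\<bar>if P then y + z else if Q then - (1/8) else - (y - z)\<bar> \<le> 2 * y"
    if "z \<le> y" "0 \<le> z" "0 \<le> y" "Q \<Longrightarrow> y = 1" for P Q and y z :: real
    using that by auto
  from this[OF h m0] have "\<bar>sigma_coef nbar (Suc m) - sigma_coef nbar m\<bar> \<le> 2 * (1 / ?x)"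
    unfolding sigma_coef_step .
  then have "sqrt ?x * \<bar>sigma_coef nbar (Suc m) - sigma_coef nbar m\<bar> \<le> ?x * (2 / ?x)"
    using x real_le_lsqrt[of ?x ?x] by (intro mult_mono) (auto simp: power2_eq_square simp del: of_nat_Suc)
  then show ?thesis by (simp add: abs_mult del: of_nat_Suc)
qed

lemma B1_D: assumes "psi \<in> B1"
  shows "l2 psi" "(\<lambda>n. pr psi n) sums 1" "cmod (psi n) \<le> 1" "(\<Sum>n\<in>A. pr psi n) \<le> 1"
proof -
  show 1: "l2 psi" and 2: "(\<lambda>n. pr psi n) sums 1" using assms by (auto simp: B1_def sums_iff)
  show "(\<Sum>n\<in>A. pr psi n) \<le> 1" for A
    using sum_le_suminf[OF 1, of A] sums_unique[OF 2] by (cases "finite A") auto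
  from this[of "{n}"] show "cmod (psi n) \<le> 1" by (simp add: power2_le_iff_abs_le[of 1, simplified])
qed

section \<open>Matrix entries for small displacements\<close>

lemma abs_Dmat_le_1: assumes "\<bar>a\<bar> \<le> 1" shows "\<bar>Dmat a m n\<bar> \<le> 1"
proof -
  have s: "(\<lambda>m. Dmat a m n * Dmat a m n) sums 1" using Dmat_col_orthonormal[OF assms, of n n] by simp
  have "Dmat a m n * Dmat a m n \<le> 1"
    using sum_le_suminf[OF sums_summable[OF s], of "{m}"] sums_unique[OF s] by simp
  then show ?thesis by (simp add: abs_le_square_iff[of _ 1, simplified] power2_eq_square)
qed

lemma Dmat_off_diagonal_le:
  assumes "m \<noteq> n" "0 \<le> s" "s \<le> 1" "m \<le> Suc n"
  shows "\<bar>Dmat s m n\<bar> \<le> 2 * sqrt (real (n + 2)) * s"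
proof (cases "s = 0")
  case False
  then have s: "0 < s" using assms by simp
  obtain t where t: "0 < t" "t < s" "Dmat s m n - Dmat 0 m n = (s - 0) * (sqrt (real m) * Dmat t (m - 1) n - sqrt (real (Suc m)) * Dmat t (Suc m) n)"
    using MVT2[OF s Dmat_deriv] by blast
  have t1: "\<bar>t\<bar> \<le> 1" using t assms by auto
  have "\<bar>sqrt (real m) * Dmat t (m - 1) n - sqrt (real (Suc m)) * Dmat t (Suc m) n\<bar> \<le>
     sqrt (real m) * \<bar>Dmat t (m - 1) n\<bar> + sqrt (real (Suc m)) * \<bar>Dmat t (Suc m) n\<bar>"
    by (rule order_trans[OF abs_triangle_ineq4]) (simp add: abs_mult)
  also have "\<dots> \<le> sqrt (real (n + 2)) * 1 + sqrt (real (n + 2)) * 1"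
    using assms abs_Dmat_le_1[OF t1] by (intro add_mono mult_mono) auto
  finally have "\<bar>sqrt (real m) * Dmat t (m - 1) n - sqrt (real (Suc m)) * Dmat t (Suc m) n\<bar> \<le> 2 * sqrt (real (n + 2))" by simp
  then have "s * \<bar>sqrt (real m) * Dmat t (m - 1) n - sqrt (real (Suc m)) * Dmat t (Suc m) n\<bar> \<le> s * (2 * sqrt (real (n + 2)))"
    using s by (intro mult_left_mono) auto
  then show ?thesis using t(3) assms s by (simp add: Dmat_0 abs_mult mult_ac)
qed (use assms in \<open>auto simp: Dmat_0\<close>)

text \<open>The derivative of a diagonal entry involves only its off-diagonal neighbours, which are
  O(s). So the population lost by |n> is quadratic in s, the same order as the energy gain; a linear
  loss would spoil the choice of \<delta>.\<close>

lemma Dmat_diagonal_ge: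
  assumes "0 \<le> s" "s \<le> 1"
  shows "1 - (Dmat s n n)^2 \<le> 4 * real (n + 2) * s\<^sup>2"
proof -
  define L where "L = 2 * sqrt (real (n + 2))"
  have L2: "L\<^sup>2 = 4 * real (n + 2)" by (simp add: L_def power_mult_distrib)
  let ?g = "\<lambda>s. sqrt (real n) * Dmat s (n - 1) n - sqrt (real (Suc n)) * Dmat s (Suc n) n"
  have "1 - (Dmat s n n)^2 - L\<^sup>2 * s\<^sup>2 \<le> 1 - (Dmat 0 n n)^2 - L\<^sup>2 * 0\<^sup>2"
  proof (rule DERIV_nonpos_imp_nonincreasing[of 0 s "\<lambda>s. 1 - (Dmat s n n)^2 - L\<^sup>2 * s\<^sup>2"])
    fix t assume t: "0 \<le> t" "t \<le> s"
    have "((\<lambda>s. 1 - (Dmat s n n)^2 - L\<^sup>2 * s\<^sup>2) has_real_derivative (- (2 * Dmat t n n * ?g t) - L\<^sup>2 * (2 * t))) (at t)"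
      by (auto intro!: derivative_eq_intros Dmat_deriv)
    moreover have "- (2 * Dmat t n n * ?g t) - L\<^sup>2 * (2 * t) \<le> 0"
    proof -
      have t1: "\<bar>t\<bar> \<le> 1" "0 \<le> t" "t \<le> 1" using t assms by auto
      have 1: "sqrt (real n) * \<bar>Dmat t (n - 1) n\<bar> \<le> sqrt (real (n + 2)) * (L * t)"
      proof (cases "n = 0")
        case False
        then show ?thesis using t1 Dmat_off_diagonal_le[of "n-1" n t] by (intro mult_mono) (auto simp: L_def)
      qed (use t1 in \<open>auto simp: L_def\<close>)
      have 2: "sqrt (real (Suc n)) * \<bar>Dmat t (Suc n) n\<bar> \<le> sqrt (real (n + 2)) * (L * t)"
        using t1 Dmat_off_diagonal_le[of "Suc n" n t] by (intro mult_mono) (auto simp: L_def)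
      have "\<bar>?g t\<bar> \<le> sqrt (real n) * \<bar>Dmat t (n - 1) n\<bar> + sqrt (real (Suc n)) * \<bar>Dmat t (Suc n) n\<bar>"
        by (rule order_trans[OF abs_triangle_ineq4]) (simp add: abs_mult)
      also have "\<dots> \<le> L * (L * t)" using 1 2 by (simp add: L_def algebra_simps)
      finally have g: "\<bar>?g t\<bar> \<le> L\<^sup>2 * t" by (simp add: power2_eq_square)
      have "\<bar>Dmat t n n * ?g t\<bar> \<le> 1 * (L\<^sup>2 * t)"
        unfolding abs_mult using abs_Dmat_le_1[OF t1(1)] g by (intro mult_mono) auto
      then show ?thesis by linarith
    qed
    ultimately show "\<exists>y. DERIV (\<lambda>s. 1 - (Dmat s n n)^2 - L\<^sup>2 * s\<^sup>2) t :> y \<and> y \<le> 0" by blast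
  qed (use assms in auto)
  then show ?thesis unfolding L2 by (simp add: Dmat_0)
qed

text \<open>The coherence between neighbouring levels. Times \<open>2 sqrt (m+1)\<close> it is the
  current of population from level m to level m+1 under the flow of
  \<open>a^dagger - a\<close>.\<close>

definition corr :: "(nat \<Rightarrow> complex) \<Rightarrow> nat \<Rightarrow> real" where
  "corr w m = Re (cnj (w m) * w (Suc m))"

text \<open>The energy with weights \<open>\<sigma>\<^bsub>min m M\<^esub>\<close>. On the unit sphere it depends on finitely many
  coordinates only, so it can be differentiated along \<open>Dop s psi\<close> for every \<open>psi\<close>; the derivative is
  bounded uniformly in \<open>M\<close> because \<open>\<surd>(m+1) (\<sigma>\<^sub>m\<^sub>+\<^sub>1 - \<sigma>\<^sub>m)\<close> is.\<close>

definition trunc_energy :: "nat \<Rightarrow> nat \<Rightarrow> (nat \<Rightarrow> complex) \<Rightarrow> real" where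
  "trunc_energy nbar M w = sigma_coef nbar M - (\<Sum>m<M. (sigma_coef nbar M - sigma_coef nbar m) * pr w m)"

lemma summation_by_parts:
  fixes c t :: "nat \<Rightarrow> real"
  shows "(\<Sum>m<M. c m * ((if m = 0 then 0 else t (m - 1)) - t m)) =
    (\<Sum>m<M. (c (Suc m) - c m) * t m) - (if M = 0 then 0 else c M * t (M - 1))"
  by (induction M) (auto simp: algebra_simps)

text \<open>Populations obey a continuity equation: that of level m changes by the difference of the
  two currents touching it. The cut-off weights \<open>?c\<close> vanish at \<open>M\<close>, so
  summation by parts leaves no boundary term.\<close>

lemma trunc_energy_deriv:
  assumes "l2 psi" "\<bar>s\<bar> < 1"
  shows "((\<lambda>s. trunc_energy nbar M (Dop s psi)) has_real_derivative
     2 * (\<Sum>m<M. sqrt (real (Suc m)) * (sigma_coef nbar (Suc m) - sigma_coef nbar m) * corr (Dop s psi) m)) (at s)"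
proof -
  let ?w = "Dop s psi"
  let ?t = "\<lambda>m. sqrt (real (Suc m)) * corr ?w m"
  let ?c = "\<lambda>m. sigma_coef nbar M - sigma_coef nbar m"
  have d: "((\<lambda>s. pr (Dop s psi) m) has_real_derivative 2 * ((if m = 0 then 0 else ?t (m - 1)) - ?t m)) (at s)" for m
  proof -
    have "((\<lambda>s. (Re (Dop s psi m))^2 + (Im (Dop s psi m))^2) has_real_derivative
      2 * Re (?w m) * (sqrt (real m) * Re (?w (m - 1)) - sqrt (real (Suc m)) * Re (?w (Suc m)))
      + 2 * Im (?w m) * (sqrt (real m) * Im (?w (m - 1)) - sqrt (real (Suc m)) * Im (?w (Suc m)))) (at s)"
      by (intro DERIV_cong[OF DERIV_add[OF DERIV_power[OF Dop_deriv(1)[OF assms]] DERIV_power[OF Dop_deriv(2)[OF assms]]]])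
        (simp del: of_nat_Suc)
    also have "2 * Re (?w m) * (sqrt (real m) * Re (?w (m - 1)) - sqrt (real (Suc m)) * Re (?w (Suc m)))
      + 2 * Im (?w m) * (sqrt (real m) * Im (?w (m - 1)) - sqrt (real (Suc m)) * Im (?w (Suc m)))
      = 2 * ((if m = 0 then 0 else ?t (m - 1)) - ?t m)"
      by (cases m) (simp_all add: corr_def algebra_simps del: of_nat_Suc)
    finally show ?thesis by (simp only: cmod_power2)
  qed
  have "((\<lambda>s. trunc_energy nbar M (Dop s psi)) has_real_derivative
     0 - (\<Sum>m<M. ?c m * (2 * ((if m = 0 then 0 else ?t (m - 1)) - ?t m)))) (at s)"
    unfolding trunc_energy_def by (intro DERIV_diff DERIV_const DERIV_sum DERIV_cmult d)
  also have "0 - (\<Sum>m<M. ?c m * (2 * ((if m = 0 then 0 else ?t (m - 1)) - ?t m)))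
    = - 2 * (\<Sum>m<M. ?c m * ((if m = 0 then 0 else ?t (m - 1)) - ?t m))"
    by (simp only: sum_distrib_left) (simp add: sum_negf[symmetric] algebra_simps)
  also have "\<dots> = 2 * (\<Sum>m<M. sqrt (real (Suc m)) * (sigma_coef nbar (Suc m) - sigma_coef nbar m) * corr ?w m)"
  proof -
    have "(\<Sum>m<M. ?c m * ((if m = 0 then 0 else ?t (m - 1)) - ?t m)) = (\<Sum>m<M. (?c (Suc m) - ?c m) * ?t m)"
      by (subst summation_by_parts[where c="?c" and t="?t"]) (simp only: diff_self mult_zero_left if_cancel diff_zero)
    also have "\<dots> = - (\<Sum>m<M. sqrt (real (Suc m)) * (sigma_coef nbar (Suc m) - sigma_coef nbar m) * corr ?w m)"
      unfolding sum_negf[symmetric] by (intro sum.cong refl) (simp add: algebra_simps del: of_nat_Suc)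
    finally show ?thesis by simp
  qed
  finally show ?thesis .
qed

text \<open>Near |n> only the two currents touching level \<open>n\<close> can be large. The others
  pair levels different from \<open>n\<close>, and \<open>2uv \<le> u^2 + v^2\<close> bounds them by
  the mass outside \<open>n\<close>; each level occurs in at most two pairs, whence the factor
  4.\<close>

lemma corr_sum_bound:
  assumes w: "w \<in> B1" and b: "\<And>m. \<bar>b m\<bar> \<le> 2" and n: "n < M"
  shows "2 * (\<Sum>m<M. b m * corr w m) \<le>
     2 * b n * corr w n + (if n = 0 then 0 else 2 * b (n - 1) * corr w (n - 1)) + 4 * (1 - pr w n)"
proof -
  define q where "q m = (if m = n then 0 else pr w m)" for m
  let ?main = "\<lambda>m. if m = n then 2 * b m * corr w m else if Suc m = n then 2 * b m * corr w m else 0"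
  have summand: "2 * b m * corr w m \<le> ?main m + 2 * (q m + q (Suc m))" for m
  proof (cases "m = n \<or> Suc m = n")
    case False
    have "\<bar>corr w m\<bar> \<le> cmod (w m) * cmod (w (Suc m))"
      unfolding corr_def by (metis abs_Re_le_cmod complex_mod_cnj norm_mult)
    then have "\<bar>b m * corr w m\<bar> \<le> 2 * (cmod (w m) * cmod (w (Suc m)))"
      unfolding abs_mult using b by (intro mult_mono) auto
    moreover have "2 * (cmod (w m) * cmod (w (Suc m))) \<le> pr w m + (cmod (w (Suc m)))^2"
      using sum_squares_bound[of "cmod (w m)" "cmod (w (Suc m))"] by simp
    ultimately have "b m * corr w m \<le> pr w m + (cmod (w (Suc m)))^2"
      using abs_le_D1 order_trans by blast
    then have "2 * b m * corr w m \<le> 2 * (pr w m + (cmod (w (Suc m)))^2)"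
      by (simp add: mult.assoc)
    then show ?thesis using False by (simp add: q_def)
  qed (auto simp: q_def)
  have q: "(\<Sum>m\<in>A. q m) \<le> 1 - pr w n" if "finite A" for A
  proof -
    have "(\<Sum>m\<in>A. q m) = (\<Sum>m\<in>A - {n}. pr w m)"
      using that by (intro sum.mono_neutral_cong_right) (auto simp: q_def)
    also have "\<dots> + pr w n = (\<Sum>m\<in>insert n A. pr w m)"
      using that by (simp add: sum.insert_remove)
    also have "\<dots> \<le> 1" by (rule B1_D(4)[OF w])
    finally show ?thesis by simp
  qed
  have "2 * (\<Sum>m<M. b m * corr w m) = (\<Sum>m<M. 2 * b m * corr w m)"
    by (simp add: sum_distrib_left mult.assoc)
  also have "\<dots> \<le> (\<Sum>m<M. ?main m + 2 * (q m + q (Suc m)))" by (intro sum_mono summand)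
  also have "\<dots> = (\<Sum>m<M. ?main m) + 2 * ((\<Sum>m<M. q m) + (\<Sum>m<M. q (Suc m)))"
    by (simp add: sum.distrib sum_distrib_left)
  also have "(\<Sum>m<M. q (Suc m)) = (\<Sum>m\<in>Suc ` {..<M}. q m)" by (simp add: sum.reindex)
  also have "(\<Sum>m<M. q m) + (\<Sum>m\<in>Suc ` {..<M}. q m) \<le> (1 - pr w n) + (1 - pr w n)"
    by (intro add_mono q) auto
  also have "(\<Sum>m<M. ?main m) = 2 * b n * corr w n + (if n = 0 then 0 else 2 * b (n - 1) * corr w (n - 1))"
  proof -
    have "(\<Sum>m<M. ?main m) = (\<Sum>m<M. (if n = m then 2 * b m * corr w m else 0) + (if n \<noteq> 0 \<and> n - 1 = m then 2 * b m * corr w m else 0))"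
      by (intro sum.cong) auto
    then show ?thesis using n by (cases "n = 0") (auto simp: sum.distrib)
  qed
  finally show ?thesis by simp
qed

text \<open>The unknown phase of \<open>z\<close> cancels against its conjugate. What remains are
  the defect of its modulus and two terms carrying a perturbation, each at most \<zeta>.\<close>

lemma perturbed_corr:
  fixes z e e' :: complex and d d' \<zeta> :: real
  assumes "\<bar>d\<bar> \<le> 1" "\<bar>d'\<bar> \<le> 1" "cmod z \<le> 1" "cmod e \<le> \<zeta>" "cmod e' \<le> \<zeta>"
    "cmod (of_real d' * z + e') \<le> 1" "1 - (cmod z)^2 \<le> \<zeta>"
  shows "\<bar>Re (cnj (of_real d * z + e) * (of_real d' * z + e')) - d * d'\<bar> \<le> 3 * \<zeta>"
proof -
  have z0: "0 \<le> \<zeta>" using assms(4) norm_ge_zero order_trans by blast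
  have "cnj (of_real d * z + e) * (of_real d' * z + e') =
    of_real (d * d' * (cmod z)^2) + of_real d * cnj z * e' + cnj e * (of_real d' * z + e')"
    by (simp only: of_real_mult complex_norm_square) (simp add: algebra_simps)
  from arg_cong[OF this, of Re]
  have "Re (cnj (of_real d * z + e) * (of_real d' * z + e')) - d * d' =
      - (d * d' * (1 - (cmod z)^2)) + Re (of_real d * cnj z * e') + Re (cnj e * (of_real d' * z + e'))"
    by (simp only: plus_complex.sel Re_complex_of_real right_diff_distrib mult_1_right)
  moreover have "\<bar>d * d' * (1 - (cmod z)^2)\<bar> \<le> \<zeta>"
  proof -
    have "0 \<le> 1 - (cmod z)^2" using assms(3) by (simp add: power_le_one)
    moreover have "\<bar>d * d'\<bar> \<le> 1" using assms by (simp add: abs_mult mult_le_one)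
    ultimately have "\<bar>d * d'\<bar> * \<bar>1 - (cmod z)^2\<bar> \<le> 1 * \<zeta>" using assms z0 by (intro mult_mono) auto
    then show ?thesis by (simp add: abs_mult)
  qed
  moreover have "\<bar>Re (of_real d * cnj z * e')\<bar> \<le> \<zeta>"
  proof -
    have "\<bar>Re (of_real d * cnj z * e')\<bar> \<le> \<bar>d\<bar> * cmod z * cmod e'"
      using abs_Re_le_cmod[of "of_real d * cnj z * e'"] by (simp add: norm_mult)
    also have "\<dots> \<le> 1 * 1 * \<zeta>" using assms by (intro mult_mono) auto
    finally show ?thesis by simp
  qed
  moreover have "\<bar>Re (cnj e * (of_real d' * z + e'))\<bar> \<le> \<zeta>"
  proof -
    have "\<bar>Re (cnj e * (of_real d' * z + e'))\<bar> \<le> cmod e * cmod (of_real d' * z + e')"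
      using abs_Re_le_cmod[of "cnj e * (of_real d' * z + e')"] by (simp only: norm_mult complex_mod_cnj)
    also have "\<dots> \<le> \<zeta> * 1" using assms z0 by (intro mult_mono) auto
    finally show ?thesis by simp
  qed
  moreover have "\<bar>t\<bar> \<le> 3 * y" if "t = - p + q + r" "\<bar>p\<bar> \<le> y" "\<bar>q\<bar> \<le> y" "\<bar>r\<bar> \<le> y" for p q r t y :: real
    using that by linarith
  ultimately show ?thesis by blast
qed

lemma Dop_near_fock:
  assumes a: "\<bar>a\<bar> \<le> 1" and psi: "psi \<in> B1"
  obtains e where "\<And>m. Dop a psi m = of_real (Dmat a m n) * psi n + e m" "\<And>m. cmod (e m) \<le> sqrt (1 - pr psi n)"
proof -
  define f where "f = (\<lambda>k. if k = n then psi n else 0)"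
  define r where "r = (\<lambda>k. if k = n then 0 else psi k)"
  have sf: "(\<lambda>k. pr f k) sums pr psi n"
    using sums_single[of n "\<lambda>k. pr psi k"] by (rule sums_cong[THEN iffD1, rotated]) (auto simp: f_def)
  have "(\<lambda>k. pr psi k - pr f k) sums (1 - pr psi n)"
    by (intro sums_diff B1_D(2) psi sf)
  then have sr: "(\<lambda>k. pr r k) sums (1 - pr psi n)"
    by (rule sums_cong[THEN iffD1, rotated]) (auto simp: f_def r_def)
  have l: "l2 f" "l2 r" using sf sr sums_summable by blast+
  have p: "(\<lambda>k. f k + r k) = psi" by (auto simp: f_def r_def)
  have "Dop a psi m = of_real (Dmat a m n) * psi n + Dop a r m" for m
  proof -
    have "Dop a f m = of_real (Dmat a m n) * psi n"
      unfolding Dop_def by (subst suminf_finite[of "{n}"]) (auto simp: f_def)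
    then show ?thesis using Dop_add[OF a l, of m] p by simp
  qed
  moreover have "cmod (Dop a r m) \<le> sqrt (1 - pr psi n)" for m
  proof (rule real_le_rsqrt)
    have "pr (Dop a r) m \<le> (\<Sum>m. pr (Dop a r) m)"
      using sum_le_suminf[OF Dop_contraction(1)[OF a l(2)], of "{m}"] by simp
    also have "\<dots> \<le> 1 - pr psi n"
      using Dop_contraction(2)[OF a l(2)] sums_unique[OF sr] by simp
    finally show "pr (Dop a r) m \<le> 1 - pr psi n" .
  qed
  ultimately show thesis by (rule that)
qed

lemma Dop_near_fock_corr:
  fixes n :: nat
  assumes a: "\<bar>a\<bar> \<le> 1" and psi: "psi \<in> B1"
  defines "\<zeta> \<equiv> sqrt (1 - pr psi n)"
  shows "\<bar>corr (Dop a psi) m - Dmat a m n * Dmat a (Suc m) n\<bar> \<le> 3 * \<zeta>"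
    and "1 - pr (Dop a psi) n \<le> 1 - (Dmat a n n)^2 + 3 * \<zeta>"
proof -
  obtain e where e: "\<And>m. Dop a psi m = of_real (Dmat a m n) * psi n + e m" "\<And>m. cmod (e m) \<le> \<zeta>"
    unfolding \<zeta>_def using Dop_near_fock[OF a psi] by blast
  have z: "cmod (psi n) \<le> 1" by (rule B1_D(3)[OF psi])
  then have "(1 - pr psi n)^2 \<le> 1 - pr psi n"
    unfolding power2_eq_square[of "1 - _"] by (intro mult_left_le) (auto simp: power_le_one)
  then have z2: "1 - pr psi n \<le> \<zeta>" unfolding \<zeta>_def by (rule real_le_rsqrt)
  have w1: "cmod (of_real (Dmat a m n) * psi n + e m) \<le> 1" for m
    using B1_D(3)[OF Dop_B1[OF a psi], of m] e(1) by simp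
  note p = perturbed_corr[OF abs_Dmat_le_1[OF a] abs_Dmat_le_1[OF a] z e(2) e(2) w1 z2]
  show "\<bar>corr (Dop a psi) m - Dmat a m n * Dmat a (Suc m) n\<bar> \<le> 3 * \<zeta>"
    unfolding corr_def e(1) by (rule p)
  have "pr (Dop a psi) n = Re (cnj (Dop a psi n) * Dop a psi n)"
    unfolding cmod_power2 by (simp add: power2_eq_square)
  then show "1 - pr (Dop a psi) n \<le> 1 - (Dmat a n n)^2 + 3 * \<zeta>"
    using p[of n n n n, folded e(1)] by (simp only: power2_eq_square)
qed

text \<open>The derivative of the truncated energy is compared with a bound \<open>q s\<close> for
  the orbit of |n> itself. The step \<open>a\<close> depends on the level and the weights alone, and
  the distance of \<open>psi\<close> from |n> enters as an additive error. Uniformity in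
  \<open>M\<close> later allows the cutoff to be removed.\<close>

lemma trunc_energy_drop:
  assumes n: "n \<noteq> nbar"
  shows "\<exists>\<kappa>>0. \<exists>a>0. a < 1 \<and> (\<forall>M psi. n < M \<longrightarrow> psi \<in> B1 \<longrightarrow>
     trunc_energy nbar M (Dop a psi) \<le> trunc_energy nbar M psi - \<kappa> * a\<^sup>2 / 2 + 36 * sqrt (1 - pr psi n) * a)"
proof -
  define b where "b m = sqrt (real (Suc m)) * (sigma_coef nbar (Suc m) - sigma_coef nbar m)" for m
  \<comment> \<open>Not simply \<open>b (n - 1)\<close>, which at \<open>n = 0\<close> would read
    \<open>b 0\<close>: no current flows below the vacuum.\<close>
  define \<beta> where "\<beta> = sqrt (real n) * (sigma_coef nbar n - sigma_coef nbar (n - 1))"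
  have bb: "\<bar>b m\<bar> \<le> 2" for m unfolding b_def by (rule sqrt_sigma_coef_step_bounded)
  have b\<beta>: "\<beta> = b (n - 1)" if "n \<noteq> 0" using that by (simp add: b_def \<beta>_def)
  have \<beta>2: "\<bar>\<beta>\<bar> \<le> 2" using bb[of "n-1"] b\<beta> by (cases "n = 0") (auto simp: \<beta>_def)
  define q where "q s = 2 * b n * (Dmat s n n * Dmat s (Suc n) n) + 2 * \<beta> * (Dmat s (n - 1) n * Dmat s n n) + 4 * (1 - (Dmat s n n)^2)" for s
  define \<kappa> where "\<kappa> = - (real (Suc n) * (sigma_coef nbar (Suc n) - sigma_coef nbar n)
       - real n * (sigma_coef nbar n - sigma_coef nbar (n - 1)))"
  have \<kappa>: "\<kappa> > 0" unfolding \<kappa>_def using sigma_coef_concave[OF n] by simp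
  have q0: "q 0 = 0" by (cases "n = 0") (auto simp: q_def Dmat_0 \<beta>_def)
  have dq: "((\<lambda>s. q s + \<kappa> * s) has_real_derivative - \<kappa>) (at 0)"
  proof -
    have D1: "((\<lambda>s. Dmat s n n) has_real_derivative 0) (at 0)"
      using Dmat_deriv[of n n 0] by (cases n) (auto simp: Dmat_0)
    have D2: "((\<lambda>s. Dmat s (Suc n) n) has_real_derivative sqrt (real (Suc n))) (at 0)"
      using Dmat_deriv[of "Suc n" n 0] by (auto simp: Dmat_0)
    have D3: "((\<lambda>s. \<beta> * Dmat s (n-1) n) has_real_derivative - \<beta> * sqrt (real n)) (at 0)"
    proof (cases "n = 0")
      case False
      then show ?thesis
        by (intro DERIV_cong[OF DERIV_cmult[OF Dmat_deriv[of "n-1" n 0]]]) (auto simp: Dmat_0)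
    qed (auto simp: \<beta>_def)
    define f where "f s = \<beta> * Dmat s (n - 1) n" for s
    have eq: "(\<lambda>s. q s + \<kappa> * s) = (\<lambda>s. 2 * b n * (Dmat s n n * Dmat s (Suc n) n) + 2 * (f s * Dmat s n n) + 4 * (1 - (Dmat s n n)^2) + \<kappa> * s)"
      by (auto simp: q_def f_def)
    have "((\<lambda>s. q s + \<kappa> * s) has_real_derivative 2 * b n * sqrt (real (Suc n)) + 2 * (- \<beta> * sqrt (real n)) + \<kappa>) (at 0)"
      unfolding eq by (auto intro!: derivative_eq_intros D1 D2 D3[folded f_def] simp: Dmat_0 simp del: of_nat_Suc)
    also have "2 * b n * sqrt (real (Suc n)) + 2 * (- \<beta> * sqrt (real n)) + \<kappa> = - \<kappa>"
    proof -
      have "b n * sqrt (real (Suc n)) = real (Suc n) * (sigma_coef nbar (Suc n) - sigma_coef nbar n)"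
        by (simp add: b_def mult_ac del: of_nat_Suc)
      moreover have "\<beta> * sqrt (real n) = real n * (sigma_coef nbar n - sigma_coef nbar (n-1))"
        by (simp add: \<beta>_def mult_ac)
      ultimately show ?thesis unfolding \<kappa>_def by (simp del: of_nat_Suc)
    qed
    finally show ?thesis .
  qed
  \<comment> \<open>The slope of \<open>q\<close> at 0 is \<open>- 2 * \<kappa>\<close>, the second
    variation at |n>. Half of it is given up so that \<open>q s \<le> - \<kappa> * s\<close> holds
    on a whole interval.\<close>
  obtain d where d: "d > 0" "\<And>h. 0 < h \<Longrightarrow> h < d \<Longrightarrow> q h + \<kappa> * h < 0"
    using DERIV_neg_dec_right[OF dq] \<kappa> q0 by auto
  define a where "a = min d 1 / 2"
  have a: "a > 0" "a < d" "a < 1" using d(1) by (auto simp: a_def min_def)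
  show ?thesis
  proof (rule exI[of _ \<kappa>], rule conjI[OF \<kappa>], rule exI[of _ a], intro conjI allI impI)
    show "a > 0" "a < 1" using a by auto
    fix M psi assume M: "n < M" and psi: "psi \<in> B1"
    let ?\<zeta> = "sqrt (1 - pr psi n)"
    let ?h = "\<lambda>s. trunc_energy nbar M (Dop s psi) + \<kappa> * s\<^sup>2 / 2 - 36 * ?\<zeta> * s"
    have "?h a \<le> ?h 0"
    proof (rule DERIV_nonpos_imp_nonincreasing[of 0 a ?h])
      fix s assume s: "0 \<le> s" "s \<le> a"
      then have s1: "\<bar>s\<bar> < 1" "\<bar>s\<bar> \<le> 1" using a by auto
      let ?w = "Dop s psi"
      let ?B = "2 * (\<Sum>m<M. b m * corr ?w m)"
      have "(?h has_real_derivative (?B + \<kappa> * s - 36 * ?\<zeta>)) (at s)"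
        unfolding b_def by (auto intro!: derivative_eq_intros trunc_energy_deriv B1_D(1) psi s1 simp del: of_nat_Suc)
      moreover have "?B + \<kappa> * s - 36 * ?\<zeta> \<le> 0"
      proof -
        note c = Dop_near_fock_corr[OF s1(2) psi, where n=n]
        have \<zeta>: "0 \<le> ?\<zeta>" using B1_D(3)[OF psi, of n] by (simp add: power_le_one)
        have 1: "b n * corr ?w n \<le> b n * (Dmat s n n * Dmat s (Suc n) n) + 6 * ?\<zeta>"
        proof -
          have "\<bar>b n * (corr ?w n - Dmat s n n * Dmat s (Suc n) n)\<bar> \<le> 2 * (3 * ?\<zeta>)"
            unfolding abs_mult using c(1)[of n] bb by (intro mult_mono) auto
          from abs_le_D1[OF this] show ?thesis by (simp add: algebra_simps)
        qed
        have 2: "(if n = 0 then 0 else 2 * b (n - 1) * corr ?w (n - 1)) \<le> 2 * \<beta> * (Dmat s (n - 1) n * Dmat s n n) + 12 * ?\<zeta>"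
        proof (cases "n = 0")
          case False
          have "\<bar>\<beta> * (corr ?w (n-1) - Dmat s (n-1) n * Dmat s n n)\<bar> \<le> 2 * (3 * ?\<zeta>)"
            unfolding abs_mult using c(1)[of "n-1"] False \<beta>2 by (intro mult_mono) auto
          from abs_le_D1[OF this] show ?thesis using False b\<beta> by (simp add: algebra_simps)
        qed (use \<zeta> in \<open>auto simp: \<beta>_def\<close>)
        \<comment> \<open>The 36 is three times 12: two currents and the lost population, each with
          weight at most 4 and an error of \<open>3 * \<zeta>\<close>.\<close>
        have arith: "A \<le> 2 * B + I + 4 * W \<Longrightarrow> B \<le> B' + 6 * z \<Longrightarrow> I \<le> J + 12 * z \<Longrightarrow> W \<le> W' + 3 * z
            \<Longrightarrow> A \<le> 2 * B' + J + 4 * W' + 36 * z" for A B B' I J W W' z :: real by linarith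
        have "?B \<le> q s + 36 * ?\<zeta>"
          using arith[OF corr_sum_bound[where b=b, OF Dop_B1[OF s1(2) psi] bb M, unfolded mult.assoc[of 2 "b n"]] 1 2 c(2)]
          unfolding q_def by (simp only: mult.assoc)
        moreover have "q s + \<kappa> * s \<le> 0" using s a q0 d(2)[of s] by (cases "s = 0") auto
        ultimately show ?thesis by linarith
      qed
      ultimately show "\<exists>y. DERIV ?h s :> y \<and> y \<le> 0" by blast
    qed (use a in auto)
    then show "trunc_energy nbar M (Dop a psi) \<le> trunc_energy nbar M psi - \<kappa> * a\<^sup>2 / 2 + 36 * ?\<zeta> * a"
      by (simp add: Dop_0)
  qed
qed

section \<open>From the truncated energy to the Lyapunov function\<close>

definition energy :: "nat \<Rightarrow> (nat \<Rightarrow> complex) \<Rightarrow> ennreal" where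
  "energy nbar psi = (\<Sum>n. ennreal (sigma_coef nbar n * pr psi n))"

text \<open>The mean of the diagonal observable \<open>x(N)\<close>. For
  \<open>x = cos2 theta ph\<close> it is the probability of outcome g.\<close>

definition wsum :: "(nat \<Rightarrow> real) \<Rightarrow> (nat \<Rightarrow> complex) \<Rightarrow> real" where
  "wsum x psi = (\<Sum>n. x n * pr psi n)"

lemma summable_wsum:
  assumes "psi \<in> B1" "\<And>n. \<bar>x n\<bar> \<le> 1"
  shows "summable (\<lambda>n. x n * pr psi n)"
proof (rule summable_comparison_test')
  show "summable (\<lambda>n. pr psi n)" by (rule B1_D(1)[OF assms(1)])
  show "norm (x n * pr psi n) \<le> pr psi n" for n
    using assms(2)[of n] by (simp add: abs_mult mult_left_le_one_le)
qed

lemma wsum_nonneg: "(\<And>n. 0 \<le> x n) \<Longrightarrow> psi \<in> B1 \<Longrightarrow> (\<And>n. x n \<le> 1) \<Longrightarrow> 0 \<le> wsum x psi"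
  unfolding wsum_def by (intro suminf_nonneg summable_wsum) (auto simp: abs_le_iff intro: order_trans)

lemma wsum_add:
  assumes "psi \<in> B1" "\<And>n. \<bar>x n\<bar> \<le> 1" "\<And>n. \<bar>y n\<bar> \<le> 1"
  shows "wsum x psi + wsum y psi = wsum (\<lambda>n. x n + y n) psi"
  unfolding wsum_def distrib_right by (intro suminf_add summable_wsum assms)

lemma wsum_const: "psi \<in> B1 \<Longrightarrow> wsum (\<lambda>_. c) psi = c"
  unfolding wsum_def by (simp add: suminf_mult B1_D(1) sums_unique[OF B1_D(2), symmetric])

lemma wsum_mono:
  assumes "psi \<in> B1" "\<And>n. \<bar>x n\<bar> \<le> 1" "\<And>n. \<bar>y n\<bar> \<le> 1" "\<And>n. x n \<le> y n"
  shows "wsum x psi \<le> wsum y psi"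
  unfolding wsum_def by (intro suminf_le summable_wsum assms mult_right_mono) auto

lemma wsum_le_1:
  assumes "psi \<in> B1" "\<And>n. \<bar>x n\<bar> \<le> 1" shows "wsum x psi \<le> 1"
  using wsum_mono[OF assms(1,2), of "\<lambda>_. 1"] wsum_const[OF assms(1)] assms(2) abs_le_D1 by fastforce

lemma wsum_near_fock:
  assumes psi: "psi \<in> B1" and x: "\<And>n. 0 \<le> x n" "\<And>n. x n \<le> 1"
  shows "\<bar>wsum x psi - x n\<bar> \<le> 1 - pr psi n"
proof -
  have s: "(\<lambda>m. (x m - x n) * pr psi m) sums (wsum x psi - x n * 1)"
    unfolding wsum_def left_diff_distrib using x
    by (intro sums_diff sums_mult summable_sums summable_wsum psi B1_D(2)) (simp add: abs_le_iff order_trans[OF _ x(1)])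
  have t: "(\<lambda>m. pr psi m - (if m = n then pr psi m else 0)) sums (1 - pr psi n)"
    by (intro sums_diff B1_D(2) psi sums_single)
  have b: "\<bar>(x m - x n) * pr psi m\<bar> \<le> pr psi m - (if m = n then pr psi m else 0)" for m
    using x(1)[of m] x(2)[of m] x(1)[of n] x(2)[of n]
    by (auto simp: abs_mult intro!: mult_left_le_one_le)
  have "wsum x psi - x n * 1 \<le> 1 - pr psi n"
    by (rule sums_le[OF _ s t]) (use b abs_le_D1 in blast)
  moreover have "- (wsum x psi - x n * 1) \<le> 1 - pr psi n"
    by (rule sums_le[OF _ sums_minus[OF s] t]) (use b abs_le_D2 in blast)
  ultimately show ?thesis by simp
qed

text \<open>A truncated energy lies above the head of the energy series and, once
  \<open>M \<ge> nbar\<close> and the weights increase, below the full energy. Hence the drop passes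
  to all heads of \<open>w\<close>, which also shows that \<open>w\<close> has finite energy
  whenever \<open>psi\<close> has. For infinite energy of \<open>psi\<close> the inequality is
  trivial.\<close>

lemma energy_drop_of_trunc:
  assumes w: "w \<in> B1" and psi: "psi \<in> B1" and d: "0 \<le> d"
    and drop: "\<And>M. L \<le> M \<Longrightarrow> trunc_energy nbar M w + d \<le> trunc_energy nbar M psi"
  shows "energy nbar w + ennreal d \<le> energy nbar psi"
proof (cases "energy nbar psi = \<top>")
  case False
  let ?s = "sigma_coef nbar"
  have sm: "summable (\<lambda>n. ?s n * pr psi n)"
    using False unfolding energy_def by (intro summable_suminf_not_top) (auto simp: sigma_coef_nonneg)
  let ?S = "\<Sum>n. ?s n * pr psi n"
  have tr: "trunc_energy nbar M v = (\<Sum>m<M. ?s m * pr v m) + ?s M * (1 - (\<Sum>m<M. pr v m))" for M v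
    by (simp add: trunc_energy_def algebra_simps sum_subtractf sum_distrib_left)
  have up: "trunc_energy nbar M psi \<le> ?S" if M: "nbar \<le> M" for M
  proof -
    have 1: "(\<lambda>m. if m < M then 0 else pr psi m) sums (1 - (\<Sum>m<M. pr psi m))"
      using suminf_split_if_lessThan(2)[OF B1_D(1)[OF psi], of M] sums_unique[OF B1_D(2)[OF psi]] by simp
    note 2 = suminf_split_if_lessThan(2)[OF sm, of M]
    have "?s M * (1 - (\<Sum>m<M. pr psi m)) \<le> ?S - (\<Sum>m<M. ?s m * pr psi m)"
      by (rule sums_le[OF _ sums_mult[OF 1, of "?s M"] 2]) (auto intro!: mult_right_mono sigma_coef_mono M)
    then show ?thesis unfolding tr by linarith
  qed
  have low: "(\<Sum>m<M. ?s m * pr w m) \<le> trunc_energy nbar M w" for M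
    unfolding tr using B1_D(4)[OF w, of "{..<M}"] sigma_coef_nonneg[of nbar M] by simp
  have le: "(\<Sum>m<M. ?s m * pr w m) \<le> ?S - d" for M
  proof -
    obtain K where K: "M \<le> K" "L \<le> K" "nbar \<le> K" by (meson nat_le_linear order_trans)
    have "(\<Sum>m<M. ?s m * pr w m) \<le> (\<Sum>m<K. ?s m * pr w m)"
      using K by (intro sum_mono2) (auto simp: sigma_coef_nonneg)
    also have "\<dots> \<le> ?S - d" using low[of K] up[of K] drop[of K] K by linarith
    finally show ?thesis .
  qed
  have sw: "summable (\<lambda>n. ?s n * pr w n)"
    by (rule bounded_imp_summable[of _ "?S - d"]) (use le[of "Suc _"] in \<open>auto simp: lessThan_Suc_atMost sigma_coef_nonneg\<close>)
  have "(\<Sum>n. ?s n * pr w n) \<le> ?S - d" by (rule suminf_le_const[OF sw le])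
  moreover have "energy nbar w = ennreal (\<Sum>n. ?s n * pr w n)" "energy nbar psi = ennreal ?S"
    unfolding energy_def by (intro suminf_ennreal2 sw sm mult_nonneg_nonneg sigma_coef_nonneg; simp)+
  moreover have "0 \<le> (\<Sum>n. ?s n * pr w n)" by (intro suminf_nonneg sw) (auto simp: sigma_coef_nonneg)
  ultimately show ?thesis using d by (simp flip: ennreal_plus)
qed simp

text \<open>\<open>V\<close> up to an additive constant: \<open>1 - X\<^sup>2 - (1 - X)\<^sup>2 = 2X(1 - X)\<close> for \<open>X = \<parallel>M\<^sub>g \<psi>\<parallel>\<^sup>2\<close>. The shift makes it
  nonnegative.\<close>

definition lyap :: "nat \<Rightarrow> (nat \<Rightarrow> real) \<Rightarrow> real \<Rightarrow> (nat \<Rightarrow> complex) \<Rightarrow> ennreal" where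
  "lyap nbar x \<delta> psi = energy nbar psi + ennreal (\<delta> * (2 * wsum x psi * (1 - wsum x psi)))"

lemma lyap_control_drop:
  assumes n: "n \<noteq> nbar" and x: "\<And>n. 0 \<le> x n" "\<And>n. x n \<le> 1"
  shows "\<exists>\<delta>0>0. \<forall>\<delta>. 0 < \<delta> \<longrightarrow> \<delta> \<le> \<delta>0 \<longrightarrow> (\<exists>\<eta>>0. \<exists>c>0. \<exists>a. 0 \<le> a \<and> a \<le> 1 \<and>
    (\<forall>psi\<in>B1. 1 - \<eta> \<le> pr psi n \<longrightarrow> lyap nbar x \<delta> (Dop a psi) + ennreal c \<le> lyap nbar x \<delta> psi))"
proof -
  obtain \<kappa> a where \<kappa>: "\<kappa> > 0" and a: "0 < a" "a < 1" and
    drop: "\<And>M psi. n < M \<Longrightarrow> psi \<in> B1 \<Longrightarrow>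
     trunc_energy nbar M (Dop a psi) \<le> trunc_energy nbar M psi - \<kappa> * a\<^sup>2 / 2 + 36 * sqrt (1 - pr psi n) * a"
    using trunc_energy_drop[OF n] by blast
  have a1: "\<bar>a\<bar> \<le> 1" using a by simp
  \<comment> \<open>The \<delta>-term grows by at most \<open>2 * \<delta> * |X - Y|\<close>, whose
    quadratic part is \<open>8 * \<delta> * (n + 2) * a^2\<close>; this threshold keeps it below
    \<open>\<kappa> * a^2 / 4\<close>. Both effects being quadratic, \<delta>0 does not depend on
    \<open>a\<close>.\<close>
  define \<delta>0 where "\<delta>0 = min 1 (\<kappa> / (32 * real (n + 2)))"
  \<comment> \<open>Errors linear in \<zeta> have total coefficient 44 = 36 + 8, and 352 = 8 * 44
    keeps them below \<open>\<kappa> * a^2 / 8\<close>. Of the gain 1/2, after losses 1/4 and 1/8,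
    the net drop 1/8 remains.\<close>
  define \<zeta>0 where "\<zeta>0 = \<kappa> * a\<^sup>2 / 352"
  have \<zeta>0: "\<zeta>0 > 0" unfolding \<zeta>0_def using \<kappa> a by simp
  show ?thesis
  proof (rule exI[of _ \<delta>0], intro conjI allI impI)
    show "0 < \<delta>0" unfolding \<delta>0_def using \<kappa> by simp
    fix \<delta> :: real assume \<delta>: "0 < \<delta>" "\<delta> \<le> \<delta>0"
    then have \<delta>1: "\<delta> \<le> 1" and \<delta>2: "\<delta> * (8 * real (n + 2)) \<le> \<kappa> / 4"
      unfolding \<delta>0_def by (auto simp: field_simps)
    have key: "lyap nbar x \<delta> (Dop a psi) + ennreal (\<kappa> * a\<^sup>2 / 8) \<le> lyap nbar x \<delta> psi"
      if psi: "psi \<in> B1" and near: "1 - \<zeta>0\<^sup>2 \<le> pr psi n" for psi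
    proof -
      define \<zeta> where "\<zeta> = sqrt (1 - pr psi n)"
      let ?w = "Dop a psi"
      have w: "?w \<in> B1" by (rule Dop_B1[OF a1 psi])
      have c1: "0 \<le> 1 - pr psi n" using B1_D(3)[OF psi, of n] by (simp add: power_le_one)
      have \<zeta>: "0 \<le> \<zeta>" "\<zeta>\<^sup>2 = 1 - pr psi n" using c1 by (auto simp: \<zeta>_def)
      have \<zeta>le: "\<zeta> \<le> \<zeta>0" unfolding \<zeta>_def using near \<zeta>0 by (intro real_le_lsqrt) auto
      have \<zeta>1: "\<zeta> \<le> 1" unfolding \<zeta>_def using c1 by simp
      have \<zeta>2: "\<zeta>\<^sup>2 \<le> \<zeta>" unfolding power2_eq_square by (rule mult_left_le[OF \<zeta>1 \<zeta>(1)])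
      have \<zeta>a: "36 * \<zeta> * a \<le> 36 * \<zeta>" using \<zeta> a by (simp add: mult_left_le)
      have k44: "44 * \<zeta> \<le> \<kappa> * a\<^sup>2 / 8" using \<zeta>le unfolding \<zeta>0_def by simp
      define d where "d = \<kappa> * a\<^sup>2 / 2 - 36 * \<zeta> * a"
      have ka: "\<kappa> * a\<^sup>2 > 0" using \<kappa> a by simp
      have d0: "0 \<le> d" unfolding d_def using k44 \<zeta>a \<zeta>(1) ka by linarith
      have E: "energy nbar ?w + ennreal d \<le> energy nbar psi"
      proof (rule energy_drop_of_trunc[OF w psi d0, where L="Suc n"])
        fix M assume "Suc n \<le> M"
        then show "trunc_energy nbar M ?w + d \<le> trunc_energy nbar M psi"
          using drop[of M psi] psi unfolding d_def \<zeta>_def by simp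
      qed
      define X where "X = wsum x ?w"
      define Y where "Y = wsum x psi"
      have xx: "\<bar>x m\<bar> \<le> 1" for m using x[of m] by simp
      have X01: "0 \<le> X" "X \<le> 1" "0 \<le> Y" "Y \<le> 1" unfolding X_def Y_def
        by (intro wsum_nonneg wsum_le_1 w psi x xx)+
      have "\<bar>X - Y\<bar> \<le> (1 - pr ?w n) + (1 - pr psi n)"
        using wsum_near_fock[OF w, of x n] wsum_near_fock[OF psi, of x n] x unfolding X_def Y_def by (simp; linarith)
      also have "\<dots> \<le> (1 - (Dmat a n n)^2) + 3 * \<zeta> + \<zeta>"
        using Dop_near_fock_corr(2)[OF a1 psi, of n] \<zeta>2 \<zeta> unfolding \<zeta>_def by simp
      also have "\<dots> \<le> 4 * real (n + 2) * a\<^sup>2 + 4 * \<zeta>"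
        using Dmat_diagonal_ge[of a n] a by simp
      finally have XY: "\<bar>X - Y\<bar> \<le> 4 * real (n + 2) * a\<^sup>2 + 4 * \<zeta>" .
      have G: "2 * X * (1 - X) - 2 * Y * (1 - Y) \<le> 2 * \<bar>X - Y\<bar>"
      proof -
        have "2 * X * (1 - X) - 2 * Y * (1 - Y) = 2 * ((X - Y) * (1 - X - Y))" by (simp add: algebra_simps)
        also have "(X - Y) * (1 - X - Y) \<le> \<bar>X - Y\<bar> * \<bar>1 - X - Y\<bar>" by (metis abs_ge_self abs_mult)
        also have "\<dots> \<le> \<bar>X - Y\<bar> * 1" using X01 by (intro mult_left_mono) auto
        finally show ?thesis by simp
      qed
      have "\<delta> * (2 * X * (1 - X) - 2 * Y * (1 - Y)) \<le> \<delta> * (2 * (4 * real (n + 2) * a\<^sup>2 + 4 * \<zeta>))"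
        using G XY \<delta> by (intro mult_left_mono) auto
      also have "\<dots> = (\<delta> * (8 * real (n + 2))) * a\<^sup>2 + \<delta> * (8 * \<zeta>)" by (simp add: algebra_simps)
      also have "\<dots> \<le> (\<kappa> / 4) * a\<^sup>2 + 1 * (8 * \<zeta>)"
        using \<delta>2 \<delta>1 \<zeta> by (intro add_mono mult_right_mono) auto
      finally have "\<delta> * (2 * X * (1 - X)) + \<kappa> * a\<^sup>2 / 8 \<le> d + \<delta> * (2 * Y * (1 - Y))"
        unfolding d_def right_diff_distrib using k44 \<zeta>a by simp
      then have R: "ennreal (\<delta> * (2 * X * (1 - X))) + ennreal (\<kappa> * a\<^sup>2 / 8) \<le> ennreal d + ennreal (\<delta> * (2 * Y * (1 - Y)))"
        using \<delta> X01 d0 ka by (simp flip: ennreal_plus)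
      have "lyap nbar x \<delta> ?w + ennreal (\<kappa> * a\<^sup>2 / 8) = energy nbar ?w + (ennreal (\<delta> * (2 * X * (1 - X))) + ennreal (\<kappa> * a\<^sup>2 / 8))"
        by (simp add: lyap_def X_def add.assoc)
      also have "\<dots> \<le> energy nbar ?w + (ennreal d + ennreal (\<delta> * (2 * Y * (1 - Y))))"
        by (intro add_left_mono R)
      also have "\<dots> = (energy nbar ?w + ennreal d) + ennreal (\<delta> * (2 * Y * (1 - Y)))" by (simp add: add.assoc)
      also have "\<dots> \<le> lyap nbar x \<delta> psi"
        unfolding lyap_def Y_def by (intro add_right_mono E)
      finally show ?thesis .
    qed
    moreover have "\<zeta>0\<^sup>2 > 0" "\<kappa> * a\<^sup>2 / 8 > 0" "0 \<le> a" "a \<le> 1" using \<zeta>0 \<kappa> a by auto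
    ultimately show "\<exists>\<eta>>0. \<exists>c>0. \<exists>a. 0 \<le> a \<and> a \<le> 1 \<and>
      (\<forall>psi\<in>B1. 1 - \<eta> \<le> pr psi n \<longrightarrow> lyap nbar x \<delta> (Dop a psi) + ennreal c \<le> lyap nbar x \<delta> psi)"
      by blast
  qed
qed

section \<open>The measurement step\<close>

definition cos2 :: "real \<Rightarrow> real \<Rightarrow> nat \<Rightarrow> real" where
  "cos2 theta ph n = (cos (theta + real n * ph))^2"

definition outw :: "bool \<Rightarrow> (nat \<Rightarrow> real) \<Rightarrow> nat \<Rightarrow> real" where
  "outw b x n = (if b then x n else 1 - x n)"

lemma cos2_bounds: "0 \<le> cos2 theta ph n" "cos2 theta ph n \<le> 1"
  by (auto simp: cos2_def abs_square_le_1)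

lemma cmod_Mop: "pr (Mop b theta ph psi) n = outw b (cos2 theta ph) n * pr psi n"
  by (simp add: Mop_def outw_def cos2_def norm_mult power_mult_distrib sin_squared_eq)

lemma pout_eq: "psi \<in> B1 \<Longrightarrow> pout b theta ph psi = wsum (outw b (cos2 theta ph)) psi"
  unfolding pout_def l2norm_def cmod_Mop wsum_def
  by (intro real_sqrt_pow2 suminf_nonneg summable_wsum) (auto simp: outw_def cos2_bounds abs_le_iff intro: order_trans[OF _ cos2_bounds(1)])

lemma wsum_outw:
  assumes "psi \<in> B1" "\<And>n. 0 \<le> x n" "\<And>n. x n \<le> 1"
  shows "wsum (outw b x) psi = (if b then wsum x psi else 1 - wsum x psi)"
proof -
  have "wsum x psi + wsum (\<lambda>n. 1 - x n) psi = wsum (\<lambda>n. x n + (1 - x n)) psi"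
    using assms by (intro wsum_add) (auto simp: abs_le_iff intro: order_trans[OF _ assms(2)])
  then show ?thesis using wsum_const[OF assms(1), of 1]
    by (cases b) (auto simp: outw_def[abs_def])
qed

text \<open>In this product form Bayes' rule also covers an outcome of probability 0, where
  \<open>halfstep\<close> has its default value and both sides vanish.\<close>

lemma cmod_halfstep:
  assumes "psi \<in> B1"
  shows "pout b theta ph psi * pr (halfstep b theta ph psi) n = outw b (cos2 theta ph) n * pr psi n"
proof (cases "l2norm (Mop b theta ph psi) = 0")
  case True
  then have p: "pout b theta ph psi = 0" by (simp add: pout_def)
  have o: "0 \<le> outw b (cos2 theta ph) n" "\<bar>outw b (cos2 theta ph) n\<bar> \<le> 1" for n
    using cos2_bounds[of theta ph n] by (auto simp: outw_def)
  have "(\<Sum>n. outw b (cos2 theta ph) n * pr psi n) = 0"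
    using p pout_eq[OF assms] by (simp add: wsum_def)
  then have "outw b (cos2 theta ph) n * pr psi n = 0"
    by (subst (asm) suminf_eq_zero_iff) (auto intro!: summable_wsum assms o mult_nonneg_nonneg)
  with p show ?thesis by simp
next
  case False
  then show ?thesis by (simp add: halfstep_def pout_def norm_divide power_divide cmod_Mop)
qed

lemma halfstep_B1:
  assumes "psi \<in> B1" shows "halfstep b theta ph psi \<in> B1"
proof (cases "l2norm (Mop b theta ph psi) = 0")
  case False
  then have p: "pout b theta ph psi \<noteq> 0" by (simp add: pout_def)
  have o: "\<bar>outw b (cos2 theta ph) n\<bar> \<le> 1" for n
    using cos2_bounds[of theta ph n] by (auto simp: outw_def)
  have e: "pr (halfstep b theta ph psi) n = outw b (cos2 theta ph) n * pr psi n / pout b theta ph psi" for n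
    using cmod_halfstep[OF assms, of b theta ph n] p by (simp add: field_simps)
  have "(\<lambda>n. outw b (cos2 theta ph) n * pr psi n / pout b theta ph psi) sums (pout b theta ph psi / pout b theta ph psi)"
    by (intro sums_divide) (simp add: pout_eq[OF assms] wsum_def summable_sums summable_wsum assms o)
  then show ?thesis using p unfolding B1_def by (auto simp: e sums_iff)
qed (use assms in \<open>simp add: halfstep_def\<close>)

lemma wsum_halfstep:
  assumes "psi \<in> B1" "\<And>n. \<bar>x n\<bar> \<le> 1"
  shows "pout b theta ph psi * wsum x (halfstep b theta ph psi) = wsum (\<lambda>n. x n * outw b (cos2 theta ph) n) psi"
proof -
  have "pout b theta ph psi * wsum x (halfstep b theta ph psi) = (\<Sum>n. pout b theta ph psi * (x n * pr (halfstep b theta ph psi) n))"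
    unfolding wsum_def by (intro suminf_mult[symmetric] summable_wsum halfstep_B1 assms)
  also have "\<dots> = wsum (\<lambda>n. x n * outw b (cos2 theta ph) n) psi"
    unfolding wsum_def mult.left_commute[of "pout b theta ph psi"] cmod_halfstep[OF assms(1)] by (simp add: mult_ac)
  finally show ?thesis .
qed

text \<open>The measurement is diagonal in the Fock basis, so the populations after it, averaged
  over the outcomes, are those before: cos^2 + sin^2 = 1 makes each of them a martingale.\<close>

lemma energy_halfstep:
  assumes "psi \<in> B1"
  shows "ennreal (pout True theta ph psi) * energy nbar (halfstep True theta ph psi)
    + ennreal (pout False theta ph psi) * energy nbar (halfstep False theta ph psi) = energy nbar psi"
proof -
  have p: "0 \<le> pout b theta ph psi" for b by (simp add: pout_def)
  have o: "0 \<le> outw b (cos2 theta ph) n" for b n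
    using cos2_bounds[of theta ph n] by (auto simp: outw_def)
  have 1: "ennreal (pout b theta ph psi) * energy nbar (halfstep b theta ph psi) =
     (\<Sum>n. ennreal (sigma_coef nbar n * (outw b (cos2 theta ph) n * pr psi n)))" for b
    unfolding energy_def ennreal_suminf_cmult[symmetric] cmod_halfstep[OF assms, symmetric]
    by (simp add: ennreal_mult[symmetric] p sigma_coef_nonneg mult_ac)
  have "ennreal (sigma_coef nbar n * (outw True (cos2 theta ph) n * pr psi n))
      + ennreal (sigma_coef nbar n * (outw False (cos2 theta ph) n * pr psi n))
      = ennreal (sigma_coef nbar n * pr psi n)" for n
    by (simp only: ennreal_plus[symmetric] mult_nonneg_nonneg sigma_coef_nonneg o zero_le_power2)
      (simp add: outw_def algebra_simps)
  then show ?thesis unfolding 1 unfolding energy_def by (subst suminf_add[OF summableI summableI]) simp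
qed

definition xvar :: "(nat \<Rightarrow> real) \<Rightarrow> (nat \<Rightarrow> complex) \<Rightarrow> real" where
  "xvar x psi = wsum (\<lambda>n. (x n)^2) psi - (wsum x psi)^2"

text \<open>With \<open>X\<close>, \<open>Y\<close> the first two moments, the mean of the impurity \<open>2X(1-X)\<close> after the measurement
  is smaller than before it by exactly \<open>2(Y-X\<^sup>2)\<^sup>2/(X(1-X))\<close>.\<close>

lemma impurity_drop:
  fixes X Y A B :: real
  assumes "0 \<le> Y" "Y \<le> X" "X - Y \<le> 1 - X" "X * A = Y" "(1 - X) * B = X - Y"
  shows "X * (2 * A * (1 - A)) + (1 - X) * (2 * B * (1 - B)) + 8 * (Y - X\<^sup>2)^2 \<le> 2 * X * (1 - X)"
proof -
  consider "X = 0" | "X = 1" | "0 < X" "X < 1" using assms by linarith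
  then show ?thesis
  proof cases
    case 3
    have A: "A = Y / X" and B: "B = (X - Y) / (1 - X)" using assms 3 by (auto simp: field_simps)
    have eq: "2 * X * (1 - X) - (X * (2 * A * (1 - A)) + (1 - X) * (2 * B * (1 - B))) = 2 * (Y - X\<^sup>2)^2 / (X * (1 - X))"
    proof -
      have "X * (1 - X) * (2 * X * (1 - X) - (X * (2 * A * (1 - A)) + (1 - X) * (2 * B * (1 - B)))) =
        2 * (X * (1 - X))^2 - (2 * (1 - X) * (X * A) * (X - X * A) + 2 * X * ((1 - X) * B) * ((1 - X) - (1 - X) * B))"
        by (simp add: power2_eq_square algebra_simps)
      also have "\<dots> = 2 * (Y - X\<^sup>2)^2" unfolding assms(4,5) by (simp add: power2_eq_square algebra_simps)
      finally show ?thesis using 3 by (simp add: field_simps)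
    qed
    \<comment> \<open>The denominator of the exact drop is at most 1/4; this is the origin of the
      constant 8, and it gives a lower bound that stays polynomial in the moments.\<close>
    have "4 * (X * (1 - X)) \<le> 1" using zero_le_power2[of "2 * X - 1"] by (simp add: power2_eq_square algebra_simps)
    then have "8 * (Y - X\<^sup>2)^2 * (X * (1 - X)) \<le> 2 * (Y - X\<^sup>2)^2"
      using mult_right_mono[of "4 * (X * (1 - X))" 1 "2 * (Y - X\<^sup>2)^2"] by (simp only: mult_ac mult_1_left) simp
    then have "8 * (Y - X\<^sup>2)^2 \<le> 2 * (Y - X\<^sup>2)^2 / (X * (1 - X))" using 3 by (simp add: pos_le_divide_eq)
    with eq show ?thesis by linarith
  qed (use assms in auto)
qed

lemma impurity_halfstep:
  fixes theta ph :: real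
  assumes psi: "psi \<in> B1"
  defines "x \<equiv> cos2 theta ph"
  defines "G \<equiv> \<lambda>psi. 2 * wsum x psi * (1 - wsum x psi)"
  shows "pout True theta ph psi * G (halfstep True theta ph psi) + pout False theta ph psi * G (halfstep False theta ph psi)
     + 8 * (xvar x psi)^2 \<le> G psi"
proof -
  have x: "0 \<le> x n" "x n \<le> 1" "\<bar>x n\<bar> \<le> 1" "\<bar>x n * x n\<bar> \<le> 1" "\<bar>x n - x n * x n\<bar> \<le> 1" "x n * x n \<le> x n" for n
    using cos2_bounds[of theta ph n] mult_left_le[of "x n" "x n"] by (auto simp: x_def abs_le_iff mult_le_one)
       (smt (verit) mult_nonneg_nonneg)+
  define X where "X = wsum x psi"
  define Y where "Y = wsum (\<lambda>n. x n * x n) psi"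
  have pT: "pout True theta ph psi = X" and pF: "pout False theta ph psi = 1 - X"
    using wsum_outw[OF psi x(1,2)] pout_eq[OF psi] by (auto simp: X_def x_def)
  have T: "X * wsum x (halfstep True theta ph psi) = Y"
    using wsum_halfstep[OF psi, of x True theta ph, OF x(3)] pT by (simp add: Y_def outw_def x_def[symmetric])
  have "wsum (\<lambda>n. x n * x n) psi + wsum (\<lambda>n. x n - x n * x n) psi = wsum (\<lambda>n. x n * x n + (x n - x n * x n)) psi"
    by (intro wsum_add psi x)
  then have XY: "wsum (\<lambda>n. x n - x n * x n) psi = X - Y" by (simp add: X_def Y_def)
  have F: "(1 - X) * wsum x (halfstep False theta ph psi) = X - Y"
    using wsum_halfstep[OF psi, of x False theta ph, OF x(3)] XY unfolding pF
    by (simp add: outw_def x_def[symmetric] right_diff_distrib)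
  have "0 \<le> Y" unfolding Y_def using x(1,4) by (intro wsum_nonneg psi) (auto simp: abs_le_iff)
  moreover have "Y \<le> X" unfolding Y_def X_def by (intro wsum_mono psi x)
  \<comment> \<open>From \<open>(1 - x)^2 \<ge> 0\<close>. It settles the degenerate case of a
    certain outcome: \<open>X = 1\<close> forces \<open>Y = 1\<close>.\<close>
  moreover have "X - Y \<le> 1 - X"
  proof -
    have "x n - x n * x n \<le> 1 - x n" for n
      using mult_nonneg_nonneg[of "1 - x n" "1 - x n"] x(2)[of n] by (simp add: algebra_simps)
    then have "X - Y \<le> wsum (\<lambda>n. 1 - x n) psi"
      unfolding XY[symmetric] using x by (intro wsum_mono psi) (auto simp: abs_le_iff intro: order_trans[OF _ x(1)])
    also have "\<dots> = 1 - X" using wsum_outw[OF psi x(1,2), of False] by (simp add: outw_def[abs_def] X_def)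
    finally show ?thesis .
  qed
  ultimately have "X * (2 * wsum x (halfstep True theta ph psi) * (1 - wsum x (halfstep True theta ph psi)))
     + (1 - X) * (2 * wsum x (halfstep False theta ph psi) * (1 - wsum x (halfstep False theta ph psi)))
     + 8 * (Y - X\<^sup>2)^2 \<le> 2 * X * (1 - X)"
    by (intro impurity_drop T F)
  moreover have "xvar x psi = Y - X\<^sup>2" by (simp add: xvar_def X_def Y_def power2_eq_square[of "x _"])
  ultimately show ?thesis by (simp add: G_def pT pF flip: X_def)
qed

lemma lyap_halfstep:
  fixes theta ph :: real
  assumes psi: "psi \<in> B1" and \<delta>: "0 \<le> \<delta>"
  defines "x \<equiv> cos2 theta ph"
  shows "ennreal (pout True theta ph psi) * lyap nbar x \<delta> (halfstep True theta ph psi)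
     + ennreal (pout False theta ph psi) * lyap nbar x \<delta> (halfstep False theta ph psi)
     + ennreal (8 * \<delta> * (xvar x psi)^2) \<le> lyap nbar x \<delta> psi"
proof -
  let ?p = "\<lambda>b. pout b theta ph psi" and ?h = "\<lambda>b. halfstep b theta ph psi"
  let ?G = "\<lambda>psi. 2 * wsum x psi * (1 - wsum x psi)"
  have x: "0 \<le> x n" "x n \<le> 1" "\<bar>x n\<bar> \<le> 1" for n using cos2_bounds by (auto simp: x_def)
  have G: "0 \<le> ?G v" if "v \<in> B1" for v
    using wsum_nonneg[OF x(1) that x(2)] wsum_le_1[OF that x(3)] by simp
  have p: "0 \<le> pout b theta ph psi" for b by (simp add: pout_def)
  note h = halfstep_B1[OF psi]
  have R: "ennreal (?p True) * ennreal (\<delta> * ?G (?h True)) +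
     ennreal (?p False) * ennreal (\<delta> * ?G (?h False)) + ennreal (8 * \<delta> * (xvar x psi)^2)
     \<le> ennreal (\<delta> * ?G psi)"
  proof -
    have "\<delta> * (?p True * ?G (?h True) + ?p False * ?G (?h False)
     + 8 * (xvar x psi)^2) \<le> \<delta> * ?G psi"
      unfolding x_def by (intro mult_left_mono impurity_halfstep psi \<delta>)
    then have "?p True * (\<delta> * ?G (?h True)) + ?p False * (\<delta> * ?G (?h False))
     + 8 * \<delta> * (xvar x psi)^2 \<le> \<delta> * ?G psi"
      by (simp only: distrib_left mult.left_commute[of \<delta>] mult.assoc)
    then have "ennreal (?p True * (\<delta> * ?G (?h True)) + ?p False * (\<delta> * ?G (?h False))
     + 8 * \<delta> * (xvar x psi)^2) \<le> ennreal (\<delta> * ?G psi)" by (rule ennreal_leI)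
    then show ?thesis
      using G[OF h] p \<delta> by (simp only: ennreal_plus ennreal_mult mult_nonneg_nonneg add_nonneg_nonneg zero_le_power2 zero_le_numeral)
  qed
  have "ennreal (?p True) * lyap nbar x \<delta> (?h True)
     + ennreal (?p False) * lyap nbar x \<delta> (?h False)
     + ennreal (8 * \<delta> * (xvar x psi)^2) =
    (ennreal (?p True) * energy nbar (?h True)
    + ennreal (?p False) * energy nbar (?h False)) +
    (ennreal (?p True) * ennreal (\<delta> * ?G (?h True)) +
     ennreal (?p False) * ennreal (\<delta> * ?G (?h False)) + ennreal (8 * \<delta> * (xvar x psi)^2))"
    unfolding lyap_def distrib_left by (simp only: ac_simps)
  also have "\<dots> \<le> lyap nbar x \<delta> psi"
    unfolding energy_halfstep[OF psi] lyap_def by (intro add_left_mono R)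
  finally show ?thesis .
qed

text \<open>Times the outcome probability, the mass outside level \<open>n\<close> cannot grow in a
  measurement. Dividing by a probability of at least 1/2 therefore at most doubles it.\<close>

lemma halfstep_near_fock:
  assumes psi: "psi \<in> B1" and near: "1 - \<eta> / 2 \<le> pr psi n" and p: "1/2 \<le> pout b theta ph psi"
  shows "1 - \<eta> \<le> pr (halfstep b theta ph psi) n"
proof -
  let ?y = "outw b (cos2 theta ph)"
  let ?c = "pr psi n"
  have y: "0 \<le> ?y m" "?y m \<le> 1" "\<bar>?y m\<bar> \<le> 1" for m using cos2_bounds[of theta ph m] by (auto simp: outw_def)
  have t: "(\<lambda>m. pr psi m - (if m = n then (1 - ?y n) * pr psi m else 0)) sums (1 - (1 - ?y n) * ?c)"
    by (intro sums_diff B1_D(2) psi sums_single[of n "\<lambda>m. (1 - ?y n) * pr psi m"])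
  have "wsum ?y psi \<le> 1 - (1 - ?y n) * ?c"
    unfolding wsum_def
  proof (rule sums_le[OF _ summable_sums t])
    show "summable (\<lambda>n. ?y n * pr psi n)" by (intro summable_wsum psi y)
    show "?y m * pr psi m \<le> pr psi m - (if m = n then (1 - ?y n) * pr psi m else 0)" for m
      using y[of m] by (auto simp: algebra_simps intro!: mult_left_le_one_le)
  qed
  then have P: "pout b theta ph psi \<le> 1 - ?c + ?y n * ?c"
    unfolding pout_eq[OF psi] by (simp add: algebra_simps)
  let ?P = "pout b theta ph psi"
  let ?h = "pr (halfstep b theta ph psi) n"
  have "?P * ?h = ?y n * ?c" by (rule cmod_halfstep[OF psi])
  then have "?P * (1 - ?h) \<le> 1 - ?c" using P by (simp add: algebra_simps)
  moreover have "0 \<le> 1 - ?h" using B1_D(3)[OF halfstep_B1[OF psi], of b theta ph n] by (simp add: power_le_one)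
  ultimately have "1/2 * (1 - ?h) \<le> 1 - ?c" using p mult_right_mono[of "1/2" ?P "1 - ?h"] by linarith
  moreover have "1 - \<eta> \<le> h" if "1/2 * (1 - h) \<le> 1 - c" "1 - \<eta> / 2 \<le> c" for h c :: real
    using that by (simp add: field_simps)
  ultimately show ?thesis using near by blast
qed

lemma lyap_fullstep:
  fixes theta ph :: real
  assumes psi: "psi \<in> B1" and \<delta>: "0 \<le> \<delta>" and c: "0 \<le> c"
  defines "x \<equiv> cos2 theta ph"
  assumes fb: "\<And>v. v \<in> B1 \<Longrightarrow> lyap nbar x \<delta> (Dop (fb v) v) \<le> lyap nbar x \<delta> v"
    and near: "\<And>v. v \<in> B1 \<Longrightarrow> 1 - \<eta> \<le> pr v n \<Longrightarrow> lyap nbar x \<delta> (Dop (fb v) v) + ennreal c \<le> lyap nbar x \<delta> v"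
  shows "ennreal (pout True theta ph psi) * lyap nbar x \<delta> (fullstep True theta ph fb psi)
     + ennreal (pout False theta ph psi) * lyap nbar x \<delta> (fullstep False theta ph fb psi)
     + ennreal (8 * \<delta> * (xvar x psi)^2 + c / 2 * indicator {psi. 1 - \<eta> / 2 \<le> pr psi n} psi) \<le> lyap nbar x \<delta> psi"
proof -
  note h = halfstep_B1[OF psi]
  let ?p = "\<lambda>b. pout b theta ph psi"
  let ?f = "\<lambda>b. lyap nbar x \<delta> (fullstep b theta ph fb psi)"
  let ?h = "\<lambda>b. lyap nbar x \<delta> (halfstep b theta ph psi)"
  let ?I = "c / 2 * indicator {psi. 1 - \<eta> / 2 \<le> pr psi n} psi :: real"
  have f: "?f b \<le> ?h b" for b unfolding fullstep_def by (intro fb h)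
  have I: "ennreal (?p True) * ?f True + ennreal (?p False) * ?f False + ennreal ?I
     \<le> ennreal (?p True) * ?h True + ennreal (?p False) * ?h False"
  proof (cases "1 - \<eta> / 2 \<le> pr psi n")
    case False
    then show ?thesis using f by (auto intro!: add_mono mult_left_mono)
  next
    case True
    have strong: "ennreal (?p b) * ?f b + ennreal ?I \<le> ennreal (?p b) * ?h b" if "1/2 \<le> ?p b" for b
    proof -
      have "ennreal ?I \<le> ennreal (?p b) * ennreal c"
        using True that c mult_right_mono[OF that c] by (simp add: ennreal_mult[symmetric] pout_def)
      then have "ennreal (?p b) * ?f b + ennreal ?I \<le> ennreal (?p b) * ?f b + ennreal (?p b) * ennreal c"
        by (rule add_left_mono)
      also have "\<dots> = ennreal (?p b) * (?f b + ennreal c)" by (simp add: distrib_left)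
      also have "\<dots> \<le> ennreal (?p b) * ?h b"
        unfolding fullstep_def by (intro mult_left_mono near h halfstep_near_fock[OF psi True that]) auto
      finally show ?thesis .
    qed
    have "?p True + ?p False = 1"
      using wsum_outw[OF psi cos2_bounds] by (simp add: pout_eq[OF psi])
    then consider "1/2 \<le> ?p True" | "1/2 \<le> ?p False" by linarith
    then show ?thesis
    proof cases
      case 1
      show ?thesis using add_mono[OF strong[OF 1] mult_left_mono[OF f[of False], of "ennreal (?p False)"]] by (simp add: ac_simps)
    next
      case 2
      show ?thesis using add_mono[OF mult_left_mono[OF f[of True], of "ennreal (?p True)"] strong[OF 2]] by (simp add: ac_simps)
    qed
  qed
  have "ennreal (8 * \<delta> * (xvar x psi)^2 + ?I) = ennreal (8 * \<delta> * (xvar x psi)^2) + ennreal ?I"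
    using \<delta> c by (intro ennreal_plus) auto
  then have "ennreal (?p True) * ?f True + ennreal (?p False) * ?f False + ennreal (8 * \<delta> * (xvar x psi)^2 + ?I)
    = (ennreal (?p True) * ?f True + ennreal (?p False) * ?f False + ennreal ?I) + ennreal (8 * \<delta> * (xvar x psi)^2)"
    by (simp only: ac_simps)
  also have "\<dots> \<le> (ennreal (?p True) * ?h True + ennreal (?p False) * ?h False) + ennreal (8 * \<delta> * (xvar x psi)^2)"
    by (rule add_right_mono[OF I])
  also have "\<dots> \<le> lyap nbar x \<delta> psi"
    unfolding x_def by (rule lyap_halfstep[OF psi \<delta>])
  finally show ?thesis .
qed

text \<open>The shift \<open>e\<close> is \<delta> times the impurity of the target. It does not
  affect the minimisation, and being at most \<delta> it turns a bound on the mean of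
  \<open>V\<close> into one on the mean of \<open>lyap\<close> at the price of \<delta>.\<close>

lemma Vlyap_lyap:
  assumes \<delta>: "0 \<le> \<delta>"
  shows "\<exists>e. 0 \<le> e \<and> e \<le> \<delta> \<and> (\<forall>psi\<in>B1. Vlyap nbar theta ph \<delta> psi = enn2ereal (lyap nbar (cos2 theta ph) \<delta> psi) - ereal e)"
proof -
  let ?x = "cos2 theta ph"
  define e where "e = \<delta> * (1 - ((cos (theta + real nbar * ph)) ^ 4 + (sin (theta + real nbar * ph)) ^ 4))"
  have "0 \<le> 1 - (t + s) \<and> 1 - (t + s) \<le> 1"
    if "c\<^sup>2 + d\<^sup>2 = 1" "t = c ^ 4" "s = d ^ 4" for t s c d :: real
  proof -
    have "t = (c\<^sup>2)^2" "s = (d\<^sup>2)^2" using that by (simp_all add: power_mult[symmetric])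
    moreover have "(c\<^sup>2)^2 + (d\<^sup>2)^2 \<le> (c\<^sup>2 + d\<^sup>2)^2" by (simp add: power2_sum)
    ultimately have "t + s \<le> 1" using that(1) by simp
    moreover have "0 \<le> t" "0 \<le> s" using that(2,3) by simp_all
    ultimately show ?thesis by linarith
  qed
  from this[OF _ refl refl, of "cos (theta + real nbar * ph)" "sin (theta + real nbar * ph)"]
  have e: "0 \<le> e" "e \<le> \<delta>" unfolding e_def using \<delta> by (auto simp: mult_left_le)
  have "Vlyap nbar theta ph \<delta> psi = enn2ereal (lyap nbar ?x \<delta> psi) - ereal e" if psi: "psi \<in> B1" for psi
  proof -
    define X where "X = wsum ?x psi"
    have X: "0 \<le> X" "X \<le> 1" unfolding X_def
      by (intro wsum_nonneg wsum_le_1 psi cos2_bounds; simp add: cos2_bounds)+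
    have "l2norm (Mop b theta ph psi) ^ 4 = (if b then X else 1 - X)^2" for b
    proof -
      have "l2norm (Mop b theta ph psi) ^ 4 = (pout b theta ph psi)^2" by (simp add: pout_def power_mult[symmetric])
      then show ?thesis using wsum_outw[OF psi cos2_bounds, of b] pout_eq[OF psi] by (simp add: X_def)
    qed
    then have n: "l2norm (Mop True theta ph psi) ^ 4 = X\<^sup>2" "l2norm (Mop False theta ph psi) ^ 4 = (1 - X)^2" by auto
    have s: "(\<Sum>n. ereal (sigma_coef nbar n * pr psi n)) = enn2ereal (energy nbar psi)"
      unfolding energy_def suminf_enn2ereal[symmetric] by (simp add: sigma_coef_nonneg)
    have l: "enn2ereal (lyap nbar ?x \<delta> psi) = enn2ereal (energy nbar psi) + ereal (\<delta> * (2 * X * (1 - X)))"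
      unfolding lyap_def X_def[symmetric] using \<delta> X by (simp add: plus_ennreal.rep_eq)
    have "ereal (\<delta> * (2 * X * (1 - X))) - ereal e = ereal (\<delta> * ((cos (theta + real nbar * ph)) ^ 4 + (sin (theta + real nbar * ph)) ^ 4)) - ereal (\<delta> * (X\<^sup>2 + (1 - X)^2))"
      by (simp add: e_def power2_eq_square algebra_simps)
    then show ?thesis unfolding Vlyap_def n s l
      by (cases "enn2ereal (energy nbar psi)") (auto simp: algebra_simps)
  qed
  with e show ?thesis by blast
qed

section \<open>Topology of the unit sphere and the Markov step\<close>

lemma cmod_diff_sq_le: "(cmod (z - w))^2 \<le> 2 * (cmod z)^2 + 2 * (cmod w)^2"
  using zero_le_power2[of "Re z + Re w"] zero_le_power2[of "Im z + Im w"]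
  unfolding cmod_power2 by (simp add: power2_eq_square algebra_simps)

lemma l2_diff:
  assumes "psi \<in> B1" "chi \<in> B1" shows "l2 (\<lambda>n. psi n - chi n)"
proof (rule summable_comparison_test')
  show "summable (\<lambda>n. 2 * pr psi n + 2 * pr chi n)"
    by (intro summable_add summable_mult B1_D(1) assms)
qed (use cmod_diff_sq_le in simp)

lemma cmod_diff_le_l2dist:
  assumes "psi \<in> B1" "chi \<in> B1" shows "cmod (psi n - chi n) \<le> l2dist psi chi"
  unfolding l2dist_def l2norm_def
  using sum_le_suminf[OF l2_diff[OF assms], of "{n}"] by (intro real_le_rsqrt) simp

lemma dist_fun_le_coordinatewise:
  fixes psi chi :: "nat \<Rightarrow> complex"
  assumes "\<And>n. cmod (psi n - chi n) \<le> e" shows "dist psi chi \<le> 2 * e"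
proof -
  have s: "summable (\<lambda>n. (1/2)^n * e)" by (intro summable_mult2 summable_geometric) auto
  have le: "(1/2)^n * min (dist (psi (from_nat n)) (chi (from_nat n))) 1 \<le> (1/2)^n * e" for n
    using assms[of "from_nat n"] by (intro mult_left_mono) (auto simp: dist_norm)
  have "dist psi chi \<le> (\<Sum>n. (1/2)^n * e)"
    unfolding dist_fun_def
    by (intro suminf_le le s summable_comparison_test'[OF s]) (use le in \<open>simp add: abs_mult\<close>)
  also have "\<dots> = 2 * e"
    using suminf_geometric[of "1/2::real"] by (simp add: suminf_mult2[symmetric] summable_geometric)
  finally show ?thesis .
qed

lemma dist_le_l2dist:
  assumes "psi \<in> B1" "chi \<in> B1" shows "dist psi chi \<le> 2 * l2dist psi chi"
  by (intro dist_fun_le_coordinatewise cmod_diff_le_l2dist assms)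

lemma B1_tail_small:
  assumes "psi \<in> B1" "e > 0" shows "\<exists>T. 1 - (\<Sum>m<T. pr psi m) < e"
proof -
  have "(\<lambda>T. \<Sum>m<T. pr psi m) \<longlonglongrightarrow> 1" using B1_D(2)[OF assms(1)] by (simp add: sums_def)
  then have "eventually (\<lambda>T. 1 - e < (\<Sum>m<T. pr psi m)) sequentially"
    using assms(2) by (intro order_tendstoD) auto
  then show ?thesis by (auto simp: eventually_sequentially algebra_simps)
qed

lemma B1_tail_sums:
  assumes "psi \<in> B1" shows "(\<lambda>m. if m < T then 0 else pr psi m) sums (1 - (\<Sum>m<T. pr psi m))"
  using suminf_split_if_lessThan(2)[OF B1_D(1)[OF assms], of T] sums_unique[OF B1_D(2)[OF assms]] by simp

text \<open>On the unit sphere coordinatewise convergence implies norm convergence, because no mass can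
  escape to infinity. Hence the norm topology of \<open>B1\<close> is the product topology.\<close>

lemma l2dist_small:
  assumes chi: "chi \<in> B1" and e: "e > 0"
  shows "\<exists>d>0. \<forall>psi\<in>B1. dist psi chi < d \<longrightarrow> l2dist psi chi < e"
proof -
  obtain T where T: "1 - (\<Sum>m<T. pr chi m) < e\<^sup>2 / 4" using B1_tail_small[OF chi, of "e\<^sup>2/4"] e by auto
  define h where "h psi = (\<Sum>m<T. (cmod (psi m - chi m))^2) + 2 * (1 - (\<Sum>m<T. pr psi m)) + 2 * (1 - (\<Sum>m<T. pr chi m))" for psi :: "nat \<Rightarrow> complex"
  have "continuous_on UNIV h" unfolding h_def
    by (intro continuous_intros continuous_on_product_coordinates)
  then have "open {psi. h psi < e\<^sup>2}"
    using open_Collect_less[of h "\<lambda>_. e\<^sup>2"] by (simp add: continuous_on_const)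
  moreover have "chi \<in> {psi. h psi < e\<^sup>2}" using T by (simp add: h_def)
  ultimately obtain d where d: "d > 0" "ball chi d \<subseteq> {psi. h psi < e\<^sup>2}" using open_contains_ball by blast
  have "l2dist psi chi < e" if psi: "psi \<in> B1" and "dist psi chi < d" for psi
  proof -
    have h: "h psi < e\<^sup>2" using d that by (auto simp: dist_commute subset_eq)
    have 1: "(\<lambda>m. if m < T then (cmod (psi m - chi m))\<^sup>2 else 0) sums (\<Sum>m<T. (cmod (psi m - chi m))^2)"
      by (rule suminf_split_if_lessThan(1)[OF l2_diff[OF psi chi]])
    have 2: "(\<lambda>m. (if m < T then (cmod (psi m - chi m))\<^sup>2 else 0) + 2 * (if m < T then 0 else pr psi m) + 2 * (if m < T then 0 else pr chi m)) sums h psi"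
      unfolding h_def by (intro sums_add sums_mult 1 B1_tail_sums psi chi)
    have "(\<Sum>m. (cmod (psi m - chi m))^2) \<le> h psi"
      by (rule sums_le[OF _ summable_sums[OF l2_diff[OF psi chi]] 2]) (use cmod_diff_sq_le in auto)
    with h have "(\<Sum>m. (cmod (psi m - chi m))^2) < e\<^sup>2" by simp
    then show ?thesis unfolding l2dist_def l2norm_def using e by (intro real_less_lsqrt) (auto intro: suminf_nonneg l2_diff psi chi)
  qed
  with d(1) show ?thesis by blast
qed

text \<open>By normalisation the tail of a state is 1 minus a finite sum, hence continuous in
  finitely many coordinates. The difference of two values of \<open>wsum x\<close> is thus dominated
  by the continuous function \<open>h\<close>, which is small at \<open>chi\<close>.\<close>

lemma continuous_on_wsum:
  assumes x: "\<And>n. \<bar>x n\<bar> \<le> 1"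
  shows "continuous_on B1 (wsum x)"
  unfolding continuous_on_iff
proof (intro ballI allI impI)
  fix chi and e :: real assume chi: "chi \<in> B1" and e: "e > 0"
  obtain T where T: "1 - (\<Sum>m<T. pr chi m) < e / 2" using B1_tail_small[OF chi, of "e/2"] e by auto
  define h where "h psi = (\<Sum>m<T. \<bar>pr psi m - pr chi m\<bar>) + (1 - (\<Sum>m<T. pr psi m)) + (1 - (\<Sum>m<T. pr chi m))" for psi :: "nat \<Rightarrow> complex"
  have "continuous_on UNIV h" unfolding h_def
    by (intro continuous_intros continuous_on_product_coordinates)
  then have "open {psi. h psi < e}"
    using open_Collect_less[of h "\<lambda>_. e"] by (simp add: continuous_on_const)
  moreover have "chi \<in> {psi. h psi < e}" using T by (simp add: h_def)
  ultimately obtain d where d: "d > 0" "ball chi d \<subseteq> {psi. h psi < e}" using open_contains_ball by blast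
  have "dist (wsum x psi) (wsum x chi) < e" if psi: "psi \<in> B1" and "dist psi chi < d" for psi
  proof -
    have h: "h psi < e" using d that by (auto simp: dist_commute subset_eq)
    let ?p = "\<lambda>m. pr psi m" and ?q = "\<lambda>m. pr chi m"
    have 1: "(\<lambda>m. if m < T then \<bar>?p m - ?q m\<bar> else 0) sums (\<Sum>m<T. \<bar>?p m - ?q m\<bar>)"
      using sums_If_finite_set[of "{..<T}" "\<lambda>m. \<bar>?p m - ?q m\<bar>"] by simp
    have 2: "(\<lambda>m. (if m < T then \<bar>?p m - ?q m\<bar> else 0) + (if m < T then 0 else ?p m) + (if m < T then 0 else ?q m)) sums h psi"
      unfolding h_def by (intro sums_add 1 B1_tail_sums psi chi)
    have 3: "(\<lambda>m. x m * ?p m - x m * ?q m) sums (wsum x psi - wsum x chi)"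
      unfolding wsum_def by (intro sums_diff summable_sums summable_wsum psi chi x)
    have b: "\<bar>x m * ?p m - x m * ?q m\<bar> \<le> (if m < T then \<bar>?p m - ?q m\<bar> else 0) + (if m < T then 0 else ?p m) + (if m < T then 0 else ?q m)" for m
    proof -
      have "\<bar>x m * ?p m - x m * ?q m\<bar> = \<bar>x m\<bar> * \<bar>?p m - ?q m\<bar>" by (simp add: abs_mult[symmetric] right_diff_distrib)
      also have "\<dots> \<le> \<bar>?p m - ?q m\<bar>" using x by (intro mult_left_le_one_le) auto
      also have "\<bar>?p m - ?q m\<bar> \<le> ?p m + ?q m" by (simp add: abs_le_iff)
      finally show ?thesis using \<open>\<bar>x m\<bar> * \<bar>?p m - ?q m\<bar> \<le> \<bar>?p m - ?q m\<bar>\<close> \<open>\<bar>x m * ?p m - x m * ?q m\<bar> = \<bar>x m\<bar> * \<bar>?p m - ?q m\<bar>\<close> by auto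
    qed
    have "wsum x psi - wsum x chi \<le> h psi" by (rule sums_le[OF _ 3 2]) (use b abs_le_D1 in blast)
    moreover have "- (wsum x psi - wsum x chi) \<le> h psi" by (rule sums_le[OF _ sums_minus[OF 3] 2]) (use b abs_le_D2 in blast)
    ultimately show ?thesis using h by (simp add: dist_real_def)
  qed
  with d(1) show "\<exists>d>0. \<forall>psi\<in>B1. dist psi chi < d \<longrightarrow> dist (wsum x psi) (wsum x chi) < e" by blast
qed

lemma l2open_in_iff: "l2open_in U \<longleftrightarrow> (\<exists>V. open V \<and> U = B1 \<inter> V)"
proof
  assume U: "l2open_in U"
  have "openin (top_of_set B1) U" unfolding openin_euclidean_subtopology_iff
  proof (intro conjI ballI)
    show "U \<subseteq> B1" using U by (simp add: l2open_in_def)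
    fix psi assume "psi \<in> U"
    then obtain e where "e > 0" "\<And>phi. phi \<in> B1 \<Longrightarrow> l2dist phi psi < e \<Longrightarrow> phi \<in> U" and "psi \<in> B1"
      using U unfolding l2open_in_def by blast
    with l2dist_small[of psi e] show "\<exists>e>0. \<forall>x'\<in>B1. dist x' psi < e \<longrightarrow> x' \<in> U" by blast
  qed
  then show "\<exists>V. open V \<and> U = B1 \<inter> V" by (auto simp: openin_open)
next
  assume "\<exists>V. open V \<and> U = B1 \<inter> V"
  then obtain V where V: "open V" "U = B1 \<inter> V" by blast
  show "l2open_in U" unfolding l2open_in_def
  proof (intro conjI ballI)
    fix psi assume "psi \<in> U"
    then have "psi \<in> B1" "psi \<in> V" using V by auto
    then obtain e where e: "e > 0" "ball psi e \<subseteq> V" using V(1) open_contains_ball by blast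
    have "phi \<in> U" if "phi \<in> B1" "l2dist phi psi < e / 2" for phi
      using dist_le_l2dist[OF that(1) \<open>psi \<in> B1\<close>] that e V(2) by (auto simp: subset_eq dist_commute)
    then show "\<exists>e>0. \<forall>phi\<in>B1. l2dist phi psi < e \<longrightarrow> phi \<in> U" using e(1) by (intro exI[of _ "e/2"]) auto
  qed (use V in auto)
qed

section \<open>Measurability on the sphere and the closed-loop kernel\<close>

lemma space_B1_borel [simp]: "space B1_borel = B1"
  unfolding B1_borel_def by (rule space_measure_of) (auto simp: l2open_in_def)

lemma sets_B1_borel: "sets B1_borel = sets (restrict_space borel B1)"
proof
  have sig: "sets B1_borel = sigma_sets B1 {U. l2open_in U}"
    unfolding B1_borel_def by (rule sets_measure_of) (auto simp: l2open_in_def)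
  show "sets B1_borel \<subseteq> sets (restrict_space borel B1)"
  proof -
    have "sigma_sets (space (restrict_space borel B1)) {U. l2open_in U} \<subseteq> sets (restrict_space borel B1)"
      by (rule sets.sigma_sets_subset) (auto simp: l2open_in_iff sets_restrict_space)
    then show ?thesis by (simp add: sig space_restrict_space)
  qed
  have "(\<lambda>psi. psi) \<in> borel_measurable B1_borel"
  proof (rule borel_measurableI)
    fix S :: "(nat \<Rightarrow> complex) set" assume "open S"
    then have "l2open_in (B1 \<inter> S)" by (auto simp: l2open_in_iff)
    then have "B1 \<inter> S \<in> sigma_sets B1 {U. l2open_in U}" by blast
    then show "(\<lambda>psi. psi) -` S \<inter> space B1_borel \<in> sets B1_borel" by (simp add: sig Int_commute)
  qed
  from measurable_sets[OF this] have "B1 \<inter> S \<in> sets B1_borel" if "S \<in> sets borel" for S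
    using that unfolding Int_commute[of B1] by simp
  then show "sets (restrict_space borel B1) \<subseteq> sets B1_borel"
    by (auto simp: sets_restrict_space)
qed

lemma measurable_B1_borel_iff:
  "f \<in> measurable M B1_borel \<longleftrightarrow> f \<in> space M \<rightarrow> B1 \<and> (\<forall>n. (\<lambda>x. f x n) \<in> borel_measurable M)"
proof -
  have "f \<in> measurable M B1_borel \<longleftrightarrow> f \<in> measurable M (restrict_space borel B1)"
    by (rule measurable_cong_sets[THEN arg_cong[where f="\<lambda>S. f \<in> S"]]) (auto simp: sets_B1_borel)
  also have "\<dots> \<longleftrightarrow> f \<in> space M \<rightarrow> B1 \<and> f \<in> borel_measurable M"
    by (auto simp: measurable_restrict_space2_iff)
  also have "f \<in> borel_measurable M \<longleftrightarrow> (\<forall>n. (\<lambda>x. f x n) \<in> borel_measurable M)"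
    by (intro iffI allI measurable_coordinatewise_then_product) (erule measurable_product_then_coordinatewise, erule spec)
  finally show ?thesis .
qed

lemma measurable_B1_coord [measurable]: "(\<lambda>psi. psi n) \<in> borel_measurable B1_borel"
  using measurable_B1_borel_iff[of "\<lambda>psi. psi" B1_borel] by (auto simp: measurable_ident)

lemma measurable_continuous_on_B1:
  "continuous_on B1 f \<Longrightarrow> f \<in> borel_measurable B1_borel" for f :: "(nat \<Rightarrow> complex) \<Rightarrow> 'a::topological_space"
  unfolding measurable_cong_sets[OF sets_B1_borel refl] by (rule borel_measurable_continuous_on_restrict)

lemma bcont_B1_iff: "bcont_B1 f \<longleftrightarrow> (\<exists>K. \<forall>psi\<in>B1. \<bar>f psi\<bar> \<le> K) \<and> continuous_on B1 f"
proof -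
  have eq: "(\<exists>d>0. \<forall>phi\<in>B1. l2dist phi psi < d \<longrightarrow> \<bar>f phi - f psi\<bar> < e) \<longleftrightarrow>
      (\<exists>d>0. \<forall>phi\<in>B1. dist phi psi < d \<longrightarrow> \<bar>f phi - f psi\<bar> < e)" if psi: "psi \<in> B1" for psi e
  proof
    show "\<exists>d>0. \<forall>phi\<in>B1. dist phi psi < d \<longrightarrow> \<bar>f phi - f psi\<bar> < e"
      if ex: "\<exists>d>0. \<forall>phi\<in>B1. l2dist phi psi < d \<longrightarrow> \<bar>f phi - f psi\<bar> < e"
    proof -
      obtain d where d: "d > 0" "\<And>phi. phi \<in> B1 \<Longrightarrow> l2dist phi psi < d \<Longrightarrow> \<bar>f phi - f psi\<bar> < e"
        using ex by blast
      from l2dist_small[OF psi d(1)] d(2) show ?thesis by blast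
    qed
    assume "\<exists>d>0. \<forall>phi\<in>B1. dist phi psi < d \<longrightarrow> \<bar>f phi - f psi\<bar> < e"
    then obtain d where d: "d > 0" "\<And>phi. phi \<in> B1 \<Longrightarrow> dist phi psi < d \<Longrightarrow> \<bar>f phi - f psi\<bar> < e" by blast
    have "\<bar>f phi - f psi\<bar> < e" if "phi \<in> B1" "l2dist phi psi < d / 2" for phi
      using dist_le_l2dist[OF that(1) psi] that by (intro d(2)) auto
    then show "\<exists>d>0. \<forall>phi\<in>B1. l2dist phi psi < d \<longrightarrow> \<bar>f phi - f psi\<bar> < e"
      using d(1) by (intro exI[of _ "d/2"]) auto
  qed
  have "(\<forall>psi\<in>B1. \<forall>e>0. \<exists>d>0. \<forall>phi\<in>B1. l2dist phi psi < d \<longrightarrow> \<bar>f phi - f psi\<bar> < e) \<longleftrightarrow> continuous_on B1 f"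
    unfolding continuous_on_iff dist_real_def by (rule ball_cong[OF refl]) (simp only: eq)
  then show ?thesis unfolding bcont_B1_def by simp
qed

lemma continuous_on_Dmat: "continuous_on UNIV (\<lambda>a. Dmat a m n)"
  by (intro continuous_at_imp_continuous_on ballI DERIV_isCont[OF Dmat_deriv])

lemma measurable_pout [measurable]: "pout b theta ph \<in> borel_measurable B1_borel"
  unfolding pout_def l2norm_def Mop_def by measurable

lemma measurable_halfstep [measurable]: "halfstep b theta ph \<in> measurable B1_borel B1_borel"
  unfolding measurable_B1_borel_iff
proof (intro conjI allI)
  show "halfstep b theta ph \<in> space B1_borel \<rightarrow> B1" using halfstep_B1 by auto
  have [measurable]: "(\<lambda>psi. l2norm (Mop b theta ph psi)) \<in> borel_measurable B1_borel"
    unfolding l2norm_def Mop_def by measurable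
  have [measurable]: "(\<lambda>psi. Mop b theta ph psi n) \<in> borel_measurable B1_borel" for n
    unfolding Mop_def by measurable
  show "(\<lambda>psi. halfstep b theta ph psi n) \<in> borel_measurable B1_borel" for n
  proof -
    have "(\<lambda>psi. halfstep b theta ph psi n) = (\<lambda>psi. if l2norm (Mop b theta ph psi) = 0 then psi n
      else Mop b theta ph psi n / complex_of_real (l2norm (Mop b theta ph psi)))"
      by (auto simp: halfstep_def)
    then show ?thesis by simp
  qed
qed

lemma measurable_fullstep:
  assumes [measurable]: "fb \<in> borel_measurable B1_borel" and fb: "\<And>v. v \<in> B1 \<Longrightarrow> \<bar>fb v\<bar> \<le> 1"
  shows "fullstep b theta ph fb \<in> measurable B1_borel B1_borel"
proof -
  have [measurable]: "(\<lambda>a. Dmat a m n) \<in> borel_measurable borel" for m n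
    by (rule borel_measurable_continuous_onI[OF continuous_on_Dmat])
  have D: "(\<lambda>v. Dop (fb v) v) \<in> measurable B1_borel B1_borel"
    unfolding measurable_B1_borel_iff
  proof (intro conjI allI)
    show "(\<lambda>v. Dop (fb v) v) \<in> space B1_borel \<rightarrow> B1" using Dop_B1 fb by auto
    show "(\<lambda>v. Dop (fb v) v n) \<in> borel_measurable B1_borel" for n
      unfolding Dop_def by measurable
  qed
  show ?thesis using measurable_compose[OF measurable_halfstep D] by (simp add: fullstep_def[abs_def])
qed

lemma prob_on_B1_D:
  assumes "prob_on_B1 mu"
  shows "prob_space mu" "sets mu = sets B1_borel" "space mu = B1"
    "measurable mu N = measurable B1_borel N"
  using assms sets_eq_imp_space_eq[of mu B1_borel] by (auto simp: prob_on_B1_def intro: measurable_cong_sets)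

text \<open>\<open>measure_of\<close> yields the intended measure only if the given set function is
  countably additive. This is seen by realising it as \<open>K\<close>: weight the pairs of outcome
  and state by the outcome probability and push forward along the closed-loop step.\<close>

lemma Gstep_properties:
  assumes mu: "prob_on_B1 mu" and fb: "fb \<in> borel_measurable B1_borel" "\<And>v. v \<in> B1 \<Longrightarrow> \<bar>fb v\<bar> \<le> 1"
  shows "prob_on_B1 (Gstep theta ph fb mu)"
    and "f \<in> borel_measurable B1_borel \<Longrightarrow> (\<integral>\<^sup>+ psi. f psi \<partial>Gstep theta ph fb mu) =
      (\<integral>\<^sup>+ psi. ennreal (pout True theta ph psi) * f (fullstep True theta ph fb psi)
               + ennreal (pout False theta ph psi) * f (fullstep False theta ph fb psi) \<partial>mu)"
proof -
  note mus = prob_on_B1_D[OF mu]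
  interpret prob_space mu by (rule mus(1))
  note [measurable_cong] = mus(2)
  let ?S = "\<lambda>f psi. ennreal (pout True theta ph psi) * f (fullstep True theta ph fb psi)
      + ennreal (pout False theta ph psi) * f (fullstep False theta ph fb psi)"
  define P where "P = (\<lambda>(b, psi). ennreal (pout b theta ph psi))"
  define F where "F = (\<lambda>(b, psi). fullstep b theta ph fb psi)"
  have [measurable]: "P \<in> borel_measurable (count_space UNIV \<Otimes>\<^sub>M mu)"
    unfolding P_def by (rule measurable_pair_measure_countable1) (simp_all, measurable)
  have Fm[measurable]: "F \<in> measurable (count_space UNIV \<Otimes>\<^sub>M mu) B1_borel"
    unfolding F_def by (rule measurable_pair_measure_countable1) (simp_all add: mus(4) measurable_fullstep fb)
  define K where "K = distr (density (count_space UNIV \<Otimes>\<^sub>M mu) P) B1_borel F"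
  have K: "(\<integral>\<^sup>+ psi. f psi \<partial>K) = (\<integral>\<^sup>+ psi. ?S f psi \<partial>mu)"
    if [measurable]: "f \<in> borel_measurable B1_borel" for f :: "(nat \<Rightarrow> complex) \<Rightarrow> ennreal"
  proof -
    have m: "(\<lambda>psi. ennreal (pout b theta ph psi) * f (fullstep b theta ph fb psi)) \<in> borel_measurable mu" for b
      using measurable_compose[OF measurable_fullstep[OF fb] that] mus(4) by measurable
    have "(\<integral>\<^sup>+ psi. f psi \<partial>K) = (\<integral>\<^sup>+ z. P z * f (F z) \<partial>(count_space UNIV \<Otimes>\<^sub>M mu))"
      unfolding K_def by (simp add: nn_integral_distr nn_integral_density)
    also have "\<dots> = (\<integral>\<^sup>+ b. \<integral>\<^sup>+ psi. P (b, psi) * f (F (b, psi)) \<partial>mu \<partial>count_space UNIV)"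
      by (subst nn_integral_fst[symmetric]) auto
    also have "\<dots> = (\<integral>\<^sup>+ psi. ennreal (pout True theta ph psi) * f (fullstep True theta ph fb psi) \<partial>mu)
        + (\<integral>\<^sup>+ psi. ennreal (pout False theta ph psi) * f (fullstep False theta ph fb psi) \<partial>mu)"
      by (simp add: nn_integral_count_space_finite UNIV_bool P_def F_def add.commute)
    also have "\<dots> = (\<integral>\<^sup>+ psi. ?S f psi \<partial>mu)"
      by (rule nn_integral_add[symmetric, OF m m])
    finally show ?thesis .
  qed
  have sK: "sets K = sets B1_borel" "space K = B1" by (simp_all add: K_def)
  have "Gstep theta ph fb mu = measure_of B1 (sets B1_borel) (emeasure K)"
    unfolding Gstep_def
  proof (rule measure_of_eq)
    show "sets B1_borel \<subseteq> Pow B1" using sets.space_closed[of B1_borel] by simp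
    fix A assume "A \<in> sigma_sets B1 (sets B1_borel)"
    then have A: "A \<in> sets B1_borel" using sets.sigma_sets_eq[of B1_borel] by simp
    have "emeasure K A = (\<integral>\<^sup>+ psi. indicator A psi \<partial>K)" using A sK by simp
    also have "\<dots> = (\<integral>\<^sup>+ psi. ?S (indicator A) psi \<partial>mu)"
      using A by (intro K) simp
    finally show "(\<integral>\<^sup>+ psi. ?S (indicator A) psi \<partial>mu) = emeasure K A" by simp
  qed
  also have "\<dots> = K" using measure_of_of_measure[of K] sK by simp
  finally have G: "Gstep theta ph fb mu = K" .
  show "f \<in> borel_measurable B1_borel \<Longrightarrow> (\<integral>\<^sup>+ psi. f psi \<partial>Gstep theta ph fb mu) =
      (\<integral>\<^sup>+ psi. ?S f psi \<partial>mu)"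
    unfolding G by (rule K)
  have "emeasure K (space K) = (\<integral>\<^sup>+ psi. 1 \<partial>K)" by simp
  also have "\<dots> = (\<integral>\<^sup>+ psi. ennreal (pout True theta ph psi) * 1 + ennreal (pout False theta ph psi) * 1 \<partial>mu)"
    by (rule K) simp
  also have "\<dots> = (\<integral>\<^sup>+ psi. 1 \<partial>mu)"
  proof (rule nn_integral_cong)
    fix psi assume "psi \<in> space mu"
    then have psi: "psi \<in> B1" by (simp add: mus)
    have "pout True theta ph psi + pout False theta ph psi = 1"
      using wsum_outw[OF psi cos2_bounds] by (simp add: pout_eq[OF psi])
    then show "ennreal (pout True theta ph psi) * 1 + ennreal (pout False theta ph psi) * 1 = 1"
      by (simp add: pout_def flip: ennreal_plus)
  qed
  also have "\<dots> = 1" by (simp add: emeasure_space_1)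
  finally show "prob_on_B1 (Gstep theta ph fb mu)"
    unfolding G prob_on_B1_def using sK by (auto intro: prob_spaceI)
qed

section \<open>Concentration on Fock states and weak compactness\<close>

text \<open>On the sphere this is the probability of more than \<open>N\<close> photons. As 1 minus
  a finite sum it is visibly continuous.\<close>

definition tail :: "nat \<Rightarrow> (nat \<Rightarrow> complex) \<Rightarrow> real" where
  "tail N psi = 1 - (\<Sum>m\<le>N. pr psi m)"

lemma tail_bounds: "psi \<in> B1 \<Longrightarrow> 0 \<le> tail N psi" "tail N psi \<le> 1"
  using B1_D(4)[of psi "{..N}"] by (auto simp: tail_def sum_nonneg)

lemma continuous_on_tail: "continuous_on B1 (tail N)"
  unfolding tail_def by (intro continuous_intros continuous_on_product_coordinates[THEN continuous_on_subset]) auto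

lemma coord_le_tail:
  assumes "psi \<in> B1" "N < n" shows "pr psi n \<le> tail N psi"
  using B1_D(4)[OF assms(1), of "insert n {..N}"] assms(2) by (simp add: tail_def)

lemma xvar_sums:
  assumes psi: "psi \<in> B1" and x: "\<And>n. 0 \<le> x n" "\<And>n. x n \<le> 1"
  shows "(\<lambda>n. (x n - wsum x psi)^2 * pr psi n) sums xvar x psi"
proof -
  let ?X = "wsum x psi"
  have "(\<lambda>n. (x n)^2 * pr psi n - 2 * ?X * (x n * pr psi n) + ?X\<^sup>2 * pr psi n) sums
     (wsum (\<lambda>n. (x n)^2) psi - 2 * ?X * ?X + ?X\<^sup>2 * 1)"
    unfolding wsum_def[of "\<lambda>n. (x n)^2"] wsum_def[of x] using x
    by (intro sums_add sums_diff sums_mult summable_sums[OF summable_wsum] B1_D(2) psi) (auto simp: abs_square_le_1 power_le_one)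
  then show ?thesis
    by (simp add: xvar_def power2_eq_square algebra_simps)
qed

lemma xvar_bounds:
  assumes psi: "psi \<in> B1" and x: "\<And>n. 0 \<le> x n" "\<And>n. x n \<le> 1"
  shows "0 \<le> xvar x psi" "xvar x psi \<le> 1"
proof -
  show "0 \<le> xvar x psi" using sums_le[OF _ sums_zero xvar_sums[of psi x, OF assms]] by simp
  have "wsum (\<lambda>n. (x n)^2) psi \<le> 1" using x by (intro wsum_le_1 psi) (auto simp: power_le_one)
  then show "xvar x psi \<le> 1" unfolding xvar_def using zero_le_power2[of "wsum x psi"] by linarith
qed

lemma continuous_on_xvar:
  assumes x: "\<And>n. 0 \<le> x n" "\<And>n. x n \<le> 1"
  shows "continuous_on B1 (xvar x)"
  unfolding xvar_def using x by (intro continuous_intros continuous_on_wsum) (auto simp: power_le_one)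

text \<open>Chebyshev's inequality. Let \<open>n\<close> be the level whose value is nearest to the
  mean; among levels up to \<open>N\<close> with mutual gap \<open>h\<close>, every other value is
  at least \<open>h/2\<close> away from it. Infinitely many distinct values in [0,1] have no common
  gap, so higher levels must be charged to \<open>tail N\<close>.\<close>

lemma near_fock_of_xvar:
  fixes x :: "nat \<Rightarrow> real"
  assumes x: "\<And>n. 0 \<le> x n" "\<And>n. x n \<le> 1" and inj: "inj x"
  shows "\<exists>g>0. \<forall>psi\<in>B1. \<exists>n\<le>N. 1 - tail N psi - xvar x psi / g \<le> pr psi n"
proof -
  \<comment> \<open>The extra element 1 keeps the minimum meaningful for \<open>N = 0\<close>, where
    there are no pairs.\<close>
  let ?D = "insert 1 ((\<lambda>(m, n). \<bar>x m - x n\<bar>) ` {(m, n). m \<le> N \<and> n \<le> N \<and> m \<noteq> n})"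
  have fin: "finite ?D"
    by (rule finite.insertI, rule finite_imageI, rule finite_subset[of _ "{..N} \<times> {..N}"]) auto
  define h where "h = Min ?D"
  have h0: "h > 0" unfolding h_def using fin inj by (subst Min_gr_iff) (auto simp: inj_eq)
  have h: "h \<le> \<bar>x m - x n\<bar>" if "m \<le> N" "n \<le> N" "m \<noteq> n" for m n
    unfolding h_def using that by (intro Min_le[OF fin]) force
  have "\<exists>n\<le>N. 1 - tail N psi - xvar x psi / (h\<^sup>2 / 4) \<le> pr psi n" if psi: "psi \<in> B1" for psi
  proof -
    let ?X = "wsum x psi"
    obtain n where n: "n \<le> N" "\<And>m. m \<le> N \<Longrightarrow> \<bar>x n - ?X\<bar> \<le> \<bar>x m - ?X\<bar>"
      using ex_is_arg_min_if_finite[of "{..N}" "\<lambda>m. \<bar>x m - ?X\<bar>"] by (auto simp: is_arg_min_linorder)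
    have far: "h\<^sup>2 / 4 \<le> (x m - ?X)^2" if m: "m \<le> N" "m \<noteq> n" for m
    proof -
      have "h / 2 \<le> \<bar>x m - ?X\<bar>" using h[OF m(1) n(1) m(2)] n(2)[OF m(1)] by linarith
      then have "(h / 2)^2 \<le> \<bar>x m - ?X\<bar>\<^sup>2" using h0 by (intro power_mono) auto
      then show ?thesis by (simp add: power_divide)
    qed
    have "1 - tail N psi - pr psi n = (\<Sum>m\<in>{..N} - {n}. pr psi m)"
      using n(1) by (simp add: tail_def sum_diff1)
    then have "h\<^sup>2 / 4 * (1 - tail N psi - pr psi n) = (\<Sum>m\<in>{..N} - {n}. h\<^sup>2 / 4 * pr psi m)"
      by (simp only: sum_distrib_left)
    also have "\<dots> \<le> (\<Sum>m\<in>{..N} - {n}. (x m - ?X)^2 * pr psi m)"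
      using far by (intro sum_mono mult_right_mono) auto
    also have "\<dots> \<le> xvar x psi"
      using sum_le_suminf[OF sums_summable[OF xvar_sums[of psi x, OF psi x]], of "{..N} - {n}"] sums_unique[OF xvar_sums[of psi x, OF psi x]] by simp
    finally have "1 - tail N psi - pr psi n \<le> xvar x psi / (h\<^sup>2 / 4)"
      using h0 by (subst pos_le_divide_eq) (auto simp: mult.commute)
    then show ?thesis using n(1) by (intro exI[of _ n]) linarith
  qed
  then show ?thesis using h0 by (intro exI[of _ "h\<^sup>2 / 4"]) auto
qed

lemma fock_of_xvar_0:
  assumes psi: "psi \<in> B1" and x: "\<And>n. 0 \<le> x n" "\<And>n. x n \<le> 1" and inj: "inj x" and v: "xvar x psi = 0"
  shows "\<exists>n. cmod (psi n) = 1"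
proof -
  let ?X = "wsum x psi"
  note s = xvar_sums[of psi x, OF psi x, unfolded v]
  have z: "(x n - ?X)^2 * pr psi n = 0" for n
    using suminf_eq_zero_iff[OF sums_summable[OF s]] sums_unique[OF s] by simp
  have "\<exists>n. psi n \<noteq> 0"
  proof (rule ccontr)
    assume "\<not> ?thesis"
    then have "(\<lambda>n. pr psi n) sums 0" by simp
    from sums_unique2[OF this B1_D(2)[OF psi]] show False by simp
  qed
  then obtain n where n: "psi n \<noteq> 0" by blast
  have "psi m = 0" if "m \<noteq> n" for m
  proof -
    have "x m \<noteq> x n" using inj that by (simp add: inj_eq)
    then show ?thesis using z[of n] z[of m] n by auto
  qed
  then have "(\<lambda>m. pr psi m) = (\<lambda>m. if m = n then pr psi m else 0)" by auto
  then have "(\<lambda>m. pr psi m) sums pr psi n"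
    using sums_single[of n "\<lambda>k. pr psi k"] by simp
  from sums_unique2[OF this B1_D(2)[OF psi]] have "cmod (psi n) = 1"
    by (simp add: power2_eq_1_iff) (metis norm_ge_zero abs_of_nonneg abs_minus_cancel abs_one)
  then show ?thesis by blast
qed

lemma fock_phase_iff:
  assumes "psi \<in> B1"
  shows "cmod (psi n) = 1 \<longleftrightarrow> (\<exists>gam. psi = (\<lambda>m. cis gam * fock n m))"
proof
  assume 1: "cmod (psi n) = 1"
  have "psi m = cis (Arg (psi n)) * fock n m" for m
  proof (cases "m = n")
    case True
    have "psi n \<noteq> 0" using 1 by auto
    then show ?thesis using True cis_Arg[of "psi n"] 1 by (simp add: fock_def sgn_div_norm)
  next
    case False
    have "pr psi m + pr psi n \<le> 1" using B1_D(4)[OF assms, of "{m, n}"] False by simp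
    then show ?thesis using 1 False by (simp add: fock_def)
  qed
  then show "\<exists>gam. psi = (\<lambda>m. cis gam * fock n m)" by blast
qed (auto simp: fock_def)

text \<open>A continuous curve in the sphere that runs once through the phase circle of \<open>|n\<rangle>\<close> for
  parameters in \<open>[2n, 2n+1]\<close> and moves from \<open>|n\<rangle>\<close> to \<open>|n+1\<rangle>\<close> on \<open>[2n+1, 2n+2]\<close>. It reduces weak
  compactness of measures concentrating on Fock states to Helly's theorem on the real line.\<close>

definition amp :: "nat \<Rightarrow> real \<Rightarrow> real" where
  "amp n t = cos (pi / 2 * min 1 (max 0 (max (t - 2 * real n - 1) (2 * real n - t))))"

definition curve :: "real \<Rightarrow> nat \<Rightarrow> complex" where
  "curve t = (\<lambda>n. - cis (2 * pi * max 0 t) * of_real (amp n (max 0 t)))"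

lemma amp_fock:
  assumes "2 * real n \<le> t" "t \<le> 2 * real n + 1" shows "amp m t = (if m = n then 1 else 0)"
proof -
  have "min 1 (max 0 (max (t - 2 * real m - 1) (2 * real m - t))) = (if m = n then 0 else 1)"
  proof -
    consider "m = n" | "real m + 1 \<le> real n" "m \<noteq> n" | "real n + 1 \<le> real m" "m \<noteq> n" by linarith
    then show ?thesis using assms by cases (auto simp: min_def max_def)
  qed
  then show ?thesis by (simp only: amp_def) simp
qed

lemma amp_transition:
  assumes "2 * real n + 1 \<le> t" "t \<le> 2 * real n + 2"
  shows "amp m t = (if m = n then cos (pi / 2 * (t - 2 * real n - 1)) else if m = Suc n then sin (pi / 2 * (t - 2 * real n - 1)) else 0)"
proof -
  have "min 1 (max 0 (max (t - 2 * real m - 1) (2 * real m - t))) =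
      (if m = n then t - 2 * real n - 1 else if m = Suc n then 1 - (t - 2 * real n - 1) else 1)"
  proof -
    consider "m = n" | "m = Suc n" | "real m + 1 \<le> real n" "m \<noteq> n" "m \<noteq> Suc n" | "real n + 2 \<le> real m" "m \<noteq> n" "m \<noteq> Suc n"
      by linarith
    then show ?thesis using assms by cases (auto simp: min_def max_def)
  qed
  moreover have "cos (pi / 2 * (1 - v)) = sin (pi / 2 * v)" for v
    unfolding right_diff_distrib by (simp add: cos_diff)
  ultimately show ?thesis unfolding amp_def by (simp only: split: if_split) simp
qed

lemma curve_B1: "curve t \<in> B1"
proof -
  define u where "u = max 0 t"
  have u: "0 \<le> u" by (simp add: u_def)
  define n where "n = nat \<lfloor>u / 2\<rfloor>"
  have n: "2 * real n \<le> u" "u \<le> 2 * real n + 2" using u unfolding n_def by linarith+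
  have "(\<lambda>m. (amp m u)^2) sums 1"
  proof (cases "u \<le> 2 * real n + 1")
    case True
    have "(amp m u)^2 = (if m = n then 1 else 0)" for m using amp_fock[OF n(1) True, of m] by simp
    then show ?thesis using sums_single[of n "\<lambda>_. 1::real"] by simp
  next
    case False
    let ?v = "pi / 2 * (u - 2 * real n - 1)"
    have "(\<lambda>m. (if m = n then (cos ?v)\<^sup>2 else 0) + (if m = Suc n then (sin ?v)\<^sup>2 else 0)) sums ((cos ?v)^2 + (sin ?v)^2)"
      by (intro sums_add sums_single)
    moreover have "(amp m u)^2 = (if m = n then (cos ?v)\<^sup>2 else 0) + (if m = Suc n then (sin ?v)\<^sup>2 else 0)" for m
      using amp_transition[of n u m] False n(2) by simp
    ultimately show ?thesis by (simp only: cos_squared_eq[symmetric] sin_cos_squared_add2)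
  qed
  moreover have "pr (curve t) m = (amp m u)^2" for m
    by (simp add: curve_def u_def norm_mult)
  ultimately show ?thesis by (auto simp: B1_def sums_iff)
qed

lemma continuous_on_curve: "continuous_on UNIV curve"
  unfolding curve_def amp_def
  by (intro continuous_on_coordinatewise_then_product continuous_intros)

text \<open>Differs from \<open>Arg\<close> only at 0. Being constant on the closed half-line of the
  branch cut and continuous off it, it is Borel.\<close>

definition phase :: "complex \<Rightarrow> real" where
  "phase z = (if z \<in> \<real>\<^sub>\<le>\<^sub>0 then pi else Arg z)"

lemma measurable_phase [measurable]: "phase \<in> borel_measurable borel"
  unfolding phase_def
  by (rule borel_measurable_continuous_on_if) (auto intro!: borel_closed closed_nonpos_Reals_complex continuous_on_const continuous_intros)

lemma phase_bounds: "- pi < phase z" "phase z \<le> pi"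
  using mpi_less_Arg[of z] Arg_le_pi[of z] by (auto simp: phase_def)

lemma cis_phase: assumes "z \<noteq> 0" shows "cis (phase z) = sgn z"
proof (cases "z \<in> \<real>\<^sub>\<le>\<^sub>0")
  case True
  then obtain r where r: "z = of_real r" "r \<le> 0" by (auto simp: nonpos_Reals_def)
  then have "sgn z = - 1" using assms by (simp add: sgn_of_real)
  then show ?thesis using True by (simp add: phase_def)
qed (use assms in \<open>simp add: phase_def cis_Arg\<close>)

text \<open>On the sphere at most one level exceeds 1/2. The default 0 keeps the index at most
  \<open>N\<close> for states of small tail in which no level dominates.\<close>

definition dominant :: "(nat \<Rightarrow> complex) \<Rightarrow> nat" where
  "dominant psi = (if \<exists>n. 1/2 < pr psi n then LEAST n. 1/2 < pr psi n else 0)"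

text \<open>A measurable approximate inverse of \<open>curve\<close> near the Fock circles. Adding
  pi moves phases into one full turn of nonnegative parameters, and the minus sign in
  \<open>curve\<close> compensates it.\<close>

definition param :: "(nat \<Rightarrow> complex) \<Rightarrow> real" where
  "param psi = 2 * real (dominant psi) + (phase (psi (dominant psi)) + pi) / (2 * pi)"

lemma measurable_dominant [measurable]: "dominant \<in> measurable B1_borel (count_space UNIV)"
  unfolding dominant_def by measurable

lemma measurable_param [measurable]: "param \<in> borel_measurable B1_borel"
proof -
  have [measurable]: "(\<lambda>psi. psi (dominant psi)) \<in> borel_measurable B1_borel"
    by (rule measurable_compose_countable[where f="\<lambda>i psi. psi i", OF measurable_B1_coord measurable_dominant])
  show ?thesis unfolding param_def by measurable
qed

lemma param_bounds: "2 * real (dominant psi) \<le> param psi" "param psi \<le> 2 * real (dominant psi) + 1"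
  using phase_bounds[of "psi (dominant psi)"] pi_gt_zero by (auto simp: param_def field_simps)

lemma dominant_eq:
  assumes "psi \<in> B1" "1/2 < pr psi n" shows "dominant psi = n"
proof -
  have uniq: "m = n" if "1/2 < pr psi m" for m
    using B1_D(4)[OF assms(1), of "{m, n}"] assms(2) that by (cases "m = n") auto
  have "(LEAST m. 1/2 < pr psi m) = n"
    by (rule Least_equality, rule assms(2)) (drule uniq, rule eq_refl, erule sym)
  moreover have "\<exists>m. 1/2 < pr psi m" using assms(2) by (rule exI)
  ultimately show ?thesis unfolding dominant_def by (simp only: if_True)
qed

lemma dominant_le:
  assumes "psi \<in> B1" "tail N psi \<le> 1/2" shows "dominant psi \<le> N"
proof (rule ccontr)
  assume c: "\<not> dominant psi \<le> N"
  then have "\<exists>n. 1/2 < pr psi n" by (auto simp: dominant_def split: if_splits)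
  then have "1/2 < (cmod (psi (dominant psi)))^2"
    unfolding dominant_def using LeastI_ex[of "\<lambda>n. 1/2 < pr psi n"] by simp
  with coord_le_tail[OF assms(1), of N "dominant psi"] c assms(2) show False by simp
qed

lemma dist_curve_param:
  assumes psi: "psi \<in> B1" and near: "1 - \<eta> \<le> pr psi n" and \<eta>: "\<eta> < 1/2"
  shows "dist psi (curve (param psi)) \<le> 2 * sqrt \<eta>"
proof (rule dist_fun_le_coordinatewise)
  have d: "dominant psi = n" using near \<eta> by (intro dominant_eq psi) simp
  have c1: "cmod (psi n) \<le> 1" by (rule B1_D(3)[OF psi])
  then have c2: "pr psi n \<le> 1" by (simp add: power_le_one)
  have \<eta>0: "0 \<le> \<eta>" using near c2 by linarith
  have nz: "psi n \<noteq> 0" using near \<eta> by auto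
  have u: "2 * real n \<le> param psi" "param psi \<le> 2 * real n + 1" using param_bounds[of psi] d by auto
  have cu: "curve (param psi) m = (if m = n then sgn (psi n) else 0)" for m
  proof -
    have "2 * pi * param psi = 2 * pi * real (2 * n) + (phase (psi n) + pi)"
      unfolding param_def d by (simp add: field_simps)
    then have "cis (2 * pi * param psi) = cis (2 * pi * real (2 * n)) * (cis (phase (psi n)) * cis pi)"
      by (simp only: cis_mult)
    also have "cis (2 * pi * real (2 * n)) = 1" by (rule cis_multiple_2pi) simp
    finally have "cis (2 * pi * param psi) = - sgn (psi n)" using cis_phase[OF nz] by simp
    moreover have "max 0 (param psi) = param psi" using u by simp
    ultimately show ?thesis unfolding curve_def using amp_fock[OF u, of m] by simp
  qed
  fix m
  show "cmod (psi m - curve (param psi) m) \<le> sqrt \<eta>"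
  proof (cases "m = n")
    case True
    have "psi n - sgn (psi n) = of_real (cmod (psi n) - 1) * sgn (psi n)"
      using nz by (simp add: sgn_div_norm scaleR_conv_of_real field_simps)
    then have "cmod (psi n - sgn (psi n)) = \<bar>cmod (psi n) - 1\<bar> * cmod (sgn (psi n))"
      by (simp only: norm_mult norm_of_real)
    then have "cmod (psi n - sgn (psi n)) = 1 - cmod (psi n)" using nz c1 by (simp add: norm_sgn)
    also have "\<dots> \<le> 1 - pr psi n" using c1 by (simp add: power2_eq_square mult_left_le)
    also have "\<dots> \<le> \<eta>" using near by simp
    also have "\<eta> \<le> sqrt \<eta>" using \<eta>0 \<eta> by (intro real_le_rsqrt) (simp add: power2_eq_square mult_left_le)
    finally show ?thesis using True cu by simp
  next
    case False
    have "pr psi m + pr psi n \<le> 1" using B1_D(4)[OF psi, of "{m, n}"] False by simp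
    then show ?thesis using near False cu by (auto intro!: real_le_rsqrt)
  qed
qed

text \<open>A continuous function on the noncompact sphere need not be uniformly continuous; around
  a compact piece of the curve it is, by extracting a convergent sequence of base points.\<close>

lemma uniform_continuity_near_compact:
  fixes f :: "'a::metric_space \<Rightarrow> real"
  assumes f: "continuous_on S f" and K: "compact K" "K \<subseteq> S" and e: "e > 0"
  shows "\<exists>d>0. \<forall>y\<in>K. \<forall>x\<in>S. dist x y < d \<longrightarrow> \<bar>f x - f y\<bar> < e"
proof (rule ccontr)
  assume "\<not> ?thesis"
  then have "\<forall>n::nat. \<exists>y x. y \<in> K \<and> x \<in> S \<and> dist x y < inverse (real (Suc n)) \<and> e \<le> \<bar>f x - f y\<bar>"
    by (meson inverse_positive_iff_positive not_less of_nat_0_less_iff zero_less_Suc)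
  then obtain y x where yx: "\<And>n. y n \<in> K" "\<And>n. x n \<in> S" "\<And>n. dist (x n) (y n) < inverse (real (Suc n))" "\<And>n. e \<le> \<bar>f (x n) - f (y n)\<bar>"
    by metis
  obtain l r where l: "l \<in> K" "strict_mono r" "(y \<circ> r) \<longlonglongrightarrow> l"
    using K(1) yx(1) unfolding compact_def by blast
  have "(\<lambda>n. dist (x n) (y n)) \<longlonglongrightarrow> 0"
    using yx(3) by (intro tendsto_sandwich[where f="\<lambda>_. 0", OF _ _ tendsto_const LIMSEQ_inverse_real_of_nat])
      (auto intro!: always_eventually less_imp_le)
  then have "(\<lambda>n. dist (x (r n)) (y (r n))) \<longlonglongrightarrow> 0"
    using LIMSEQ_subseq_LIMSEQ[OF _ l(2)] by (auto simp: o_def)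
  moreover have "(\<lambda>n. dist (y (r n)) l) \<longlonglongrightarrow> 0" using l(3) by (simp add: o_def tendsto_dist_iff[symmetric])
  ultimately have "(\<lambda>n. dist (x (r n)) (y (r n)) + dist (y (r n)) l) \<longlonglongrightarrow> 0 + 0" by (rule tendsto_add)
  then have "(\<lambda>n. dist (x (r n)) l) \<longlonglongrightarrow> 0"
    using tendsto_sandwich[of "\<lambda>_. 0" "\<lambda>n. dist (x (r n)) l" sequentially "\<lambda>n. dist (x (r n)) (y (r n)) + dist (y (r n)) l" 0]
    by (simp add: dist_triangle)
  then have x: "(\<lambda>n. x (r n)) \<longlonglongrightarrow> l" by (simp add: tendsto_dist_iff[symmetric])
  have "l \<in> S" "y n \<in> S" for n using l(1) K(2) yx(1)[of n] by auto
  then have "(\<lambda>n. f (x (r n))) \<longlonglongrightarrow> f l" "(\<lambda>n. f (y (r n))) \<longlonglongrightarrow> f l"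
    using continuous_on_tendsto_compose[OF f x] continuous_on_tendsto_compose[OF f l(3)] yx(2) by (simp_all add: o_def)
  from tendsto_rabs[OF tendsto_diff[OF this]] have "(\<lambda>n. \<bar>f (x (r n)) - f (y (r n))\<bar>) \<longlonglongrightarrow> 0" by simp
  from order_tendstoD(2)[OF this e] obtain k where "\<bar>f (x (r k)) - f (y (r k))\<bar> < e"
    by (auto simp: eventually_sequentially)
  with yx(4)[of "r k"] show False by linarith
qed

section \<open>Transfer of weak limits from the line to the sphere\<close>

lemma integrable_bounded_B1:
  assumes mu: "prob_on_B1 mu" and f: "f \<in> borel_measurable B1_borel" and b: "\<And>psi. psi \<in> B1 \<Longrightarrow> \<bar>f psi\<bar> \<le> (B::real)"
  shows "integrable mu f"
proof -
  interpret prob_space mu by (rule prob_on_B1_D[OF mu])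
  show ?thesis using f b prob_on_B1_D[OF mu]
    by (intro integrable_const_bound[of _ B]) (auto intro!: AE_I2)
qed

text \<open>\<open>N\<close> confines the parameter to a compact piece of the curve, whose
  continuity modulus gives \<open>a\<close>. The second cutoff \<open>N'\<close> controls the
  distance to the curve and may be taken after \<open>a\<close>, making \<open>a * tail N'\<close>
  small in mean; the gap up to \<open>N'\<close> then fixes \<open>b\<close>, and the variance is
  left to tend to 0.\<close>

lemma f_curve_param_close:
  fixes f :: "(nat \<Rightarrow> complex) \<Rightarrow> real"
  assumes f: "continuous_on B1 f" and B: "\<And>psi. psi \<in> B1 \<Longrightarrow> \<bar>f psi\<bar> \<le> B"
    and x: "\<And>n. 0 \<le> x n" "\<And>n. x n \<le> 1" and inj: "inj x" and e: "e > 0"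
  shows "\<exists>a\<ge>0. \<forall>N'. \<exists>b\<ge>0. \<forall>psi\<in>B1. \<bar>f psi - f (curve (param psi))\<bar> \<le>
     e + 2 * B * (2 * tail N psi + a * tail N' psi + b * (xvar x psi)^2)"
proof -
  let ?K = "curve ` {0..2 * real N + 1}"
  have K: "compact ?K" by (intro compact_continuous_image continuous_on_subset[OF continuous_on_curve] compact_Icc) auto
  have "?K \<subseteq> B1" using curve_B1 by auto
  from uniform_continuity_near_compact[OF f K this e]
  obtain d where d: "d > 0" and close: "\<forall>y\<in>?K. \<forall>psi\<in>B1. dist psi y < d \<longrightarrow> \<bar>f psi - f y\<bar> < e"
    by (elim exE conjE)
  define \<eta> where "\<eta> = min (1/4) ((d/4)^2)"
  have \<eta>: "0 < \<eta>" "\<eta> < 1/2" "\<eta> \<le> (d/4)^2" using d by (auto simp: \<eta>_def)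
  then have "sqrt \<eta> \<le> d / 4" using d by (intro real_le_lsqrt) auto
  then have \<eta>d: "2 * sqrt \<eta> < d" using d by linarith
  have B0: "0 \<le> B" using B[OF curve_B1[of 0]] abs_ge_zero order_trans by blast
  show ?thesis
  proof (rule exI[of _ "2 / \<eta>"], intro conjI allI)
    show "0 \<le> 2 / \<eta>" using \<eta> by simp
    fix N'
    obtain g where g: "g > 0" "\<And>psi. psi \<in> B1 \<Longrightarrow> \<exists>n\<le>N'. 1 - tail N' psi - xvar x psi / g \<le> pr psi n"
      using near_fock_of_xvar[of x N', OF x inj] by blast
    define b where "b = (2 / (g * \<eta>))^2"
    have main: "\<bar>f psi - f (curve (param psi))\<bar> \<le> e + 2 * B * (2 * tail N psi + 2 / \<eta> * tail N' psi + b * (xvar x psi)^2)"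
      if psi: "psi \<in> B1" for psi
    proof -
      have nn: "0 \<le> tail N psi" "0 \<le> tail N' psi" "0 \<le> xvar x psi"
        using tail_bounds(1)[OF psi] xvar_bounds[of psi x, OF psi x] by auto
      have tri: "\<bar>f psi - f (curve (param psi))\<bar> \<le> 2 * B"
        using B[OF psi] B[OF curve_B1[of "param psi"]] by linarith
      let ?R = "2 * tail N psi + 2 / \<eta> * tail N' psi + b * (xvar x psi)^2"
      have parts: "0 \<le> 2 * tail N psi" "0 \<le> 2 / \<eta> * tail N' psi" "0 \<le> b * (xvar x psi)^2"
        using nn \<eta> by (auto simp: b_def)
      show ?thesis
      \<comment> \<open>Markov's inequality built into the pointwise bound: where the error sum
        reaches 1 it pays for the trivial estimate \<open>2 * B\<close>; elsewhere each of its terms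
        is below 1 and \<open>psi\<close> is close to the curve.\<close>
      proof (cases "1 \<le> ?R")
        case True
        then have "2 * B * 1 \<le> 2 * B * ?R" using B0 by (intro mult_left_mono) auto
        then show ?thesis using tri e by linarith
      next
        case False
        have t1: "tail N psi \<le> 1/2" using False parts by linarith
        have "2 / \<eta> * tail N' psi < 1" using False parts by linarith
        then have t2: "tail N' psi < \<eta> / 2" using \<eta> by (simp add: field_simps)
        have "b * (xvar x psi)^2 < 1" using False parts by linarith
        then have "(2 / (g * \<eta>) * xvar x psi)^2 < 1" by (simp only: b_def power_mult_distrib)
        then have "2 / (g * \<eta>) * xvar x psi < 1" using nn g(1) \<eta> by (simp add: abs_square_less_1)
        then have t3: "xvar x psi / g < \<eta> / 2" using g(1) \<eta> by (simp add: field_simps)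
        obtain n where n: "1 - tail N' psi - xvar x psi / g \<le> pr psi n" using g(2)[OF psi] by blast
        then have near: "1 - \<eta> \<le> pr psi n" using t2 t3 by linarith
        have "dominant psi \<le> N" by (rule dominant_le[OF psi t1])
        then have "real (dominant psi) \<le> real N" by simp
        then have "param psi \<in> {0..2 * real N + 1}" using param_bounds[of psi] by auto
        moreover have "dist psi (curve (param psi)) < d"
          using dist_curve_param[OF psi near \<eta>(2)] \<eta>d by linarith
        ultimately have "\<bar>f psi - f (curve (param psi))\<bar> < e" using close psi by simp
        moreover have "0 \<le> ?R" using parts by linarith
        then have "0 \<le> 2 * B * ?R" using B0 by (intro mult_nonneg_nonneg) auto
        ultimately show ?thesis by linarith
      qed
    qed
    then show "\<exists>b\<ge>0. \<forall>psi\<in>B1. \<bar>f psi - f (curve (param psi))\<bar> \<le> e + 2 * B * (2 * tail N psi + 2 / \<eta> * tail N' psi + b * (xvar x psi)^2)"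
      by (intro exI[of _ b]) (auto simp: b_def)
  qed
qed

text \<open>The laws of \<open>param\<close> are tight on the line and have a weakly convergent
  subsequence; its limit is carried back by the continuous \<open>curve\<close>. Composing
  \<open>curve\<close> with \<open>param\<close> changes a state little in mean, as the variance
  tends to 0, so both sequences of laws share their limits.\<close>

lemma weak_compactness_near_fock:
  fixes x :: "nat \<Rightarrow> real"
  assumes Ms: "\<And>k. prob_on_B1 (Ms k)"
    and x: "\<And>n. 0 \<le> x n" "\<And>n. x n \<le> 1" and inj: "inj x"
    and tight: "\<And>e. e > 0 \<Longrightarrow> \<exists>N. \<forall>k. integral\<^sup>L (Ms k) (tail N) \<le> e"
    and var: "(\<lambda>k. integral\<^sup>L (Ms k) (\<lambda>psi. (xvar x psi)^2)) \<longlonglongrightarrow> 0"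
    and r: "strict_mono (r :: nat \<Rightarrow> nat)"
  shows "\<exists>r' M. strict_mono (r' :: nat \<Rightarrow> nat) \<and> prob_on_B1 M \<and> weak_conv_B1 (Ms \<circ> r \<circ> r') M"
proof -
  note ms = prob_on_B1_D[OF Ms]
  interpret P: prob_space "Ms k" for k by (rule ms)
  have [measurable]: "tail N \<in> borel_measurable B1_borel" for N
    by (intro measurable_continuous_on_B1 continuous_on_tail)
  have [measurable]: "(\<lambda>psi. (xvar x psi)^2) \<in> borel_measurable B1_borel"
    by (intro measurable_continuous_on_B1 continuous_intros continuous_on_xvar x)
  have int_tail: "integrable (Ms k) (tail N)" for k N
    using tail_bounds by (intro integrable_bounded_B1[OF Ms, of _ 1]) (auto simp: abs_le_iff intro: order_trans)
  have int_var: "integrable (Ms k) (\<lambda>psi. (xvar x psi)^2)" for k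
    using xvar_bounds[of _ x, OF _ x] by (intro integrable_bounded_B1[OF Ms, of _ 1]) (auto simp: power_le_one)
  define \<nu> where "\<nu> k = distr (Ms k) borel param" for k
  have pm: "param \<in> borel_measurable (Ms k)" for k by (simp add: ms(4))
  have rd: "real_distribution (\<nu> k)" for k
    unfolding \<nu>_def by (intro P.real_distribution_distr pm)
  have "tight \<nu>" unfolding tight_def
  proof (intro conjI allI impI rd)
    fix e :: real assume e: "e > 0"
    obtain N where N: "\<And>k. integral\<^sup>L (Ms k) (tail N) \<le> e / 4" using tight[of "e/4"] e by auto
    let ?I = "{-1<..2 * real N + 1}"
    have "measure (\<nu> k) ?I > 1 - e" for k
    proof -
      \<comment> \<open>Pointwise Markov bound: a tail of at most 1/2 puts the dominant level, and
        hence the parameter, in range. The left end -1 is there because the interval is open on the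
        left and must contain 0.\<close>
      have le: "1 - 2 * tail N psi \<le> indicator ?I (param psi)" if psi: "psi \<in> B1" for psi
      proof (cases "tail N psi \<le> 1/2")
        case True
        then have "real (dominant psi) \<le> real N" using dominant_le[OF psi] by simp
        then have "param psi \<in> ?I" using param_bounds[of psi] by auto
        then show ?thesis using tail_bounds(1)[OF psi, of N] by simp
      next
        case False
        then show ?thesis by (auto simp: indicator_def)
      qed
      have "measure (\<nu> k) ?I = measure (Ms k) (param -` ?I \<inter> space (Ms k))"
        unfolding \<nu>_def by (rule measure_distr[OF pm]) simp
      also have "\<dots> = integral\<^sup>L (Ms k) (\<lambda>psi. indicator (param -` ?I \<inter> space (Ms k)) psi)"
        using measurable_sets[OF pm, of ?I] by simp
      also have "\<dots> \<ge> integral\<^sup>L (Ms k) (\<lambda>psi. 1 - 2 * tail N psi)"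
      proof (rule integral_mono)
        show "integrable (Ms k) (\<lambda>psi. 1 - 2 * tail N psi)" using int_tail by simp
        show "integrable (Ms k) (\<lambda>psi. indicator (param -` ?I \<inter> space (Ms k)) psi :: real)"
          using measurable_sets[OF pm, of ?I] by (intro integrable_real_indicator) (auto simp: less_top[symmetric])
        show "1 - 2 * tail N psi \<le> indicator (param -` ?I \<inter> space (Ms k)) psi" if "psi \<in> space (Ms k)" for psi
          using le[of psi] that ms(3) by (auto simp: indicator_def)
      qed
      also have "integral\<^sup>L (Ms k) (\<lambda>psi. 1 - 2 * tail N psi) = 1 - 2 * integral\<^sup>L (Ms k) (tail N)"
        using int_tail by (simp add: P.prob_space)
      finally show ?thesis using N[of k] e by linarith
    qed
    then show "\<exists>a b. a < b \<and> (\<forall>k. measure (\<nu> k) {a<..b} > 1 - e)"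
      by - (rule exI[of _ "-1"], rule exI[of _ "2 * real N + 1"], simp)
  qed
  from tight_imp_convergent_subsubsequence[OF this r]
  obtain r' N where r': "strict_mono r'" and N: "real_distribution N" "weak_conv_m (\<nu> \<circ> r \<circ> r') N" by blast
  interpret N: real_distribution N by (rule N)
  have cm: "curve \<in> measurable borel B1_borel"
    unfolding measurable_B1_borel_iff using curve_B1
    by (auto intro!: borel_measurable_continuous_onI continuous_on_product_then_coordinatewise continuous_on_curve)
  then have cN: "curve \<in> measurable N B1_borel" by (simp add: measurable_cong_sets[of N borel])
  define M where "M = distr N B1_borel curve"
  have M: "prob_on_B1 M" unfolding prob_on_B1_def M_def using N.prob_space_distr[OF cN] by simp
  have "weak_conv_B1 (Ms \<circ> r \<circ> r') M" unfolding weak_conv_B1_def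
  proof (intro allI impI)
    fix f assume "bcont_B1 f"
    then obtain B where B: "\<And>psi. psi \<in> B1 \<Longrightarrow> \<bar>f psi\<bar> \<le> B" and f: "continuous_on B1 f"
      by (auto simp: bcont_B1_iff)
    have fm: "f \<in> borel_measurable B1_borel" by (rule measurable_continuous_on_B1[OF f])
    have B0: "0 \<le> B" using B[OF curve_B1[of 0]] abs_ge_zero order_trans by blast
    have fc: "continuous_on UNIV (\<lambda>t. f (curve t))"
      using curve_B1 by (intro continuous_on_compose2[OF f continuous_on_curve]) auto
    have cp: "(\<lambda>psi. f (curve (param psi))) \<in> borel_measurable B1_borel"
      using measurable_compose[OF measurable_param borel_measurable_continuous_onI[OF fc]] by simp
    define s where "s = r \<circ> r'"
    have s: "strict_mono s" unfolding s_def by (rule strict_mono_o[OF r r'])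
    have "(\<lambda>k. integral\<^sup>L ((\<nu> \<circ> r \<circ> r') k) (\<lambda>t. f (curve t))) \<longlonglongrightarrow> integral\<^sup>L N (\<lambda>t. f (curve t))"
      by (rule weak_conv_imp_integral_bdd_continuous_conv[of _ _ _ B])
        (use N rd fc B curve_B1 in \<open>auto simp: continuous_on_eq_continuous_at o_def\<close>)
    moreover have "integral\<^sup>L ((\<nu> \<circ> r \<circ> r') k) (\<lambda>t. f (curve t)) = integral\<^sup>L (Ms (s k)) (\<lambda>psi. f (curve (param psi)))" for k
      unfolding \<nu>_def s_def o_def by (rule integral_distr[OF pm borel_measurable_continuous_onI[OF fc]])
    moreover have "integral\<^sup>L N (\<lambda>t. f (curve t)) = integral\<^sup>L M f"
      unfolding M_def by (rule integral_distr[OF cN fm, symmetric])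
    ultimately have lim: "(\<lambda>k. integral\<^sup>L (Ms (s k)) (\<lambda>psi. f (curve (param psi)))) \<longlonglongrightarrow> integral\<^sup>L M f" by simp
    have "(\<lambda>k. integral\<^sup>L (Ms k) (\<lambda>psi. f psi - f (curve (param psi)))) \<longlonglongrightarrow> 0"
    proof (rule LIMSEQ_I)
      fix e0 :: real assume e0: "e0 > 0"
      \<comment> \<open>Three error terms of size \<open>e\<close> give the total
        \<open>e * (1 + 6 * B)\<close>, strictly below \<open>e0\<close> even for
        \<open>B = 0\<close>.\<close>
      define e where "e = e0 / (8 * B + 2)"
      have e1: "e > 0" "e * (8 * B + 2) = e0" using e0 B0 by (auto simp: e_def)
      have "e * (1 + 6 * B) < e * (8 * B + 2)" using e1(1) B0 by (intro mult_strict_left_mono) auto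
      then have e: "e > 0" "e + 2 * B * (3 * e) < e0" using e1 by (auto simp: algebra_simps)
      obtain T where T: "\<And>k. integral\<^sup>L (Ms k) (tail T) \<le> e / 2" using tight[of "e/2"] e by auto
      obtain a where a: "a \<ge> 0" "\<And>T'. \<exists>b\<ge>0. \<forall>psi\<in>B1. \<bar>f psi - f (curve (param psi))\<bar> \<le>
         e + 2 * B * (2 * tail T psi + a * tail T' psi + b * (xvar x psi)^2)"
        using f_curve_param_close[OF f B x inj e(1), of T] by blast
      obtain T' where T': "\<And>k. integral\<^sup>L (Ms k) (tail T') \<le> e / (a + 1)" using tight[of "e/(a+1)"] e a by auto
      obtain b where b: "b \<ge> 0" "\<And>psi. psi \<in> B1 \<Longrightarrow> \<bar>f psi - f (curve (param psi))\<bar> \<le>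
         e + 2 * B * (2 * tail T psi + a * tail T' psi + b * (xvar x psi)^2)" using a(2)[of T'] by blast
      have "eventually (\<lambda>k. integral\<^sup>L (Ms k) (\<lambda>psi. (xvar x psi)^2) < e / (b + 1)) sequentially"
        using e b by (intro order_tendstoD(2)[OF var]) auto
      then obtain k0 where k0: "\<And>k. k \<ge> k0 \<Longrightarrow> integral\<^sup>L (Ms k) (\<lambda>psi. (xvar x psi)^2) < e / (b + 1)"
        by (auto simp: eventually_sequentially)
      have "norm (integral\<^sup>L (Ms k) (\<lambda>psi. f psi - f (curve (param psi))) - 0) < e0" if "k \<ge> k0" for k
      proof -
        have i1: "integrable (Ms k) (\<lambda>psi. f psi - f (curve (param psi)))"
          using fm cp B curve_B1 by (intro Bochner_Integration.integrable_diff integrable_bounded_B1[OF Ms, of _ B]) auto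
        have "norm (integral\<^sup>L (Ms k) (\<lambda>psi. f psi - f (curve (param psi)))) \<le> integral\<^sup>L (Ms k) (\<lambda>psi. \<bar>f psi - f (curve (param psi))\<bar>)"
          using integral_norm_bound[of "Ms k" "\<lambda>psi. f psi - f (curve (param psi))"] by simp
        also have "\<dots> \<le> integral\<^sup>L (Ms k) (\<lambda>psi. e + 2 * B * (2 * tail T psi + a * tail T' psi + b * (xvar x psi)^2))"
          using i1 int_tail int_var b(2) ms(3) by (intro integral_mono) auto
        also have "\<dots> = e + 2 * B * (2 * integral\<^sup>L (Ms k) (tail T) + a * integral\<^sup>L (Ms k) (tail T') + b * integral\<^sup>L (Ms k) (\<lambda>psi. (xvar x psi)^2))"
          using int_tail int_var by (simp add: P.prob_space)
        also have "\<dots> \<le> e + 2 * B * (e + e + e)"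
        proof (intro add_left_mono mult_left_mono add_mono)
          show "2 * integral\<^sup>L (Ms k) (tail T) \<le> e" using T[of k] by simp
          have "a * integral\<^sup>L (Ms k) (tail T') \<le> a * (e / (a + 1))" using T'[of k] a by (intro mult_left_mono) auto
          also have "\<dots> \<le> e" using a e by (simp add: field_simps)
          finally show "a * integral\<^sup>L (Ms k) (tail T') \<le> e" .
          have "b * integral\<^sup>L (Ms k) (\<lambda>psi. (xvar x psi)^2) \<le> b * (e / (b + 1))" using k0[OF that] b by (intro mult_left_mono) auto
          also have "\<dots> \<le> e" using b e by (simp add: field_simps)
          finally show "b * integral\<^sup>L (Ms k) (\<lambda>psi. (xvar x psi)^2) \<le> e" .
        qed (use B0 in auto)
        also have "\<dots> < e0" using e(2) by simp
        finally show ?thesis by simp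
      qed
      then show "\<exists>no. \<forall>k\<ge>no. norm (integral\<^sup>L (Ms k) (\<lambda>psi. f psi - f (curve (param psi))) - 0) < e0" by blast
    qed
    from LIMSEQ_subseq_LIMSEQ[OF this s]
    have "(\<lambda>k. integral\<^sup>L (Ms (s k)) (\<lambda>psi. f psi - f (curve (param psi)))) \<longlonglongrightarrow> 0" by (simp add: o_def)
    from tendsto_add[OF this lim]
    have "(\<lambda>k. integral\<^sup>L (Ms (s k)) (\<lambda>psi. f psi - f (curve (param psi))) + integral\<^sup>L (Ms (s k)) (\<lambda>psi. f (curve (param psi)))) \<longlonglongrightarrow> integral\<^sup>L M f" by simp
    moreover have "integral\<^sup>L (Ms k) (\<lambda>psi. f psi - f (curve (param psi))) + integral\<^sup>L (Ms k) (\<lambda>psi. f (curve (param psi))) = integral\<^sup>L (Ms k) f" for k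
      using fm cp B curve_B1
      by (subst Bochner_Integration.integral_diff) (auto intro!: integrable_bounded_B1[OF Ms, of _ B])
    ultimately show "(\<lambda>k. integral\<^sup>L ((Ms \<circ> r \<circ> r') k) f) \<longlonglongrightarrow> integral\<^sup>L M f" by (simp add: s_def)
  qed
  with r' M show ?thesis by blast
qed

section \<open>Limit laws\<close>

text \<open>If the squares agree at \<open>m < n\<close>, A1 forces both cosine and sine to change
  sign, so the angles differ by an odd multiple of pi. Going the same distance once more, to
  \<open>n + (n - m)\<close>, returns to the cosine at \<open>m\<close>, against A1.\<close>

lemma A1_inj_cos2:
  assumes "A1 theta ph" shows "inj (cos2 theta ph)"
proof -
  have *: "cos2 theta ph m \<noteq> cos2 theta ph n" if "m < n" for m n
  proof
    let ?a = "theta + real m * ph" and ?b = "theta + real n * ph"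
    assume eq: "cos2 theta ph m = cos2 theta ph n"
    then have "(cos ?a)^2 = (cos ?b)^2" "(sin ?a)^2 = (sin ?b)^2" by (simp_all add: cos2_def sin_squared_eq)
    moreover have "cos ?a \<noteq> cos ?b" "sin ?a \<noteq> sin ?b" using assms that unfolding A1_def by auto
    ultimately have c: "cos ?b = - cos ?a" "sin ?b = - sin ?a" by (auto simp: power2_eq_iff)
    let ?k = "n + (n - m)"
    have "theta + real ?k * ph = ?b + (?b - ?a)" using that by (simp add: of_nat_diff algebra_simps)
    then have "cos (theta + real ?k * ph) = cos (?b + (?b - ?a))" by (rule arg_cong)
    also have "\<dots> = cos ?a * ((cos ?a)^2 + (sin ?a)^2)"
      unfolding cos_add[of ?b] cos_diff[of ?b] sin_diff[of ?b] c by algebra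
    also have "\<dots> = cos ?a" by simp
    finally show False using assms that unfolding A1_def by (metis add_gr_0 less_not_refl less_add_same_cancel1 trans_less_add1 zero_less_diff)
  qed
  show ?thesis by (rule injI) (metis * linorder_neqE_nat)
qed

lemma energy_ge_tail:
  assumes psi: "psi \<in> B1" and N: "nbar \<le> N"
  shows "ennreal (sigma_coef nbar (Suc N) * tail N psi) \<le> energy nbar psi"
proof -
  let ?s = "sigma_coef nbar"
  have s: "(\<lambda>m. ?s (Suc N) * (if m < Suc N then 0 else pr psi m)) sums (?s (Suc N) * tail N psi)"
    unfolding tail_def lessThan_Suc_atMost[symmetric] by (intro sums_mult B1_tail_sums psi)
  have "ennreal (?s (Suc N) * tail N psi) = (\<Sum>m. ennreal (?s (Suc N) * (if m < Suc N then 0 else pr psi m)))"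
    unfolding sums_unique[OF s] by (rule suminf_ennreal2[symmetric, OF _ sums_summable[OF s]]) (simp add: sigma_coef_nonneg)
  also have "\<dots> \<le> energy nbar psi"
    unfolding energy_def using N
    by (intro suminf_le summableI ennreal_leI) (auto simp: sigma_coef_nonneg intro!: mult_right_mono sigma_coef_mono)
  finally show ?thesis .
qed

lemma measurable_lyap: "lyap nbar x \<delta> \<in> borel_measurable B1_borel"
  unfolding lyap_def energy_def wsum_def by measurable

text \<open>The decrements sum to at most the initial value. Working in ennreal matters because
  energies may be infinite; finiteness is inherited from \<open>u 0\<close>.\<close>

lemma ennreal_telescope:
  fixes u :: "nat \<Rightarrow> ennreal" and q :: "nat \<Rightarrow> real"
  assumes step: "\<And>k. u (Suc k) + ennreal (q k) \<le> u k" and q: "\<And>k. 0 \<le> q k" and u0: "u 0 \<le> ennreal C"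
  shows "q \<longlonglongrightarrow> 0" and "u k \<le> ennreal C"
proof -
  have t: "u k + ennreal (\<Sum>j<k. q j) \<le> u 0" for k
  proof (induction k)
    case (Suc k)
    have "u (Suc k) + ennreal (\<Sum>j<Suc k. q j) = (u (Suc k) + ennreal (q k)) + ennreal (\<Sum>j<k. q j)"
      using q by (simp add: sum_nonneg add_ac)
    also have "\<dots> \<le> u k + ennreal (\<Sum>j<k. q j)" by (intro add_right_mono step)
    also have "\<dots> \<le> u 0" by (rule Suc)
    finally show ?case .
  qed simp
  have "u k \<le> u k + ennreal (\<Sum>j<k. q j)" by simp
  then show "u k \<le> ennreal C" using t[of k] u0 by (meson order_trans)
  have "ennreal (\<Sum>j<k. q j) \<le> ennreal C" for k
    using t[of k] u0 add_increasing[of "u k" "ennreal (\<Sum>j<k. q j)"] by (meson order_refl order_trans zero_le)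
  then have "(\<Sum>j<k. q j) \<le> max 0 C" for k
    by (metis ennreal_le_iff2 max.coboundedI1 max.coboundedI2)
  then have "summable q"
    by (intro bounded_imp_summable[of _ "max 0 C"] q) (metis lessThan_Suc_atMost)
  then show "q \<longlonglongrightarrow> 0" by (rule summable_LIMSEQ_zero)
qed

lemma fock_phase_B1: "(\<lambda>m. cis gam * fock n m) \<in> B1"
proof -
  have "(\<lambda>m. (cmod (cis gam * fock n m))^2) = (\<lambda>m. if m = n then 1 else 0)"
    by (auto simp: fock_def norm_mult)
  then have "(\<lambda>m. (cmod (cis gam * fock n m))^2) sums 1" using sums_single[of n "\<lambda>_. 1::real"] by simp
  then show ?thesis by (auto simp: B1_def sums_iff)
qed

lemma AE_zero_of_weak_limit:
  assumes Ms: "weak_conv_B1 Ms M" and M: "prob_on_B1 M" and f: "bcont_B1 f" "\<And>psi. psi \<in> B1 \<Longrightarrow> 0 \<le> f psi"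
    and lim: "(\<lambda>k. integral\<^sup>L (Ms k) f) \<longlonglongrightarrow> 0"
  shows "AE psi in M. f psi = 0"
proof -
  obtain K where K: "\<And>psi. psi \<in> B1 \<Longrightarrow> \<bar>f psi\<bar> \<le> K" and c: "continuous_on B1 f" using f(1) by (auto simp: bcont_B1_iff)
  have i: "integrable M f" by (rule integrable_bounded_B1[OF M measurable_continuous_on_B1[OF c] K])
  have "(\<lambda>k. integral\<^sup>L (Ms k) f) \<longlonglongrightarrow> integral\<^sup>L M f" using Ms f(1) by (simp add: weak_conv_B1_def)
  then have "integral\<^sup>L M f = 0" using lim LIMSEQ_unique by blast
  moreover have "AE psi in M. 0 \<le> f psi" using f(2) prob_on_B1_D(3)[OF M] by (intro AE_I2) auto
  ultimately show ?thesis using integral_nonneg_eq_0_iff_AE[OF i] by simp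
qed

lemma bcont_tail: "bcont_B1 (tail N)"
  unfolding bcont_B1_iff using tail_bounds continuous_on_tail
  by (intro conjI exI[of _ 1] ballI) (auto simp: abs_le_iff intro: order_trans)

lemma bcont_xvar2:
  assumes "\<And>n. 0 \<le> x n" "\<And>n. x n \<le> 1" shows "bcont_B1 (\<lambda>psi. (xvar x psi)^2)"
  unfolding bcont_B1_iff using xvar_bounds[of _ x, OF _ assms]
  by (intro conjI exI[of _ 1] ballI continuous_intros continuous_on_xvar assms) (auto simp: power_le_one)

text \<open>A continuous stand-in for the indicator of a neighbourhood of |n>: dominated by \<eta>
  times the indicator, yet positive wherever \<open>|psi n| = 1\<close>.\<close>

lemma bcont_coord_bump: "bcont_B1 (\<lambda>psi. max 0 (pr psi n - (1 - \<eta>)))" if "0 \<le> \<eta>"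
  unfolding bcont_B1_iff
proof (intro conjI exI[of _ \<eta>] ballI)
  fix psi assume "psi \<in> B1"
  then have "pr psi n \<le> 1" using B1_D(3)[of psi n] by (simp add: power_le_one)
  then show "\<bar>max 0 (pr psi n - (1 - \<eta>))\<bar> \<le> \<eta>" using that by auto
next
  show "continuous_on B1 (\<lambda>psi. max 0 (pr psi n - (1 - \<eta>)))"
    by (intro continuous_intros continuous_on_product_coordinates[THEN continuous_on_subset]) auto
qed

text \<open>Under the limit law the variance vanishes almost surely, and an open set where it is
  nonzero cannot meet the support. The bumps exclude the levels up to \<open>N\<close> other than
  the target, so almost every state is the target or has \<open>tail N = 1\<close>; the mean of the
  tail then bounds the mass missing at the target.\<close>

lemma weak_limit_on_fock:
  fixes x :: "nat \<Rightarrow> real"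
  assumes conv: "weak_conv_B1 Ms M" and M: "prob_on_B1 M" and Ms: "\<And>k. prob_on_B1 (Ms k)"
    and x: "\<And>n. 0 \<le> x n" "\<And>n. x n \<le> 1" and inj: "inj x"
    and var: "(\<lambda>k. integral\<^sup>L (Ms k) (\<lambda>psi. (xvar x psi)^2)) \<longlonglongrightarrow> 0"
    and tailN: "\<And>k. integral\<^sup>L (Ms k) (tail N) \<le> eps"
    and unst: "\<And>n. n \<le> N \<Longrightarrow> n \<noteq> nbar \<Longrightarrow>
       \<exists>\<eta>>0. (\<lambda>k. integral\<^sup>L (Ms k) (indicat_real {psi. 1 - \<eta> \<le> pr psi n})) \<longlonglongrightarrow> 0"
  shows "\<forall>psi\<in>supp_B1 M. \<exists>n gam. psi = (\<lambda>m. cis gam * fock n m)"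
    and "measure M {psi. \<exists>gam. psi = (\<lambda>m. cis gam * fock nbar m)} \<ge> 1 - eps"
proof -
  note m = prob_on_B1_D[OF M]
  interpret prob_space M by (rule m)
  have var0: "AE psi in M. (xvar x psi)^2 = 0"
    by (rule AE_zero_of_weak_limit[OF conv M bcont_xvar2[of x, OF x] _ var]) simp
  have xm: "(\<lambda>psi. (xvar x psi)^2) \<in> borel_measurable M"
    unfolding m(4) using bcont_xvar2[of x, OF x] by (intro measurable_continuous_on_B1) (simp add: bcont_B1_iff)
  show "\<forall>psi\<in>supp_B1 M. \<exists>n gam. psi = (\<lambda>m. cis gam * fock n m)"
  proof
    fix psi assume s: "psi \<in> supp_B1 M"
    then have psi: "psi \<in> B1" by (simp add: supp_B1_def)
    have "xvar x psi = 0"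
    proof (rule ccontr)
      assume "xvar x psi \<noteq> 0"
      then have "0 < (xvar x psi)^2" by simp
      then obtain d where d: "d > 0" "\<And>phi. phi \<in> B1 \<Longrightarrow> l2dist phi psi < d \<Longrightarrow> \<bar>(xvar x phi)^2 - (xvar x psi)^2\<bar> < (xvar x psi)^2"
        using bcont_xvar2[of x, OF x] psi unfolding bcont_B1_def by blast
      have "(xvar x phi)^2 \<noteq> 0" if "phi \<in> B1" "l2dist phi psi < d" for phi
        using d(2)[OF that] by (intro notI) simp
      moreover have ms: "{phi\<in>space M. (xvar x phi)^2 \<noteq> 0} \<in> sets M" using xm by measurable
      ultimately have "emeasure M {phi\<in>B1. l2dist phi psi < d} \<le> emeasure M {phi\<in>space M. (xvar x phi)^2 \<noteq> 0}"
        by (intro emeasure_mono) (auto simp: m(3))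
      also have "\<dots> = 0" using AE_iff_measurable[OF ms refl] var0 by simp
      finally show False using s d(1) by (auto simp: supp_B1_def)
    qed
    from fock_of_xvar_0[of psi x, OF psi x inj this] show "\<exists>n gam. psi = (\<lambda>m. cis gam * fock n m)"
      using fock_phase_iff[OF psi] by blast
  qed
  have F: "{psi. \<exists>gam. psi = (\<lambda>m. cis gam * fock nbar m)} = {psi\<in>space M. cmod (psi nbar) = 1}"
    using fock_phase_iff[of _ nbar] fock_phase_B1[of _ nbar] m(3) by auto
  have coord[measurable]: "(\<lambda>psi. psi n) \<in> borel_measurable M" for n by (simp add: m(4))
  have "AE psi in M. cmod (psi n) \<noteq> 1" if n: "n \<le> N" "n \<noteq> nbar" for n
  proof -
    obtain \<eta> where \<eta>: "\<eta> > 0" and lim: "(\<lambda>k. integral\<^sup>L (Ms k) (indicat_real {psi. 1 - \<eta> \<le> pr psi n})) \<longlonglongrightarrow> 0"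
      using unst[OF n] by blast
    let ?I = "indicat_real {psi. 1 - \<eta> \<le> pr psi n}"
    let ?h = "\<lambda>psi. max 0 (pr psi n - (1 - \<eta>))"
    have hb: "bcont_B1 ?h" using bcont_coord_bump[of \<eta> n] \<eta> by simp
    have le: "?h psi \<le> \<eta> * ?I psi" if "psi \<in> B1" for psi
    proof -
      have "pr psi n \<le> 1" using B1_D(3)[OF that, of n] by (simp add: power_le_one)
      then show ?thesis using \<eta> by (auto simp: indicator_def)
    qed
    have "(\<lambda>k. integral\<^sup>L (Ms k) ?h) \<longlonglongrightarrow> 0"
    proof (rule tendsto_sandwich[of "\<lambda>_. 0"])
      show "\<forall>\<^sub>F k in sequentially. 0 \<le> integral\<^sup>L (Ms k) ?h" by simp
      show "\<forall>\<^sub>F k in sequentially. integral\<^sup>L (Ms k) ?h \<le> \<eta> * integral\<^sup>L (Ms k) ?I"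
      proof (intro always_eventually allI)
        fix k
        note mk = prob_on_B1_D[OF Ms[of k]]
        have i1: "integrable (Ms k) ?h"
          using hb by (intro integrable_bounded_B1[OF Ms, of _ \<eta>] measurable_continuous_on_B1) (auto simp: bcont_B1_iff B1_D(3) power_le_one \<eta> less_imp_le)
        have i2: "integrable (Ms k) ?I"
        proof (rule integrable_bounded_B1[OF Ms, of _ 1])
          have "(\<lambda>psi. if 1 - \<eta> \<le> pr psi n then 1 else 0 :: real) \<in> borel_measurable B1_borel" by measurable
          then show "?I \<in> borel_measurable B1_borel"
            by (simp add: indicator_def[abs_def] of_bool_def)
        qed (auto simp: indicator_def)
        have "integral\<^sup>L (Ms k) ?h \<le> integral\<^sup>L (Ms k) (\<lambda>psi. \<eta> * ?I psi)"
          using i1 i2 le mk(3) by (intro integral_mono) auto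
        then show "integral\<^sup>L (Ms k) ?h \<le> \<eta> * integral\<^sup>L (Ms k) ?I" by simp
      qed
      show "(\<lambda>k. \<eta> * integral\<^sup>L (Ms k) ?I) \<longlonglongrightarrow> 0"
        using tendsto_mult_left[OF lim, of \<eta>] by simp
    qed simp
    from AE_zero_of_weak_limit[OF conv M hb _ this] have "AE psi in M. ?h psi = 0" by simp
    then show ?thesis by eventually_elim (use \<eta> in auto)
  qed
  then have "AE psi in M. n \<le> N \<longrightarrow> n \<noteq> nbar \<longrightarrow> cmod (psi n) \<noteq> 1" for n by (cases "n \<le> N \<and> n \<noteq> nbar") auto
  then have unst0: "AE psi in M. \<forall>n. n \<le> N \<longrightarrow> n \<noteq> nbar \<longrightarrow> cmod (psi n) \<noteq> 1" by (simp add: AE_all_countable)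
  have it: "integrable M (tail N)"
    using bcont_tail[of N] tail_bounds by (intro integrable_bounded_B1[OF M, of _ 1] measurable_continuous_on_B1) (auto simp: bcont_B1_iff abs_le_iff intro: order_trans)
  have meas: "{psi\<in>space M. cmod (psi nbar) = 1} \<in> sets M" by measurable
  have "(\<lambda>k. integral\<^sup>L (Ms k) (tail N)) \<longlonglongrightarrow> integral\<^sup>L M (tail N)" using conv bcont_tail by (simp add: weak_conv_B1_def)
  then have tM: "integral\<^sup>L M (tail N) \<le> eps" using tailN by (intro LIMSEQ_le_const2) auto
  have "1 - integral\<^sup>L M (tail N) = integral\<^sup>L M (\<lambda>psi. 1 - tail N psi)" using it by (simp add: prob_space)
  also have "\<dots> \<le> integral\<^sup>L M (indicat_real {psi\<in>space M. cmod (psi nbar) = 1})"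
  proof (rule integral_mono_AE)
    show "integrable M (\<lambda>psi. 1 - tail N psi)" using it by simp
    show "integrable M (indicat_real {psi\<in>space M. cmod (psi nbar) = 1})"
      using meas by (intro integrable_real_indicator) (auto simp: less_top[symmetric])
    show "AE psi in M. 1 - tail N psi \<le> indicat_real {psi\<in>space M. cmod (psi nbar) = 1} psi"
      using var0 unst0 AE_space
    proof eventually_elim
      case (elim psi)
      then have psi: "psi \<in> B1" by (simp add: m(3))
      obtain n where n: "cmod (psi n) = 1" using fock_of_xvar_0[of psi x, OF psi x inj] elim(1) by auto
      show ?case
      proof (cases "n = nbar")
        case True
        then show ?thesis using n elim tail_bounds(1)[OF psi, of N] by simp
      next
        case False
        then have "N < n" using elim(2) n by (metis not_le)
        then have "1 \<le> tail N psi" using coord_le_tail[OF psi, of N n] n by simp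
        then show ?thesis by (simp add: indicator_def)
      qed
    qed
  qed
  also have "\<dots> = measure M {psi\<in>space M. cmod (psi nbar) = 1}" using meas by simp
  finally show "measure M {psi. \<exists>gam. psi = (\<lambda>m. cis gam * fock nbar m)} \<ge> 1 - eps" unfolding F using tM by linarith
qed

section \<open>The closed loop as a supermartingale\<close>

lemma Vlyap_le_iff:
  assumes "0 \<le> \<delta>" "psi \<in> B1" "chi \<in> B1"
  shows "Vlyap nbar theta ph \<delta> psi \<le> Vlyap nbar theta ph \<delta> chi \<longleftrightarrow>
    lyap nbar (cos2 theta ph) \<delta> psi \<le> lyap nbar (cos2 theta ph) \<delta> chi"
proof -
  obtain e where e: "\<forall>psi\<in>B1. Vlyap nbar theta ph \<delta> psi = enn2ereal (lyap nbar (cos2 theta ph) \<delta> psi) - ereal e"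
    using Vlyap_lyap[OF assms(1)] by blast
  have "enn2ereal a - ereal e \<le> enn2ereal b - ereal e \<longleftrightarrow> a \<le> b" for a b
    unfolding less_eq_ennreal.rep_eq by (cases "enn2ereal a"; cases "enn2ereal b") auto
  then show ?thesis using e assms by simp
qed

lemma lyap_integral_le:
  assumes mu: "prob_on_B1 mu" and \<delta>: "0 \<le> \<delta>" and C: "0 \<le> C"
    and V: "(\<integral>\<^sup>+ psi. e2ennreal (Vlyap nbar theta ph \<delta> psi) \<partial>mu) \<le> ennreal C"
  shows "(\<integral>\<^sup>+ psi. lyap nbar (cos2 theta ph) \<delta> psi \<partial>mu) \<le> ennreal (C + \<delta>)"
proof -
  note m = prob_on_B1_D[OF mu]
  interpret prob_space mu by (rule m)
  let ?L = "lyap nbar (cos2 theta ph) \<delta>"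
  have L[measurable]: "?L \<in> borel_measurable mu" by (simp add: m(4) measurable_lyap)
  obtain e where e: "0 \<le> e" "e \<le> \<delta>" "\<And>psi. psi \<in> B1 \<Longrightarrow> Vlyap nbar theta ph \<delta> psi = enn2ereal (?L psi) - ereal e"
    using Vlyap_lyap[OF \<delta>] by blast
  \<comment> \<open>\<open>e2ennreal\<close> and subtraction in ennreal both truncate at 0, so they
    agree also where \<open>V\<close> could be negative.\<close>
  have V_eq: "e2ennreal (Vlyap nbar theta ph \<delta> psi) = ?L psi - ennreal e" if "psi \<in> B1" for psi
    unfolding e(3)[OF that]
    by (cases "?L psi") (use e(1) in \<open>auto simp: ennreal_minus top_ereal_def\<close>)
  have "(\<integral>\<^sup>+ psi. ?L psi \<partial>mu) \<le> (\<integral>\<^sup>+ psi. (?L psi - ennreal e) + ennreal e \<partial>mu)"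
  proof (intro nn_integral_mono)
    show "?L psi \<le> ?L psi - ennreal e + ennreal e" for psi
      by (cases "ennreal e \<le> ?L psi") (auto simp: diff_add_cancel_ennreal intro: add_increasing)
  qed
  also have "\<dots> = (\<integral>\<^sup>+ psi. ?L psi - ennreal e \<partial>mu) + ennreal e"
    by (simp add: nn_integral_add emeasure_space_1)
  also have "(\<integral>\<^sup>+ psi. ?L psi - ennreal e \<partial>mu) = (\<integral>\<^sup>+ psi. e2ennreal (Vlyap nbar theta ph \<delta> psi) \<partial>mu)"
    by (intro nn_integral_cong) (simp add: V_eq m(3))
  also have "\<dots> + ennreal e \<le> ennreal C + ennreal \<delta>" using V e by (intro add_mono ennreal_leI)
  also have "\<dots> = ennreal (C + \<delta>)" using C \<delta> by simp
  finally show ?thesis .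
qed

lemma prob_on_B1_Gamma:
  assumes "prob_on_B1 mu" "fb \<in> borel_measurable B1_borel" "\<And>v. v \<in> B1 \<Longrightarrow> \<bar>fb v\<bar> \<le> 1"
  shows "prob_on_B1 (Gamma theta ph fb k mu)"
  unfolding Gamma_def by (induction k) (auto simp: assms Gstep_properties(1))

lemma Gamma_decrease:
  assumes mu: "prob_on_B1 mu" and fb: "fb \<in> borel_measurable B1_borel" "\<And>v. v \<in> B1 \<Longrightarrow> \<bar>fb v\<bar> \<le> 1"
    and q: "\<And>psi. psi \<in> B1 \<Longrightarrow> 0 \<le> q psi" "\<And>psi. psi \<in> B1 \<Longrightarrow> q psi \<le> B" "q \<in> borel_measurable B1_borel"
    and L: "L \<in> borel_measurable B1_borel" "(\<integral>\<^sup>+ psi. L psi \<partial>mu) \<le> ennreal C"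
    and step: "\<And>psi. psi \<in> B1 \<Longrightarrow> ennreal (pout True theta ph psi) * L (fullstep True theta ph fb psi)
       + ennreal (pout False theta ph psi) * L (fullstep False theta ph fb psi) + ennreal (q psi) \<le> L psi"
  shows "(\<lambda>k. integral\<^sup>L (Gamma theta ph fb k mu) q) \<longlonglongrightarrow> 0"
    and "(\<integral>\<^sup>+ psi. L psi \<partial>Gamma theta ph fb k mu) \<le> ennreal C"
proof -
  let ?G = "\<lambda>k. Gamma theta ph fb k mu"
  let ?S = "\<lambda>psi. ennreal (pout True theta ph psi) * L (fullstep True theta ph fb psi)
       + ennreal (pout False theta ph psi) * L (fullstep False theta ph fb psi)"
  note pG = prob_on_B1_Gamma[OF mu fb, of theta ph]
  note m = prob_on_B1_D[OF pG]
  have Gs: "?G (Suc k) = Gstep theta ph fb (?G k)" for k by (simp add: Gamma_def)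
  have s: "(\<integral>\<^sup>+ psi. L psi \<partial>?G (Suc k)) + ennreal (integral\<^sup>L (?G k) q) \<le> (\<integral>\<^sup>+ psi. L psi \<partial>?G k)" for k
  proof -
    have i: "integrable (?G k) q" using q by (intro integrable_bounded_B1[OF pG, of _ B]) auto
    have "ennreal (integral\<^sup>L (?G k) q) = (\<integral>\<^sup>+ psi. ennreal (q psi) \<partial>?G k)"
      using q(1) by (intro nn_integral_eq_integral[symmetric] i AE_I2) (simp add: m)
    then have "(\<integral>\<^sup>+ psi. L psi \<partial>?G (Suc k)) + ennreal (integral\<^sup>L (?G k) q) =
       (\<integral>\<^sup>+ psi. ?S psi \<partial>?G k) + (\<integral>\<^sup>+ psi. ennreal (q psi) \<partial>?G k)"
      by (simp only: Gs Gstep_properties(2)[OF pG fb L(1)])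
    also have "\<dots> = (\<integral>\<^sup>+ psi. ?S psi + ennreal (q psi) \<partial>?G k)"
    proof (rule nn_integral_add[symmetric])
      have [measurable]: "(\<lambda>psi. L (fullstep b theta ph fb psi)) \<in> borel_measurable B1_borel" for b
        by (rule measurable_compose[OF measurable_fullstep[OF fb] L(1)])
      show "?S \<in> borel_measurable (?G k)"
        by (subst m(4)) measurable
      show "(\<lambda>psi. ennreal (q psi)) \<in> borel_measurable (?G k)" using q(3) by (subst m(4)) measurable
    qed
    also have "\<dots> \<le> (\<integral>\<^sup>+ psi. L psi \<partial>?G k)" using step by (intro nn_integral_mono) (simp add: m)
    finally show ?thesis .
  qed
  have q0: "0 \<le> integral\<^sup>L (?G k) q" for k using q(1) by (intro integral_nonneg_AE AE_I2) (simp add: m)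
  have u0: "(\<integral>\<^sup>+ psi. L psi \<partial>?G 0) \<le> ennreal C" using L(2) by (simp add: Gamma_def)
  show "(\<lambda>k. integral\<^sup>L (?G k) q) \<longlonglongrightarrow> 0" "(\<integral>\<^sup>+ psi. L psi \<partial>?G k) \<le> ennreal C"
    using ennreal_telescope[of "\<lambda>k. \<integral>\<^sup>+ psi. L psi \<partial>?G k" "\<lambda>k. integral\<^sup>L (?G k) q", OF s q0 u0] by auto
qed

lemma tail_integral_le:
  assumes mu: "prob_on_B1 mu" and L: "(\<integral>\<^sup>+ psi. lyap nbar x \<delta> psi \<partial>mu) \<le> ennreal C" and C: "0 \<le> C"
    and N: "nbar \<le> N" and s: "C \<le> e * sigma_coef nbar (Suc N)" "0 < sigma_coef nbar (Suc N)"
  shows "integral\<^sup>L mu (tail N) \<le> e"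
proof -
  note m = prob_on_B1_D[OF mu]
  have i: "integrable mu (tail N)"
    using bcont_tail[of N] tail_bounds by (intro integrable_bounded_B1[OF mu, of _ 1] measurable_continuous_on_B1) (auto simp: bcont_B1_iff abs_le_iff intro: order_trans)
  let ?s = "sigma_coef nbar (Suc N)"
  have "ennreal (?s * integral\<^sup>L mu (tail N)) = ennreal (integral\<^sup>L mu (\<lambda>psi. ?s * tail N psi))" by simp
  also have "\<dots> = (\<integral>\<^sup>+ psi. ennreal (?s * tail N psi) \<partial>mu)"
    using s i tail_bounds(1) by (intro nn_integral_eq_integral[symmetric] AE_I2) (auto simp: m)
  also have "\<dots> \<le> (\<integral>\<^sup>+ psi. lyap nbar x \<delta> psi \<partial>mu)"
  proof (intro nn_integral_mono)
    fix psi assume "psi \<in> space mu"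
    then have "ennreal (?s * tail N psi) \<le> energy nbar psi" by (intro energy_ge_tail N) (simp add: m)
    also have "\<dots> \<le> lyap nbar x \<delta> psi" by (simp add: lyap_def)
    finally show "ennreal (?s * tail N psi) \<le> lyap nbar x \<delta> psi" .
  qed
  also note L
  finally have "?s * integral\<^sup>L mu (tail N) \<le> C" using C by (simp add: ennreal_le_iff)
  also have "C \<le> ?s * e" using s by (simp add: mult.commute)
  finally show ?thesis using s(2) by simp
qed

text \<open>The feedback is an arbitrary measurable selection of minimisers. Convergence to the
  limit set is phrased by subsequences, which rules out that part of the sequence stays away from
  all limit laws. Fock states appear up to a phase because \<open>V\<close> depends on moduli
  only.\<close>

theorem theorem2:
  fixes nbar :: nat and theta ph :: real
  assumes "A1 theta ph"
  shows "\<forall>eps>0. \<forall>C>0. \<exists>delta>0. \<exists>abar>0.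
     \<forall>fb. fb \<in> B1_borel \<rightarrow>\<^sub>M borel \<longrightarrow>
          (\<forall>psi\<in>B1. fb psi \<in> argmin_set nbar theta ph delta abar psi) \<longrightarrow>
     (\<forall>mu. prob_on_B1 mu \<longrightarrow>
          (\<integral>\<^sup>+ psi. e2ennreal (Vlyap nbar theta ph delta psi) \<partial>mu) \<le> ennreal C \<longrightarrow>
        (let Om = limit_set (\<lambda>k. Gamma theta ph fb k mu) in
          Om \<noteq> {} \<and>
          (\<forall>r::nat\<Rightarrow>nat. strict_mono r \<longrightarrow> (\<exists>r'::nat\<Rightarrow>nat. strict_mono r' \<and>
               (\<exists>M\<in>Om. weak_conv_B1 ((\<lambda>k. Gamma theta ph fb k mu) \<circ> r \<circ> r') M))) \<and>
          (\<forall>M\<in>Om.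
             (\<forall>psi\<in>supp_B1 M. \<exists>n gam. psi = (\<lambda>m. cis gam * fock n m)) \<and>
             measure M {psi. \<exists>gam. psi = (\<lambda>m. cis gam * fock nbar m)} \<ge> 1 - eps)))"
proof (intro allI impI, goal_cases)
  case (1 eps C)
  note eps = \<open>eps > 0\<close> and C = \<open>C > 0\<close>
  define x where "x = cos2 theta ph"
  have x: "0 \<le> x n" "x n \<le> 1" for n by (simp_all add: x_def cos2_bounds)
  have inj: "inj x" unfolding x_def by (rule A1_inj_cos2[OF assms])
  have large: "\<exists>N\<ge>nbar. C + 1 \<le> e * sigma_coef nbar (Suc N) \<and> 0 < sigma_coef nbar (Suc N)" if e: "e > 0" for e
  proof -
    obtain n where n: "n > nbar" "(C + 1) / e \<le> sigma_coef nbar n" using sigma_coef_unbounded by blast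
    have "0 < (C + 1) / e" using C e by simp
    then have "0 < sigma_coef nbar n" using n(2) by linarith
    moreover have "C + 1 \<le> e * sigma_coef nbar n" using n(2) e by (simp add: field_simps)
    moreover obtain N where "n = Suc N" using n(1) by (cases n) auto
    ultimately show ?thesis using n(1) by (intro exI[of _ N]) auto
  qed
  \<comment> \<open>\<open>N\<close> uses the bound \<open>C + 1\<close>, valid for all \<delta>
    \<le> 1, and so can be fixed before \<delta>.\<close>
  obtain N where N: "nbar \<le> N" "C + 1 \<le> eps * sigma_coef nbar (Suc N)" "0 < sigma_coef nbar (Suc N)"
    using large[OF eps] by blast
  have "\<forall>n. \<exists>d>0. n \<noteq> nbar \<longrightarrow> (\<forall>\<delta>. 0 < \<delta> \<longrightarrow> \<delta> \<le> d \<longrightarrow> (\<exists>\<eta>>0. \<exists>c>0. \<exists>a. 0 \<le> a \<and> a \<le> 1 \<and>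
    (\<forall>psi\<in>B1. 1 - \<eta> \<le> pr psi n \<longrightarrow> lyap nbar x \<delta> (Dop a psi) + ennreal c \<le> lyap nbar x \<delta> psi)))"
    (is "\<forall>n. \<exists>d>0. n \<noteq> nbar \<longrightarrow> ?P n d")
  proof
    fix n show "\<exists>d>0. n \<noteq> nbar \<longrightarrow> ?P n d"
      using lyap_control_drop[of n nbar x, OF _ x] by (cases "n = nbar") (auto intro: exI[of _ 1])
  qed
  then obtain d where d: "\<forall>n. d n > 0 \<and> (n \<noteq> nbar \<longrightarrow> ?P n (d n))" by (rule choice[THEN exE])
  \<comment> \<open>One \<delta> must destabilise every wrong level up to \<open>N\<close>; the
    minimum is over finitely many thresholds, and the entry 1 ensures \<delta> \<le> 1.\<close>
  define \<delta> where "\<delta> = Min (insert 1 (d ` {..N}))"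
  have \<delta>: "0 < \<delta>" "\<delta> \<le> 1" "\<And>n. n \<le> N \<Longrightarrow> \<delta> \<le> d n"
    unfolding \<delta>_def using d by (auto intro!: Min_le simp del: Min_insert)
  \<comment> \<open>The control bound 1 admits every trial displacement of
    \<open>lyap_control_drop\<close> as a competitor of the optimal feedback.\<close>
  show ?case
  proof (rule exI[of _ \<delta>], rule conjI[OF \<delta>(1)], rule exI[of _ 1], rule conjI[OF zero_less_one],
      intro allI impI, goal_cases)
    case (1 fb mu)
    note fbm = 1(1) and fba = 1(2) and mu = 1(3) and V = 1(4)
    let ?G = "\<lambda>k. Gamma theta ph fb k mu"
    let ?L = "lyap nbar x \<delta>"
    have fb1: "\<bar>fb v\<bar> \<le> 1" if "v \<in> B1" for v using fba that by (auto simp: argmin_set_def)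
    have opt: "?L (Dop (fb v) v) \<le> ?L (Dop a v)" if v: "v \<in> B1" and a: "\<bar>a\<bar> \<le> 1" for v a
    proof -
      have "a \<in> {-1..1}" using a by auto
      then have "Vlyap nbar theta ph \<delta> (Dop (fb v) v) \<le> Vlyap nbar theta ph \<delta> (Dop a v)"
        using fba v by (auto simp: argmin_set_def)
      then show ?thesis unfolding x_def using \<delta>(1) by (subst (asm) Vlyap_le_iff) (auto intro!: Dop_B1 v a fb1)
    qed
    have opt0: "?L (Dop (fb v) v) \<le> ?L v" if "v \<in> B1" for v using opt[OF that, of 0] by (simp add: Dop_0)
    note pG = prob_on_B1_Gamma[OF mu fbm fb1, of theta ph]
    have L0: "(\<integral>\<^sup>+ psi. ?L psi \<partial>mu) \<le> ennreal (C + 1)"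
    proof -
      have "(\<integral>\<^sup>+ psi. ?L psi \<partial>mu) \<le> ennreal (C + \<delta>)"
        unfolding x_def using \<delta>(1) C by (intro lyap_integral_le[OF mu _ _ V]) auto
      also have "\<dots> \<le> ennreal (C + 1)" using \<delta>(2) by (intro ennreal_leI) simp
      finally show ?thesis .
    qed
    have xm: "(\<lambda>psi. (xvar x psi)^2) \<in> borel_measurable B1_borel"
      using bcont_xvar2[of x, OF x] by (intro measurable_continuous_on_B1) (simp add: bcont_B1_iff)
    have xb: "0 \<le> (xvar x psi)^2" "(xvar x psi)^2 \<le> 1" if "psi \<in> B1" for psi
      using xvar_bounds[of psi x, OF that x] by (auto simp: power_le_one)
    have Im: "indicat_real {psi. 1 - \<eta> \<le> pr psi n} \<in> borel_measurable B1_borel" for \<eta> n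
    proof -
      have "(\<lambda>psi. if 1 - \<eta> \<le> pr psi n then 1 else 0 :: real) \<in> borel_measurable B1_borel" by measurable
      then show ?thesis by (simp add: indicator_def[abs_def] of_bool_def)
    qed
    \<comment> \<open>With \<open>c = 0\<close> and the competitor 0 this yields the vanishing
      variance and the energy bound; with the drop at an unstable level it yields, in addition, that
      the mass near this level vanishes.\<close>
    have decrease: "(\<lambda>k. integral\<^sup>L (?G k) (\<lambda>psi. 8 * \<delta> * (xvar x psi)^2 + c / 2 * indicat_real {psi. 1 - \<eta> / 2 \<le> pr psi n} psi)) \<longlonglongrightarrow> 0"
       "(\<integral>\<^sup>+ psi. ?L psi \<partial>?G k) \<le> ennreal (C + 1)"
      if c: "0 \<le> c" and near: "\<And>v. v \<in> B1 \<Longrightarrow> 1 - \<eta> \<le> pr v n \<Longrightarrow> ?L (Dop (fb v) v) + ennreal c \<le> ?L v" for c \<eta> n k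
    proof -
      let ?q = "\<lambda>psi. 8 * \<delta> * (xvar x psi)^2 + c / 2 * indicat_real {psi. 1 - \<eta> / 2 \<le> pr psi n} psi"
      have "0 \<le> ?q psi" "?q psi \<le> 8 + c" if "psi \<in> B1" for psi
      proof -
        have "\<delta> * (xvar x psi)^2 \<le> 1" using \<delta> xb[OF that] by (intro mult_le_one) auto
        moreover have "c / 2 * indicat_real {psi. 1 - \<eta> / 2 \<le> pr psi n} psi \<le> c" using c by (auto simp: indicator_def)
        ultimately show "?q psi \<le> 8 + c" by linarith
        show "0 \<le> ?q psi" using \<delta> c by (intro add_nonneg_nonneg mult_nonneg_nonneg) auto
      qed
      moreover have "?q \<in> borel_measurable B1_borel" using xm Im by measurable
      moreover have "ennreal (pout True theta ph psi) * ?L (fullstep True theta ph fb psi)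
       + ennreal (pout False theta ph psi) * ?L (fullstep False theta ph fb psi) + ennreal (?q psi) \<le> ?L psi" if "psi \<in> B1" for psi
        unfolding x_def using \<delta>(1) opt0 near unfolding x_def
        by (intro lyap_fullstep that c) auto
      ultimately show "(\<lambda>k. integral\<^sup>L (?G k) ?q) \<longlonglongrightarrow> 0" "(\<integral>\<^sup>+ psi. ?L psi \<partial>?G k) \<le> ennreal (C + 1)"
        by (intro Gamma_decrease[OF mu fbm fb1 _ _ _ measurable_lyap L0]; blast)+
    qed
    have LG: "(\<integral>\<^sup>+ psi. ?L psi \<partial>?G k) \<le> ennreal (C + 1)" for k
      by (rule decrease(2)[of 0 0]) (use opt0 in auto)
    have var: "(\<lambda>k. integral\<^sup>L (?G k) (\<lambda>psi. (xvar x psi)^2)) \<longlonglongrightarrow> 0"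
    proof -
      have "(\<lambda>k. integral\<^sup>L (?G k) (\<lambda>psi. 8 * \<delta> * (xvar x psi)^2)) \<longlonglongrightarrow> 0"
        using decrease(1)[of 0 0] opt0 by simp
      from tendsto_mult_left[OF this, of "1 / (8 * \<delta>)"] show ?thesis using \<delta>(1) by simp
    qed
    have unst: "\<exists>\<eta>>0. (\<lambda>k. integral\<^sup>L (?G k) (indicat_real {psi. 1 - \<eta> \<le> pr psi n})) \<longlonglongrightarrow> 0"
      if n: "n \<le> N" "n \<noteq> nbar" for n
    proof -
      obtain \<eta> c a where \<eta>: "\<eta> > 0" and c: "c > 0" and a: "0 \<le> a" "a \<le> 1"
        and dr: "\<And>psi. psi \<in> B1 \<Longrightarrow> 1 - \<eta> \<le> pr psi n \<Longrightarrow> ?L (Dop a psi) + ennreal c \<le> ?L psi"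
        using d n \<delta>(1) \<delta>(3)[OF n(1)] by meson
      have "?L (Dop (fb v) v) + ennreal c \<le> ?L v" if "v \<in> B1" "1 - \<eta> \<le> pr v n" for v
      proof -
        have "?L (Dop (fb v) v) + ennreal c \<le> ?L (Dop a v) + ennreal c"
          using a by (intro add_right_mono opt that) auto
        also have "\<dots> \<le> ?L v" by (rule dr[OF that])
        finally show ?thesis .
      qed
      note lim = decrease(1)[where c=c and \<eta>=\<eta> and n=n, OF less_imp_le[OF c] this]
      let ?I = "indicat_real {psi. 1 - \<eta> / 2 \<le> pr psi n}"
      have "(\<lambda>k. integral\<^sup>L (?G k) ?I) \<longlonglongrightarrow> 0"
      proof -
        have i1: "integrable (?G k) (\<lambda>psi. (xvar x psi)^2)" for k
          using xb by (intro integrable_bounded_B1[OF pG xm, where B=1]) auto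
        have i2: "integrable (?G k) ?I" for k
          by (intro integrable_bounded_B1[OF pG Im, where B=1]) (auto simp: indicator_def)
        have eq: "integral\<^sup>L (?G k) (\<lambda>psi. 8 * \<delta> * (xvar x psi)^2 + c / 2 * ?I psi)
          = 8 * \<delta> * integral\<^sup>L (?G k) (\<lambda>psi. (xvar x psi)^2) + c / 2 * integral\<^sup>L (?G k) ?I" for k
          using i1 i2 by simp
        \<comment> \<open>The variance part is already known to vanish and is subtracted, which
          isolates the mass near |n>.\<close>
        from tendsto_diff[OF lim[unfolded eq] tendsto_mult_left[OF var, of "8 * \<delta>"]]
        have "(\<lambda>k. c / 2 * integral\<^sup>L (?G k) ?I) \<longlonglongrightarrow> 0"
          by (simp only: add_diff_cancel_left' mult_zero_right diff_zero)
        from tendsto_mult_left[OF this, of "2 / c"] show ?thesis using c by simp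
      qed
      then show ?thesis using \<eta> by (intro exI[of _ "\<eta> / 2"]) auto
    qed
    have C1: "0 \<le> C + 1" using C by simp
    have tight: "\<exists>T. \<forall>k. integral\<^sup>L (?G k) (tail T) \<le> e" if "e > 0" for e
    proof -
      obtain T where T: "nbar \<le> T" "C + 1 \<le> e * sigma_coef nbar (Suc T)" "0 < sigma_coef nbar (Suc T)"
        using large[OF \<open>e > 0\<close>] by blast
      have "integral\<^sup>L (?G k) (tail T) \<le> e" for k
        by (rule tail_integral_le[OF pG LG C1 T])
      then show ?thesis by blast
    qed
    have tailN: "integral\<^sup>L (?G k) (tail N) \<le> eps" for k
      by (rule tail_integral_le[OF pG LG C1 N])
    have compact: "\<exists>r'. strict_mono r' \<and> (\<exists>M\<in>limit_set ?G. weak_conv_B1 (?G \<circ> r \<circ> r') M)"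
      if r: "strict_mono r" for r :: "nat \<Rightarrow> nat"
    proof -
      obtain r' M where r': "strict_mono (r' :: nat \<Rightarrow> nat)" "prob_on_B1 M" "weak_conv_B1 (?G \<circ> r \<circ> r') M"
        using weak_compactness_near_fock[of ?G x, OF pG x inj tight var r] by blast
      moreover have "M \<in> limit_set ?G"
        unfolding limit_set_def using r' strict_mono_o[OF r r'(1)] by (auto simp: comp_assoc)
      ultimately show ?thesis by blast
    qed
    have "limit_set ?G \<noteq> {}" using compact[OF strict_mono_id] by blast
    moreover have "(\<forall>psi\<in>supp_B1 M. \<exists>n gam. psi = (\<lambda>m. cis gam * fock n m)) \<and>
             measure M {psi. \<exists>gam. psi = (\<lambda>m. cis gam * fock nbar m)} \<ge> 1 - eps" if Mlim: "M \<in> limit_set ?G" for M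
    proof -
      obtain r where M: "prob_on_B1 M" and r: "strict_mono r" and conv: "weak_conv_B1 (?G \<circ> r) M"
        using Mlim by (auto simp: limit_set_def)
      have sub: "(\<lambda>k. integral\<^sup>L ((?G \<circ> r) k) f) \<longlonglongrightarrow> 0" if "(\<lambda>k. integral\<^sup>L (?G k) f) \<longlonglongrightarrow> 0" for f
        using LIMSEQ_subseq_LIMSEQ[OF that r] by (simp add: o_def)
      have u: "\<exists>\<eta>>0. (\<lambda>k. integral\<^sup>L ((?G \<circ> r) k) (indicat_real {psi. 1 - \<eta> \<le> pr psi n})) \<longlonglongrightarrow> 0"
        if "n \<le> N" "n \<noteq> nbar" for n using unst[OF that] sub by blast
      have p: "prob_on_B1 ((?G \<circ> r) k)" and t: "integral\<^sup>L ((?G \<circ> r) k) (tail N) \<le> eps" for k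
        using pG tailN by simp_all
      show ?thesis
        using weak_limit_on_fock[of "?G \<circ> r" M x N eps nbar, OF conv M p x inj sub[OF var] t u] by blast
    qed
    ultimately show ?case unfolding Let_def using compact by blast
  qed
qed

end
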